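(* For every integer $d\ge 1$ and every integer $n\ge 0$, the moduli space $\mathcal{M}_{=1,n}(d)$ of planar tropical curves of degree $d$ and genus $1$ with $n$ marked unbounded edges is connected.
   Context: A metric graph consists of finitely many vertices and edges. A bounded edge connects two (not necessarily distinct) vertices and has a length $l>0$ (it is identified with $[0,l]$); an unbounded edge is attached to exactly one vertex and is identified with $[0,\infty)$. A flag is a vertex together with an edge emanating from it (a self-loop contributes two flags at its vertex); the valence of a vertex is the number of flags at it. The genus is $1+\#\{\text{bounded edges}\}-\#\{\text{vertices}\}$. An ($n$-marked) abstract tropical curve is a connected metric graph all of whose vertices have valence at least $3$, with $n$ of its unbounded edges marked and labelled $x_1,\dots,x_n$. A planar tropical curve $(\Gamma,h,x_1,\dots,x_n)$ is an $n$-marked abstract tropical curve $\Gamma$ with a map $h:\Gamma\to\mathbb{R}^2$ and an integer direction vector $v(F)\in\mathbb{Z}^2$ for each flag $F$, such that on the edge of a flag $F$ at a vertex $V$ the map is $t\mapsto h(V)+t\,v(F)$ (so the two flags of a bounded edge have opposite direction vectors), every marked unbounded edge has direction $(0,0)$, and at each vertex the sum of the direction vectors of all flags at it is $(0,0)$ (balancing condition). Bounded edges of direction $(0,0)$, in particular self-loops of direction $(0,0)$, are allowed and have positive length. Unmarked unbounded edges are indistinguishable. The curve has degree $d$ if the multiset of direction vectors of its unmarked unbounded edges consists of $(1,1),(-1,0),(0,-1)$, each occurring $d$ times. The combinatorial type of a planar tropical curve is the homeomorphism class of its marked graph together with the direction vectors of all edges. $\mathcal{M}_{=1,n}(d)$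 is the set of isomorphism classes (isometries of graphs respecting the markings and $h$) of planar tropical curves of degree $d$ and genus exactly $1$ with $n$ marked edges, and $\mathcal{M}^{\alpha}_{=1,n}(d)$ is the subset of curves of type $\alpha$. Topology: $\mathcal{M}^{\alpha}_{=1,n}(d)$ is parametrized (up to automorphisms) by the position of one vertex in $\mathbb{R}^2$ and the positive lengths of the bounded edges, subject to the linear condition that the cycle closes up (an open convex polyhedron in a real vector space); $\mathcal{M}_{=1,n}(d)$ is the union of the $\mathcal{M}^{\alpha}_{=1,n}(d)$ over all types $\alpha$, glued so that boundary points of $\mathcal{M}^{\alpha}_{=1,n}(d)$, where some lengths become $0$ while the genus stays $1$, are identified with the curves with fewer bounded edges obtained by contracting the edges of length $0$. *)

theory Defs
  imports "HOL-Analysis.Analysis" "HOL-Library.Multiset"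
begin

section \<open>Marked graphs\<close>

text \<open>
  A graph is given by its vertices and its flags: \<open>base G f\<close> is the vertex of the flag \<open>f\<close>, and
  \<open>opp G f\<close> is the other flag of the same edge if that edge is bounded, and \<open>f\<close> itself if the edge
  is unbounded.  A self-loop thus consists of two different flags with the same base.  The bounded
  edge containing \<open>f\<close> is the set \<open>{f, opp G f}\<close>, an unbounded edge is identified with its
  only flag.  Since graphs are finite and only matter up to isomorphism, vertices and flags are
  taken to be natural numbers.  The marking \<open>x\<^sub>1, \<dots>, x\<^sub>n\<close> is the list \<open>marks G\<close>.
\<close>

record marked_graph =
  verts :: "nat set"
  flags :: "nat set"
  base :: "nat \<Rightarrow> nat"
  opp :: "nat \<Rightarrow> nat"
  marks :: "nat list"

definition finite_graph :: "'a marked_graph_scheme \<Rightarrow> bool" where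
  "finite_graph G \<longleftrightarrow>
     finite (verts G) \<and> finite (flags G) \<and>
     (\<forall>f\<in>flags G. base G f \<in> verts G \<and> opp G f \<in> flags G \<and> opp G (opp G f) = f)"

definition bounded_flags :: "'a marked_graph_scheme \<Rightarrow> nat set" where
  "bounded_flags G = {f \<in> flags G. opp G f \<noteq> f}"

definition unbounded_edges :: "'a marked_graph_scheme \<Rightarrow> nat set" where
  "unbounded_edges G = {f \<in> flags G. opp G f = f}"

definition flag_edge :: "'a marked_graph_scheme \<Rightarrow> nat \<Rightarrow> nat set" where
  "flag_edge G f = {f, opp G f}"

definition bounded_edges :: "'a marked_graph_scheme \<Rightarrow> nat set set" where
  "bounded_edges G = flag_edge G ` bounded_flags G"

definition flags_at :: "'a marked_graph_scheme \<Rightarrow> nat \<Rightarrow> nat set" where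
  "flags_at G v = {f \<in> flags G. base G f = v}"

definition valence :: "'a marked_graph_scheme \<Rightarrow> nat \<Rightarrow> nat" where
  "valence G v = card (flags_at G v)"

definition genus :: "'a marked_graph_scheme \<Rightarrow> int" where
  "genus G = 1 + int (card (bounded_edges G)) - int (card (verts G))"

definition connected_graph :: "'a marked_graph_scheme \<Rightarrow> bool" where
  "connected_graph G \<longleftrightarrow>
     verts G \<noteq> {} \<and>
     (\<forall>u\<in>verts G. \<forall>v\<in>verts G.
        (u, v) \<in> {(base G f, base G (opp G f)) |f. f \<in> bounded_flags G}\<^sup>*)"


section \<open>Planar tropical curves\<close>

text \<open>
  A combinatorial type is a marked graph together with the direction vectors of its flags.
  A curve has in addition lengths of its bounded edges and a map to the plane. As
  this map is \<open>t \<mapsto> h(V) + t v(F)\<close> on the edge of each flag, it is given by the images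
  \<open>pos C V = h(V)\<close> of the vertices.
\<close>

record combinatorial_type = marked_graph +
  dir :: "nat \<Rightarrow> int \<times> int"

record curve = combinatorial_type +
  len :: "nat set \<Rightarrow> real"
  pos :: "nat \<Rightarrow> real \<times> real"

definition abstract_tropical_curve :: "nat \<Rightarrow> 'a curve_scheme \<Rightarrow> bool" where
  "abstract_tropical_curve n C \<longleftrightarrow>
     finite_graph C \<and> connected_graph C \<and> (\<forall>v\<in>verts C. 3 \<le> valence C v) \<and>
     length (marks C) = n \<and> distinct (marks C) \<and> set (marks C) \<subseteq> unbounded_edges C \<and>
     (\<forall>e\<in>bounded_edges C. 0 < len C e)"

definition real_vec :: "int \<times> int \<Rightarrow> real \<times> real" where
  "real_vec = map_prod real_of_int real_of_int"

text \<open>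
  The vertices can be placed by \<open>h\<close> and the bounded edges have lengths \<open>l\<close>: following each bounded
  edge from one of its vertices leads to the image of the other one.
\<close>

definition fits :: "'a combinatorial_type_scheme \<Rightarrow> (nat set \<Rightarrow> real) \<Rightarrow> (nat \<Rightarrow> real \<times> real) \<Rightarrow> bool" where
  "fits G l h \<longleftrightarrow>
     (\<forall>f\<in>bounded_flags G.
        h (base G (opp G f)) = h (base G f) + l (flag_edge G f) *\<^sub>R real_vec (dir G f))"

definition planar_tropical_curve :: "nat \<Rightarrow> 'a curve_scheme \<Rightarrow> bool" where
  "planar_tropical_curve n C \<longleftrightarrow>
     abstract_tropical_curve n C \<and>
     fits C (len C) (pos C) \<and>
     (\<forall>f\<in>bounded_flags C. dir C (opp C f) = - dir C f) \<and>
     (\<forall>f\<in>set (marks C). dir C f = 0) \<and>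
     (\<forall>v\<in>verts C. (\<Sum>f\<in>flags_at C v. dir C f) = 0)"

definition has_degree :: "nat \<Rightarrow> 'a curve_scheme \<Rightarrow> bool" where
  "has_degree d C \<longleftrightarrow>
     image_mset (dir C) (mset_set (unbounded_edges C - set (marks C))) =
       replicate_mset d (1, 1) + replicate_mset d (-1, 0) + replicate_mset d (0, -1)"

definition genus_one_curves :: "nat \<Rightarrow> nat \<Rightarrow> curve set" where
  "genus_one_curves n d = {C. planar_tropical_curve n C \<and> has_degree d C \<and> genus C = 1}"

text \<open>
  All vertices have valence at least 3, so an isometry maps vertices to vertices and edges to edges;
  respecting the map to the plane amounts to respecting positions and direction vectors.
\<close>

definition isomorphic :: "curve \<Rightarrow> curve \<Rightarrow> bool" where
  "isomorphic C D \<longleftrightarrow>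
     (\<exists>\<phi> \<psi>. bij_betw \<phi> (verts C) (verts D) \<and> bij_betw \<psi> (flags C) (flags D) \<and>
        (\<forall>f\<in>flags C. base D (\<psi> f) = \<phi> (base C f) \<and> opp D (\<psi> f) = \<psi> (opp C f) \<and>
           dir D (\<psi> f) = dir C f) \<and>
        marks D = map \<psi> (marks C) \<and>
        (\<forall>f\<in>bounded_flags C. len D (flag_edge D (\<psi> f)) = len C (flag_edge C f)) \<and>
        (\<forall>v\<in>verts C. pos D (\<phi> v) = pos C v))"

definition iso_rel :: "nat \<Rightarrow> nat \<Rightarrow> (curve \<times> curve) set" where
  "iso_rel n d =
     {(C, D). C \<in> genus_one_curves n d \<and> D \<in> genus_one_curves n d \<and> isomorphic C D}"

definition moduli_set :: "nat \<Rightarrow> nat \<Rightarrow> curve set set" where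
  "moduli_set n d = genus_one_curves n d // iso_rel n d"


section \<open>Contraction of edges of length zero\<close>

definition contracted_flags :: "curve \<Rightarrow> nat set" where
  "contracted_flags C = {f \<in> bounded_flags C. len C (flag_edge C f) = 0}"

text \<open>
  Vertices joined by edges of length zero become one vertex, represented by the least of them.
\<close>

definition merged_vertex :: "curve \<Rightarrow> nat \<Rightarrow> nat" where
  "merged_vertex C v =
     (LEAST w. (v, w) \<in> {(base C f, base C (opp C f)) |f. f \<in> contracted_flags C}\<^sup>*)"

definition contract :: "curve \<Rightarrow> curve" where
  "contract C =
     C\<lparr>verts := merged_vertex C ` verts C,
       flags := flags C - contracted_flags C,
       base := merged_vertex C \<circ> base C\<rparr>"


section \<open>The moduli space\<close>

definition types :: "nat \<Rightarrow> nat \<Rightarrow> combinatorial_type set" where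
  "types n d = combinatorial_type.truncate ` genus_one_curves n d"

text \<open>
  The parameters of a type \<open>\<alpha>\<close> with chosen vertex \<open>r\<close> are the position \<open>p\<close> of \<open>r\<close> and the lengths
  \<open>l\<close> of the bounded edges.  The cycle closes up iff some placement of the vertices fits
  to these data.  By connectedness it is then unique on the vertices.
\<close>

definition placement ::
    "combinatorial_type \<Rightarrow> nat \<Rightarrow> real \<times> real \<Rightarrow> (nat set \<Rightarrow> real) \<Rightarrow> nat \<Rightarrow> real \<times> real" where
  "placement \<alpha> r p l = (SOME h. h r = p \<and> fits \<alpha> l h)"

definition param_curve ::
    "combinatorial_type \<times> nat \<Rightarrow> (real \<times> real) \<times> (nat set \<Rightarrow> real) \<Rightarrow> curve" where
  "param_curve = (\<lambda>(\<alpha>, r) (p, l).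
     \<lparr>verts = verts \<alpha>, flags = flags \<alpha>, base = base \<alpha>, opp = opp \<alpha>, marks = marks \<alpha>,
      dir = dir \<alpha>, len = l, pos = placement \<alpha> r p l\<rparr>)"

text \<open>
  The polyhedron of a type together with those of its boundary points, where some lengths are
  zero, at which the genus stays 1.  Contracting preserves the other defining conditions of
  \<open>genus_one_curves\<close> once the genus is preserved (the contracted edges then form a forest, so that also
  the valences stay at least 3).  As only types of actual curves are considered, the
  polyhedron with all lengths positive is nonempty, and all points below lie in its closure.
\<close>

definition cell :: "nat \<Rightarrow> nat \<Rightarrow> combinatorial_type \<times> nat \<Rightarrow> ((real \<times> real) \<times> (nat set \<Rightarrow> real)) set" where
  "cell n d = (\<lambda>(\<alpha>, r).
     {(p, l). l \<in> extensional (bounded_edges \<alpha>) \<and>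
        (\<forall>e\<in>bounded_edges \<alpha>. 0 \<le> l e) \<and>
        (\<exists>h. h r = p \<and> fits \<alpha> l h) \<and>
        contract (param_curve (\<alpha>, r) (p, l)) \<in> genus_one_curves n d})"

definition cell_topology ::
    "nat \<Rightarrow> nat \<Rightarrow> combinatorial_type \<times> nat \<Rightarrow> ((real \<times> real) \<times> (nat set \<Rightarrow> real)) topology" where
  "cell_topology n d i =
     subtopology
       (prod_topology euclidean (product_topology (\<lambda>_. euclideanreal) (bounded_edges (fst i))))
       (cell n d i)"

text \<open>
  The gluing: in the disjoint union of all cells, points giving isomorphic curves after
  contraction are identified, and the result carries the quotient topology.  Isomorphic
  types and different choices of the vertex \<open>r\<close> are all included; they give the same
  subsets of the moduli space with the same topology.
\<close>

definition cells :: "nat \<Rightarrow> nat \<Rightarrow> ((combinatorial_type \<times> nat) \<times> (real \<times> real) \<times> (nat set \<Rightarrow> real)) topology" where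
  "cells n d = sum_topology (cell_topology n d) (SIGMA \<alpha> : types n d. verts \<alpha>)"

definition curve_class ::
    "nat \<Rightarrow> nat \<Rightarrow> (combinatorial_type \<times> nat) \<times> (real \<times> real) \<times> (nat set \<Rightarrow> real) \<Rightarrow> curve set" where
  "curve_class n d = (\<lambda>(i, x). iso_rel n d `` {contract (param_curve i x)})"

definition quotient_topology :: "'a topology \<Rightarrow> ('a \<Rightarrow> 'b) \<Rightarrow> 'b topology" where
  "quotient_topology X q =
     topology (\<lambda>U. U \<subseteq> q ` topspace X \<and> openin X {x \<in> topspace X. q x \<in> U})"

definition moduli_space :: "nat \<Rightarrow> nat \<Rightarrow> curve set topology" where
  "moduli_space n d = quotient_topology (cells n d) (curve_class n d)"


section \<open>Basic consistency facts\<close>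

lemma openin_quotient_topology:
  "openin (quotient_topology X q) U \<longleftrightarrow>
     U \<subseteq> q ` topspace X \<and> openin X {x \<in> topspace X. q x \<in> U}"
proof -
  have 1: "{x \<in> topspace X. q x \<in> S \<inter> T} = {x \<in> topspace X. q x \<in> S} \<inter> {x \<in> topspace X. q x \<in> T}" for S T
    by auto
  have 2: "{x \<in> topspace X. q x \<in> \<Union>\<K>} = (\<Union>K\<in>\<K>. {x \<in> topspace X. q x \<in> K})" for \<K>
    by auto
  have "istopology (\<lambda>U. U \<subseteq> q ` topspace X \<and> openin X {x \<in> topspace X. q x \<in> U})"
    unfolding istopology_def 1 2 by blast
  then show ?thesis
    by (simp add: quotient_topology_def)
qed

lemma quotient_map_quotient_topology: "quotient_map X (quotient_topology X q) q"
proof -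
  have "topspace (quotient_topology X q) = q ` topspace X"
  proof
    show "topspace (quotient_topology X q) \<subseteq> q ` topspace X"
      using openin_topspace[of "quotient_topology X q"] unfolding openin_quotient_topology by simp
    have "{x \<in> topspace X. q x \<in> q ` topspace X} = topspace X" by auto
    then have "openin (quotient_topology X q) (q ` topspace X)"
      by (simp add: openin_quotient_topology)
    then show "q ` topspace X \<subseteq> topspace (quotient_topology X q)"
      by (rule openin_subset)
  qed
  then show ?thesis
    by (auto simp: quotient_map_def openin_quotient_topology)
qed

lemma isomorphic_refl: "isomorphic C C"
  unfolding isomorphic_def by (rule exI[of _ id], rule exI[of _ id]) auto

lemma isomorphic_trans:
  assumes "isomorphic C D" "isomorphic D E" "finite_graph C"
  shows "isomorphic C E"
proof -
  obtain \<phi> \<psi> where 1: "bij_betw \<phi> (verts C) (verts D)" "bij_betw \<psi> (flags C) (flags D)"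
    "\<And>f. f \<in> flags C \<Longrightarrow> base D (\<psi> f) = \<phi> (base C f) \<and> opp D (\<psi> f) = \<psi> (opp C f) \<and> dir D (\<psi> f) = dir C f"
    "marks D = map \<psi> (marks C)"
    "\<And>f. f \<in> bounded_flags C \<Longrightarrow> len D (flag_edge D (\<psi> f)) = len C (flag_edge C f)"
    "\<And>v. v \<in> verts C \<Longrightarrow> pos D (\<phi> v) = pos C v"
    using assms(1) unfolding isomorphic_def by blast
  obtain \<phi>' \<psi>' where 2: "bij_betw \<phi>' (verts D) (verts E)" "bij_betw \<psi>' (flags D) (flags E)"
    "\<And>f. f \<in> flags D \<Longrightarrow> base E (\<psi>' f) = \<phi>' (base D f) \<and> opp E (\<psi>' f) = \<psi>' (opp D f) \<and> dir E (\<psi>' f) = dir D f"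
    "marks E = map \<psi>' (marks D)"
    "\<And>f. f \<in> bounded_flags D \<Longrightarrow> len E (flag_edge E (\<psi>' f)) = len D (flag_edge D f)"
    "\<And>v. v \<in> verts D \<Longrightarrow> pos E (\<phi>' v) = pos D v"
    using assms(2) unfolding isomorphic_def by blast
  have m: "\<psi> f \<in> flags D" if "f \<in> flags C" for f using 1(2) that by (auto simp: bij_betw_def)
  have v: "\<phi> f \<in> verts D" if "f \<in> verts C" for f using 1(1) that by (auto simp: bij_betw_def)
  have b: "\<psi> f \<in> bounded_flags D" if "f \<in> bounded_flags C" for f
    using that 1(3)[of f] m[of f] 1(2) assms(3)
    by (auto simp: bounded_flags_def finite_graph_def bij_betw_def inj_on_def)
  have "bij_betw (\<phi>' \<circ> \<phi>) (verts C) (verts E)" "bij_betw (\<psi>' \<circ> \<psi>) (flags C) (flags E)"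
    using bij_betw_trans[OF 1(1) 2(1)] bij_betw_trans[OF 1(2) 2(2)] .
  moreover have "\<forall>f\<in>flags C. base E ((\<psi>' \<circ> \<psi>) f) = (\<phi>' \<circ> \<phi>) (base C f) \<and>
      opp E ((\<psi>' \<circ> \<psi>) f) = (\<psi>' \<circ> \<psi>) (opp C f) \<and> dir E ((\<psi>' \<circ> \<psi>) f) = dir C f"
    using 1(3) 2(3) m by simp
  moreover have "marks E = map (\<psi>' \<circ> \<psi>) (marks C)"
    using 1(4) 2(4) by simp
  moreover have "\<forall>f\<in>bounded_flags C. len E (flag_edge E ((\<psi>' \<circ> \<psi>) f)) = len C (flag_edge C f)"
    using 1(5) 2(5) b by simp
  moreover have "\<forall>v\<in>verts C. pos E ((\<phi>' \<circ> \<phi>) v) = pos C v"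
    using 1(6) 2(6) v by simp
  ultimately show ?thesis
    unfolding isomorphic_def by blast
qed

lemma isomorphic_sym:
  assumes "isomorphic C D" "finite_graph C" "set (marks C) \<subseteq> flags C"
  shows "isomorphic D C"
proof -
  obtain \<phi> \<psi> where 1: "bij_betw \<phi> (verts C) (verts D)" "bij_betw \<psi> (flags C) (flags D)"
    "\<And>f. f \<in> flags C \<Longrightarrow> base D (\<psi> f) = \<phi> (base C f) \<and> opp D (\<psi> f) = \<psi> (opp C f) \<and> dir D (\<psi> f) = dir C f"
    "marks D = map \<psi> (marks C)"
    "\<And>f. f \<in> bounded_flags C \<Longrightarrow> len D (flag_edge D (\<psi> f)) = len C (flag_edge C f)"
    "\<And>v. v \<in> verts C \<Longrightarrow> pos D (\<phi> v) = pos C v"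
    using assms(1) unfolding isomorphic_def by blast
  define \<phi>' \<psi>' where "\<phi>' = inv_into (verts C) \<phi>" and "\<psi>' = inv_into (flags C) \<psi>"
  have inv: "\<phi>' (\<phi> v) = v" if "v \<in> verts C" for v
    using that 1(1) by (simp add: \<phi>'_def bij_betw_inv_into_left)
  have inv': "\<psi>' (\<psi> f) = f" if "f \<in> flags C" for f
    using that 1(2) by (simp add: \<psi>'_def bij_betw_inv_into_left)
  have bij: "bij_betw \<phi>' (verts D) (verts C)" "bij_betw \<psi>' (flags D) (flags C)"
    using 1(1,2) by (simp_all add: \<phi>'_def \<psi>'_def bij_betw_inv_into)
  have op: "opp C f \<in> flags C" "base C f \<in> verts C" if "f \<in> flags C" for f
    using assms(2) that by (auto simp: finite_graph_def)
  have F: "flags D = \<psi> ` flags C" and V: "verts D = \<phi> ` verts C"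
    using 1(1,2) by (auto simp: bij_betw_def)
  have B: "f \<in> bounded_flags C" if "\<psi> f \<in> bounded_flags D" "f \<in> flags C" for f
    using that 1(3)[of f] by (auto simp: bounded_flags_def)
  have B': "f \<in> flags D" if "f \<in> bounded_flags D" for f
    using that by (auto simp: bounded_flags_def)
  have "\<forall>f\<in>flags D. base C (\<psi>' f) = \<phi>' (base D f) \<and> opp C (\<psi>' f) = \<psi>' (opp D f) \<and>
           dir C (\<psi>' f) = dir D f"
    using 1(3) inv inv' op by (auto simp: F)
  moreover have "\<forall>f\<in>bounded_flags D. len C (flag_edge C (\<psi>' f)) = len D (flag_edge D f)"
    using B B' 1(5) inv' unfolding F by fastforce
  moreover have "marks C = map \<psi>' (marks D)"
    using inv' assms(3) unfolding 1(4) by (auto intro!: map_idI[symmetric] simp: subset_iff)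
  moreover have "\<forall>v\<in>verts D. pos C (\<phi>' v) = pos D v"
    using 1(6) inv by (auto simp: V)
  ultimately show ?thesis
    unfolding isomorphic_def using bij by blast
qed

lemma equiv_iso_rel: "equiv (genus_one_curves n d) (iso_rel n d)"
proof -
  have *: "finite_graph C" "set (marks C) \<subseteq> flags C" if "C \<in> genus_one_curves n d" for C
    using that by (auto simp: genus_one_curves_def planar_tropical_curve_def
        abstract_tropical_curve_def unbounded_edges_def)
  show ?thesis
  proof (rule equivI)
    show "iso_rel n d \<subseteq> genus_one_curves n d \<times> genus_one_curves n d"
      by (auto simp: iso_rel_def)
    show "refl_on (genus_one_curves n d) (iso_rel n d)"
      by (rule refl_onI) (simp add: iso_rel_def isomorphic_refl)
    show "sym (iso_rel n d)"
      by (rule symI) (use * isomorphic_sym in \<open>unfold iso_rel_def, blast\<close>)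
    show "trans (iso_rel n d)"
      by (rule transI) (use * isomorphic_trans in \<open>unfold iso_rel_def, blast\<close>)
  qed
qed

lemma fits_unique:
  assumes "connected_graph G" "fits G l h" "fits G l h'" "r \<in> verts G" "h r = h' r" "v \<in> verts G"
  shows "h v = h' v"
proof -
  have "(r, v) \<in> {(base G f, base G (opp G f)) |f. f \<in> bounded_flags G}\<^sup>*"
    using assms by (auto simp: connected_graph_def)
  then show ?thesis
    by induction (use assms in \<open>auto simp: fits_def\<close>)
qed

lemma graph_simps_truncate:
  "bounded_flags (combinatorial_type.truncate C) = bounded_flags C"
  "bounded_edges (combinatorial_type.truncate C) = bounded_edges C"
  "flag_edge (combinatorial_type.truncate C) = flag_edge C"
  "fits (combinatorial_type.truncate C) l h = fits C l h"
  for C :: curve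
  by (auto simp: combinatorial_type.defs bounded_flags_def bounded_edges_def flag_edge_def fits_def)

lemma genus_one_curves_cong:
  assumes C: "C \<in> genus_one_curves n d"
    and D: "D = \<lparr>verts = verts C, flags = flags C, base = b, opp = opp C, marks = marks C,
      dir = dir C, len = l, pos = h\<rparr>"
    and b: "\<And>f. f \<in> flags C \<Longrightarrow> b f = base C f"
    and l: "\<And>e. e \<in> bounded_edges C \<Longrightarrow> l e = len C e"
    and h: "\<And>v. v \<in> verts C \<Longrightarrow> h v = pos C v"
  shows "D \<in> genus_one_curves n d" "isomorphic C D"
proof -
  have C': "finite_graph C" using C
    by (auto simp: genus_one_curves_def planar_tropical_curve_def abstract_tropical_curve_def)
  have fl: "opp C f \<in> flags C" "base C f \<in> verts C" if "f \<in> flags C" for f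
    using C' that by (auto simp: finite_graph_def)
  have eq: "bounded_flags D = bounded_flags C" "unbounded_edges D = unbounded_edges C"
    "flag_edge D = flag_edge C" "bounded_edges D = bounded_edges C"
    by (auto simp: D bounded_flags_def unbounded_edges_def flag_edge_def bounded_edges_def)
  have at: "flags_at D v = flags_at C v" for v
    using b by (auto simp: D flags_at_def)
  have bf: "f \<in> flags C" "flag_edge C f \<in> bounded_edges C" if "f \<in> bounded_flags C" for f
    using that by (auto simp: bounded_flags_def bounded_edges_def)
  have rel: "{(base D f, base D (opp D f)) |f. f \<in> bounded_flags D} =
      {(base C f, base C (opp C f)) |f. f \<in> bounded_flags C}"
  proof -
    have "base D f = base C f \<and> base D (opp D f) = base C (opp C f)" if "f \<in> bounded_flags C" for f
      using b fl bf(1)[OF that] by (simp add: D)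
    then show ?thesis unfolding eq(1) by (intro Collect_cong ex_cong) metis
  qed
  have "finite_graph D" using C' b by (auto simp: finite_graph_def D)
  moreover have "connected_graph D \<longleftrightarrow> connected_graph C"
    unfolding connected_graph_def rel by (simp add: D)
  moreover have "fits D (len D) (pos D) \<longleftrightarrow> fits C (len C) (pos C)"
    unfolding fits_def eq by (rule ball_cong) (use b bf fl l h in \<open>auto simp: D\<close>)
  moreover have "genus D = genus C" by (simp add: genus_def eq) (simp add: D)
  moreover have "has_degree d D \<longleftrightarrow> has_degree d C"
    by (simp add: has_degree_def eq) (simp add: D)
  moreover have "(\<forall>e\<in>bounded_edges D. 0 < len D e) \<longleftrightarrow> (\<forall>e\<in>bounded_edges C. 0 < len C e)"
    unfolding eq using l by (simp add: D)
  ultimately show "D \<in> genus_one_curves n d"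
    using C unfolding genus_one_curves_def mem_Collect_eq planar_tropical_curve_def
      abstract_tropical_curve_def valence_def at eq
    by (simp add: D)
  show "isomorphic C D"
    unfolding isomorphic_def by (rule exI[of _ id], rule exI[of _ id]) (use b l h bf eq in \<open>auto simp: D\<close>)
qed

lemma topspace_cell_topology:
  "topspace (cell_topology n d i) = cell n d i"
  by (auto simp: cell_topology_def cell_def PiE_def)

lemma topspace_moduli_space: "topspace (moduli_space n d) = moduli_set n d"
proof -
  have "curve_class n d ` topspace (cells n d) = moduli_set n d"
  proof
    show "curve_class n d ` topspace (cells n d) \<subseteq> moduli_set n d"
      by (auto simp: cells_def topspace_cell_topology cell_def curve_class_def moduli_set_def
          intro!: quotientI)
    show "moduli_set n d \<subseteq> curve_class n d ` topspace (cells n d)"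
    proof
      fix X assume "X \<in> moduli_set n d"
      then obtain C where C: "C \<in> genus_one_curves n d" and X: "X = iso_rel n d `` {C}"
        by (auto simp: moduli_set_def quotient_def)
      have C': "connected_graph C" "fits C (len C) (pos C)"
        "\<And>e. e \<in> bounded_edges C \<Longrightarrow> 0 < len C e" "finite_graph C"
        using C by (auto simp: genus_one_curves_def planar_tropical_curve_def abstract_tropical_curve_def)
      then obtain r where r: "r \<in> verts C" by (auto simp: connected_graph_def)
      define \<alpha> where "\<alpha> = combinatorial_type.truncate C"
      define l where "l = restrict (len C) (bounded_edges C)"
      define D where "D = param_curve (\<alpha>, r) (pos C r, l)"
      have bf: "flag_edge C f \<in> bounded_edges C" if "f \<in> bounded_flags C" for f
        using that by (auto simp: bounded_edges_def)
      have fits: "fits C l (pos C)"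
        using C'(2) bf by (auto simp: fits_def l_def)
      then have ex: "\<exists>h. h r = pos C r \<and> fits \<alpha> l h"
        by (auto simp: \<alpha>_def graph_simps_truncate)
      from someI_ex[OF ex] have pl: "placement \<alpha> r (pos C r) l r = pos C r"
        "fits C l (placement \<alpha> r (pos C r) l)"
        by (auto simp: placement_def \<alpha>_def graph_simps_truncate)
      have pl': "placement \<alpha> r (pos C r) l v = pos C v" if "v \<in> verts C" for v
        by (rule fits_unique[OF C'(1) pl(2) fits r pl(1) that])
      have Deq: "D = \<lparr>verts = verts C, flags = flags C, base = base C, opp = opp C,
          marks = marks C, dir = dir C, len = l, pos = placement \<alpha> r (pos C r) l\<rparr>"
        by (simp add: D_def param_curve_def \<alpha>_def combinatorial_type.defs)
      have "bounded_flags D = bounded_flags C" "flag_edge D = flag_edge C"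
        by (auto simp: Deq bounded_flags_def flag_edge_def)
      then have cf: "contracted_flags D = {}"
        using C'(3) bf by (fastforce simp: contracted_flags_def Deq l_def)
      have mv: "merged_vertex D v = v" for v
        unfolding merged_vertex_def cf by (auto intro: Least_equality)
      have con: "contract D = \<lparr>verts = verts C, flags = flags C, base = base C, opp = opp C,
          marks = marks C, dir = dir C, len = l, pos = placement \<alpha> r (pos C r) l\<rparr>"
        unfolding contract_def cf by (simp add: mv o_def) (simp add: Deq)
      have mem: "contract D \<in> genus_one_curves n d" "isomorphic C (contract D)"
        by (rule genus_one_curves_cong[OF C con _ _ pl']; simp add: l_def)+
      have "(pos C r, l) \<in> cell n d (\<alpha>, r)"
        using mem(1) ex C'(3)
        unfolding D_def cell_def
        by (auto simp: \<alpha>_def graph_simps_truncate l_def[symmetric])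
          (auto simp: l_def intro: less_imp_le)
      moreover have "(\<alpha>, r) \<in> (SIGMA \<alpha> : types n d. verts \<alpha>)"
        using C r by (auto simp: types_def \<alpha>_def combinatorial_type.defs)
      moreover have "curve_class n d ((\<alpha>, r), (pos C r, l)) = X"
        unfolding X curve_class_def
        using equiv_class_eq[OF equiv_iso_rel, of C "contract D"] mem C
        by (simp add: D_def[symmetric] iso_rel_def)
      ultimately show "X \<in> curve_class n d ` topspace (cells n d)"
        by (intro image_eqI[where x = "((\<alpha>, r), (pos C r, l))"])
          (auto simp: cells_def topspace_cell_topology)
    qed
  qed
  then show ?thesis
    using quotient_map_quotient_topology[of "cells n d" "curve_class n d"]
    by (simp add: quotient_map_def moduli_space_def)
qed

end

theory Submission
  imports Defs
begin

text \<open>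
  A cell is convex, so a curve and each of its degenerations of genus one lie in one connected
  subset of the moduli space: the straight path in the parameters joins them
  (\<open>linked_degeneration\<close>).  Hence it suffices to reach one fixed connected set of curves from every curve
  by contracting edges and by undoing contractions.

  Edges off the cycle can be contracted one leaf at a time (\<open>prune_leaf\<close>), so that only a cycle with
  unbounded edges, the \<^emph>\<open>ends\<close>, at its vertices is left.  List the \<open>N\<close> ends in cyclic order and let
  \<open>v\<^sub>t\<close> be the direction of the cycle after the \<open>t\<close>-th end.  By the balancing condition
  \<open>v\<^sub>t\<close> arises from its predecessor by subtracting the direction of the \<open>t\<close>-th end: the \<open>v\<^sub>t\<close> are
  the vertices of a closed lattice path.  The cycle closes up iff \<open>\<Sum> l\<^sub>t v\<^sub>t = 0\<close> for the lengths
  \<open>l\<^sub>t \<ge> 0\<close>, where length \<open>0\<close> means that neighbouring ends share a vertex.  Such data are called a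
  necklace, and they exist for a path iff \<open>0\<close> is in the convex hull of its vertices.  The lengths possible
  for one path form a cone without its apex, which is convex, and so give curves in the same component
  (\<open>necklace_lengths_linked\<close>).  Ends at the same vertex can be permuted without changing the curve
  (\<open>reorder_block\<close>); this changes the lattice path.

  If the path passes through \<open>0\<close>, the edge of direction \<open>0\<close> alone may have positive length.  Then all ends
  sit at one vertex, their order does not matter, and all these curves are in one component.  So
  the task is to steer the path into \<open>0\<close> (\<open>reach_standard\<close>).  Let \<open>A\<close> be a vertex of the path.  As \<open>0\<close> is
  in the convex hull of the path, it is in a triangle \<open>A, B, C\<close> spanned by \<open>A\<close> and two more vertices
  (\<open>positive_relation_through\<close>), and the ends between \<open>A\<close> and \<open>B\<close> and those between \<open>C\<close> and \<open>A\<close> may be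
  permuted as long as the three vertices stay.  Write \<open>A = b f - a e\<close> with two of the end directions
  \<open>(1,1), (-1,0), (0,-1)\<close> and \<open>a, b \<ge> 0\<close>.  An end of direction \<open>f\<close> between \<open>A\<close> and \<open>B\<close> (if \<open>b > 0\<close>), or one of
  direction \<open>e\<close> between \<open>C\<close> and \<open>A\<close> (if \<open>a > 0\<close>), can be moved next to \<open>A\<close>, which produces the path vertex
  \<open>A - f\<close> or \<open>A + e\<close> with smaller \<open>a + b\<close>.  If \<open>b = 0\<close>, two ends with the two directions other than \<open>e\<close>
  between \<open>A\<close> and \<open>B\<close> serve as well, since these directions add up to \<open>-e\<close>; similarly if \<open>a = 0\<close>.  If none of
  this applies, then, after exchanging the roles of directions if \<open>a\<close> or \<open>b\<close> is \<open>0\<close>, the linear form with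
  value \<open>-1\<close> at \<open>e\<close>, \<open>1\<close> at \<open>f\<close> and \<open>0\<close> at the third direction is positive at \<open>A\<close>, \<open>B\<close> and \<open>C\<close>
  (\<open>no_cut_relation\<close>), so \<open>0\<close> is not in the triangle.
\<close>

section \<open>Isomorphic curves\<close>

lemma genus_one_curves_imp:
  assumes "C \<in> genus_one_curves n d"
  shows "finite_graph C" "connected_graph C" "set (marks C) \<subseteq> flags C"
    "fits C (len C) (pos C)" "\<And>e. e \<in> bounded_edges C \<Longrightarrow> 0 < len C e"
  using assms by (auto simp: genus_one_curves_def planar_tropical_curve_def
      abstract_tropical_curve_def unbounded_edges_def)

lemma genus_one_curves_isomorphic:
  assumes C: "C \<in> genus_one_curves n d" and iso: "isomorphic C D"
  shows "D \<in> genus_one_curves n d"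
proof -
  obtain \<phi> \<psi> where 1: "bij_betw \<phi> (verts C) (verts D)" "bij_betw \<psi> (flags C) (flags D)"
    "\<And>f. f \<in> flags C \<Longrightarrow> base D (\<psi> f) = \<phi> (base C f) \<and> opp D (\<psi> f) = \<psi> (opp C f) \<and> dir D (\<psi> f) = dir C f"
    "marks D = map \<psi> (marks C)"
    "\<And>f. f \<in> bounded_flags C \<Longrightarrow> len D (flag_edge D (\<psi> f)) = len C (flag_edge C f)"
    "\<And>v. v \<in> verts C \<Longrightarrow> pos D (\<phi> v) = pos C v"
    using iso unfolding isomorphic_def by blast
  note C' = C[unfolded genus_one_curves_def mem_Collect_eq planar_tropical_curve_def abstract_tropical_curve_def]
  have fin: "finite_graph C" using C' by blast
  have cl: "opp C f \<in> flags C" "base C f \<in> verts C" "opp C (opp C f) = f" if "f \<in> flags C" for f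
    using fin that by (auto simp: finite_graph_def)
  have V: "verts D = \<phi> ` verts C" and F: "flags D = \<psi> ` flags C"
    and injV: "inj_on \<phi> (verts C)" and injF: "inj_on \<psi> (flags C)"
    using 1(1,2) by (auto simp: bij_betw_def)
  have inj: "\<psi> f = \<psi> g \<longleftrightarrow> f = g" if "f \<in> flags C" "g \<in> flags C" for f g
    using injF that by (auto simp: inj_on_def)
  have inj': "\<phi> f = \<phi> g \<longleftrightarrow> f = g" if "f \<in> verts C" "g \<in> verts C" for f g
    using injV that by (auto simp: inj_on_def)
  have BF: "bounded_flags D = \<psi> ` bounded_flags C"
    using 1(3) cl inj by (auto simp: bounded_flags_def F)
  have UE: "unbounded_edges D = \<psi> ` unbounded_edges C"
    using 1(3) cl inj by (auto simp: unbounded_edges_def F)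
  have bsub: "bounded_flags C \<subseteq> flags C" and usub: "unbounded_edges C \<subseteq> flags C"
    by (auto simp: bounded_flags_def unbounded_edges_def)
  have FE: "flag_edge D (\<psi> f) = \<psi> ` flag_edge C f" if "f \<in> flags C" for f
    using 1(3) that by (auto simp: flag_edge_def)
  have BE: "bounded_edges D = (\<lambda>e. \<psi> ` e) ` bounded_edges C"
    unfolding bounded_edges_def BF image_image by (rule image_cong) (use FE bsub in auto)
  have besub: "e \<subseteq> flags C" if "e \<in> bounded_edges C" for e
    using that cl bsub by (auto simp: bounded_edges_def flag_edge_def)
  have injE: "inj_on (\<lambda>e. \<psi> ` e) (bounded_edges C)"
    using besub injF by (auto simp: inj_on_def inj_on_image_eq_iff)
  have FA: "flags_at D (\<phi> v) = \<psi> ` flags_at C v" if "v \<in> verts C" for v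
    using 1(3) cl inj' that by (auto simp: flags_at_def F)
  have fasub: "flags_at C v \<subseteq> flags C" for v by (auto simp: flags_at_def)
  have "finite_graph D"
    using fin 1(3) cl by (auto simp: finite_graph_def V F)
  moreover have "connected_graph D"
    unfolding connected_graph_def
  proof (intro conjI ballI)
    show "verts D \<noteq> {}" using C' by (auto simp: V connected_graph_def)
    fix u v assume "u \<in> verts D" "v \<in> verts D"
    then obtain u' v' where uv: "u = \<phi> u'" "v = \<phi> v'" "u' \<in> verts C" "v' \<in> verts C" by (auto simp: V)
    then have "(u', v') \<in> {(base C f, base C (opp C f)) |f. f \<in> bounded_flags C}\<^sup>*"
      using C' by (auto simp: connected_graph_def)
    then have "(\<phi> u', \<phi> v') \<in> {(base D f, base D (opp D f)) |f. f \<in> bounded_flags D}\<^sup>*"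
    proof induction
      case (step y z)
      then obtain f where f: "f \<in> bounded_flags C" "y = base C f" "z = base C (opp C f)" by auto
      then have "f \<in> flags C" using bsub by auto
      then have "\<phi> y = base D (\<psi> f)" "\<phi> z = base D (opp D (\<psi> f))" "\<psi> f \<in> bounded_flags D"
        using f 1(3) cl BF by auto
      then have "(\<phi> y, \<phi> z) \<in> {(base D f, base D (opp D f)) |f. f \<in> bounded_flags D}" by blast
      then show ?case using step.IH by (rule rtrancl_into_rtrancl[rotated])
    qed simp
    then show "(u, v) \<in> {(base D f, base D (opp D f)) |f. f \<in> bounded_flags D}\<^sup>*"
      by (simp add: uv)
  qed
  moreover have "\<forall>v\<in>verts D. 3 \<le> valence D v"
    using C' FA fasub injF by (auto simp: V valence_def card_image inj_on_subset)
  moreover have "length (marks D) = n" "distinct (marks D)" "set (marks D) \<subseteq> unbounded_edges D"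
    using C' usub injF by (auto simp: 1(4) UE distinct_map intro: inj_on_subset)
  moreover have "\<forall>e\<in>bounded_edges D. 0 < len D e"
  proof
    fix e assume "e \<in> bounded_edges D"
    then obtain f where f: "f \<in> bounded_flags C" "e = flag_edge D (\<psi> f)"
      using BF by (auto simp: bounded_edges_def)
    then have "len D e = len C (flag_edge C f)" using 1(5) by simp
    moreover have "flag_edge C f \<in> bounded_edges C" using f by (auto simp: bounded_edges_def)
    ultimately show "0 < len D e" using C' by auto
  qed
  moreover have "fits D (len D) (pos D)"
    unfolding fits_def BF
  proof (rule, clarify)
    fix f assume f: "f \<in> bounded_flags C"
    then have "f \<in> flags C" using bsub by auto
    then show "pos D (base D (opp D (\<psi> f))) =
         pos D (base D (\<psi> f)) + len D (flag_edge D (\<psi> f)) *\<^sub>R real_vec (dir D (\<psi> f))"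
      using C' f 1(3,5,6) cl unfolding fits_def by simp
  qed
  moreover have "\<forall>f\<in>bounded_flags D. dir D (opp D f) = - dir D f"
    using C' 1(3) bsub cl by (auto simp: BF subset_iff)
  moreover have "\<forall>f\<in>set (marks D). dir D f = 0"
    using C' 1(3) usub by (auto simp: 1(4))
  moreover have "\<forall>v\<in>verts D. (\<Sum>f\<in>flags_at D v. dir D f) = 0"
  proof (clarsimp simp: V)
    fix v assume v: "v \<in> verts C"
    have "(\<Sum>f\<in>flags_at D (\<phi> v). dir D f) = (\<Sum>f\<in>flags_at C v. dir D (\<psi> f))"
      unfolding FA[OF v] using inj_on_subset[OF injF fasub] by (simp add: sum.reindex)
    also have "\<dots> = (\<Sum>f\<in>flags_at C v. dir C f)"
      by (rule sum.cong) (use 1(3) fasub in auto)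
    finally show "(\<Sum>f\<in>flags_at D (\<phi> v). dir D f) = 0" using C' v by auto
  qed
  moreover have "has_degree d D"
  proof -
    have "unbounded_edges D - set (marks D) = \<psi> ` (unbounded_edges C - set (marks C))"
      unfolding UE 1(4) set_map using inj_on_image_set_diff[OF injF, of "unbounded_edges C" "set (marks C)"] usub C' by auto
    moreover have "mset_set (\<psi> ` (unbounded_edges C - set (marks C)))
        = image_mset \<psi> (mset_set (unbounded_edges C - set (marks C)))"
      by (rule image_mset_mset_set[symmetric]) (rule inj_on_subset[OF injF], use usub in auto)
    moreover have "image_mset (dir D \<circ> \<psi>) (mset_set (unbounded_edges C - set (marks C)))
       = image_mset (dir C) (mset_set (unbounded_edges C - set (marks C)))"
      using usub 1(3) fin finite_subset[OF usub] by (intro image_mset_cong) (auto simp: finite_graph_def)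
    ultimately show ?thesis using C' by (simp add: has_degree_def multiset.map_comp)
  qed
  moreover have "genus D = 1"
    using C' by (simp add: genus_def BE V card_image[OF injE] card_image[OF injV])
  ultimately show ?thesis
    unfolding genus_one_curves_def planar_tropical_curve_def abstract_tropical_curve_def by simp
qed


section \<open>Collapsing\<close>

definition contracted_rel :: "curve \<Rightarrow> (nat \<times> nat) set" where
  "contracted_rel C = {(base C f, base C (opp C f)) |f. f \<in> contracted_flags C}"

lemma contracted_flags_opp:
  assumes "finite_graph C" "f \<in> contracted_flags C"
  shows "opp C f \<in> contracted_flags C"
  using assms by (auto simp: contracted_flags_def bounded_flags_def finite_graph_def flag_edge_def insert_commute)

lemma sym_contracted_rel:
  assumes "finite_graph C"
  shows "sym ((contracted_rel C)\<^sup>*)"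
proof (rule sym_rtrancl, rule symI)
  fix u v assume "(u, v) \<in> contracted_rel C"
  then obtain f where f: "f \<in> contracted_flags C" "u = base C f" "v = base C (opp C f)"
    by (auto simp: contracted_rel_def)
  then have "opp C (opp C f) = f" using assms
    by (auto simp: contracted_flags_def bounded_flags_def finite_graph_def)
  with f contracted_flags_opp[OF assms f(1)] show "(v, u) \<in> contracted_rel C"
    unfolding contracted_rel_def by force
qed

lemma contracted_rel_merged: "(v, merged_vertex C v) \<in> (contracted_rel C)\<^sup>*"
  unfolding merged_vertex_def contracted_rel_def by (rule LeastI[of _ v]) simp

lemma merged_vertex_eq_iff:
  assumes "finite_graph C"
  shows "merged_vertex C u = merged_vertex C v \<longleftrightarrow> (u, v) \<in> (contracted_rel C)\<^sup>*"
proof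
  assume eq: "merged_vertex C u = merged_vertex C v"
  have "(merged_vertex C v, v) \<in> (contracted_rel C)\<^sup>*"
    using contracted_rel_merged sym_contracted_rel[OF assms] by (metis symD)
  then show "(u, v) \<in> (contracted_rel C)\<^sup>*"
    using contracted_rel_merged[of u C] eq by (metis rtrancl_trans)
next
  assume uv: "(u, v) \<in> (contracted_rel C)\<^sup>*"
  then have "(v, u) \<in> (contracted_rel C)\<^sup>*" using sym_contracted_rel[OF assms] by (metis symD)
  with uv have "(u, w) \<in> (contracted_rel C)\<^sup>* \<longleftrightarrow> (v, w) \<in> (contracted_rel C)\<^sup>*" for w
    by (metis rtrancl_trans)
  then show "merged_vertex C u = merged_vertex C v"
    by (simp add: merged_vertex_def contracted_rel_def)
qed

lemma merged_vertex_idem: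
  assumes "finite_graph C"
  shows "merged_vertex C (merged_vertex C v) = merged_vertex C v"
  using contracted_rel_merged merged_vertex_eq_iff[OF assms] by metis

lemma contracted_rel_verts:
  assumes "finite_graph C" "(u, v) \<in> (contracted_rel C)\<^sup>*" "u \<in> verts C"
  shows "v \<in> verts C"
  using assms(2)
  by induction (use assms in \<open>auto simp: contracted_rel_def contracted_flags_def bounded_flags_def finite_graph_def\<close>)

lemma merged_vertex_verts:
  assumes "finite_graph C" "v \<in> verts C"
  shows "merged_vertex C v \<in> verts C"
  using contracted_rel_verts[OF assms(1) contracted_rel_merged assms(2)] .

lemma fits_merged:
  assumes "fits C (len C) h"
  shows "h (merged_vertex C v) = h v"
proof -
  have "h w = h v" if "(v, w) \<in> (contracted_rel C)\<^sup>*" for w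
    using that by induction (use assms in \<open>auto simp: contracted_rel_def contracted_flags_def fits_def\<close>)
  then show ?thesis using contracted_rel_merged by blast
qed

lemma contract_simps [simp]:
  "verts (contract C) = merged_vertex C ` verts C"
  "flags (contract C) = flags C - contracted_flags C"
  "base (contract C) = merged_vertex C \<circ> base C"
  "opp (contract C) = opp C" "marks (contract C) = marks C" "dir (contract C) = dir C"
  "len (contract C) = len C" "pos (contract C) = pos C" "flag_edge (contract C) = flag_edge C"
  by (auto simp: contract_def flag_edge_def)

lemma bounded_flags_contract: "bounded_flags (contract C) = bounded_flags C - contracted_flags C"
  and unbounded_edges_contract: "unbounded_edges (contract C) = unbounded_edges C"
  by (auto simp: bounded_flags_def unbounded_edges_def contracted_flags_def)

lemma finite_graph_contract:
  assumes "finite_graph C" shows "finite_graph (contract C)"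
  using assms contracted_flags_opp[OF assms]
  by (auto simp: finite_graph_def) (metis assms contracted_flags_opp)

text \<open>
  An explicit description of a curve \<open>D\<close> that \<open>F\<close> becomes by contraction.  It frees comparisons of
  curves from the representatives of merged vertices that \<open>contract\<close> chooses.
\<close>

definition collapse :: "curve \<Rightarrow> curve \<Rightarrow> bool" where
  "collapse F D \<longleftrightarrow>
     (\<exists>\<phi> \<psi>. \<phi> ` verts F = verts D \<and>
        (\<forall>u\<in>verts F. \<forall>v\<in>verts F. \<phi> u = \<phi> v \<longleftrightarrow> (u, v) \<in> (contracted_rel F)\<^sup>*) \<and>
        bij_betw \<psi> (flags F - contracted_flags F) (flags D) \<and>
        (\<forall>f\<in>flags F - contracted_flags F. base D (\<psi> f) = \<phi> (base F f) \<and> opp D (\<psi> f) = \<psi> (opp F f) \<and>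
           dir D (\<psi> f) = dir F f) \<and>
        marks D = map \<psi> (marks F) \<and>
        (\<forall>f\<in>bounded_flags F - contracted_flags F. len D (flag_edge D (\<psi> f)) = len F (flag_edge F f)) \<and>
        (\<forall>v\<in>verts F. pos D (\<phi> v) = pos F v))"

lemma collapse_isomorphic:
  assumes "finite_graph F" "collapse F D"
  shows "isomorphic (contract F) D"
proof -
  obtain \<phi> \<psi> where 1: "\<phi> ` verts F = verts D"
    "\<And>u v. u \<in> verts F \<Longrightarrow> v \<in> verts F \<Longrightarrow> \<phi> u = \<phi> v \<longleftrightarrow> (u, v) \<in> (contracted_rel F)\<^sup>*"
    "bij_betw \<psi> (flags F - contracted_flags F) (flags D)"
    "\<And>f. f \<in> flags F - contracted_flags F \<Longrightarrow> base D (\<psi> f) = \<phi> (base F f) \<and> opp D (\<psi> f) = \<psi> (opp F f) \<and>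
           dir D (\<psi> f) = dir F f"
    "marks D = map \<psi> (marks F)"
    "\<forall>f\<in>bounded_flags F - contracted_flags F. len D (flag_edge D (\<psi> f)) = len F (flag_edge F f)"
    "\<And>v. v \<in> verts F \<Longrightarrow> pos D (\<phi> v) = pos F v"
    using assms(2) unfolding collapse_def by blast
  have m: "\<phi> (merged_vertex F v) = \<phi> v" if "v \<in> verts F" for v
    using 1(2)[of v "merged_vertex F v"] that merged_vertex_verts[OF assms(1) that] contracted_rel_merged by metis
  have "bij_betw \<phi> (merged_vertex F ` verts F) (verts D)"
  proof (rule bij_betw_imageI)
    show "\<phi> ` merged_vertex F ` verts F = verts D"
      using m by (auto simp: 1(1)[symmetric] image_image)
    show "inj_on \<phi> (merged_vertex F ` verts F)"
      using m 1(2) merged_vertex_eq_iff[OF assms(1)] by (auto intro!: inj_onI)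
  qed
  moreover have "base D (\<psi> f) = \<phi> (merged_vertex F (base F f))" if "f \<in> flags F - contracted_flags F" for f
    using 1(4)[OF that] m[of "base F f"] that assms(1) by (auto simp: finite_graph_def)
  moreover have "pos D (\<phi> (merged_vertex F v)) = pos F (merged_vertex F v)" if "v \<in> verts F" for v
    using merged_vertex_verts[OF assms(1) that] 1(7) by auto
  ultimately show ?thesis unfolding isomorphic_def
    by (intro exI[of _ \<phi>] exI[of _ \<psi>]) (use 1 in \<open>auto simp: bounded_flags_contract\<close>)
qed

lemma collapse_contract:
  assumes "finite_graph F" "fits F (len F) (pos F)"
  shows "collapse F (contract F)"
  unfolding collapse_def
  by (rule exI[of _ "merged_vertex F"], rule exI[of _ id])
    (use merged_vertex_eq_iff[OF assms(1)] fits_merged[OF assms(2)] in auto)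

lemma isomorphic_collapse:
  assumes iso: "isomorphic F F'" and fin: "finite_graph F" "finite_graph F'" and c: "collapse F' D"
    and mk: "set (marks F) \<subseteq> unbounded_edges F"
  shows "collapse F D"
proof -
  obtain \<phi> \<psi> where 1: "bij_betw \<phi> (verts F) (verts F')" "bij_betw \<psi> (flags F) (flags F')"
    "\<And>f. f \<in> flags F \<Longrightarrow> base F' (\<psi> f) = \<phi> (base F f) \<and> opp F' (\<psi> f) = \<psi> (opp F f) \<and> dir F' (\<psi> f) = dir F f"
    "marks F' = map \<psi> (marks F)"
    "\<And>f. f \<in> bounded_flags F \<Longrightarrow> len F' (flag_edge F' (\<psi> f)) = len F (flag_edge F f)"
    "\<And>v. v \<in> verts F \<Longrightarrow> pos F' (\<phi> v) = pos F v"
    using iso unfolding isomorphic_def by blast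
  obtain \<phi>' \<psi>' where 2: "\<phi>' ` verts F' = verts D"
    "\<And>u v. u \<in> verts F' \<Longrightarrow> v \<in> verts F' \<Longrightarrow> \<phi>' u = \<phi>' v \<longleftrightarrow> (u, v) \<in> (contracted_rel F')\<^sup>*"
    "bij_betw \<psi>' (flags F' - contracted_flags F') (flags D)"
    "\<And>f. f \<in> flags F' - contracted_flags F' \<Longrightarrow> base D (\<psi>' f) = \<phi>' (base F' f) \<and> opp D (\<psi>' f) = \<psi>' (opp F' f) \<and>
           dir D (\<psi>' f) = dir F' f"
    "marks D = map \<psi>' (marks F')"
    "\<forall>f\<in>bounded_flags F' - contracted_flags F'. len D (flag_edge D (\<psi>' f)) = len F' (flag_edge F' f)"
    "\<And>v. v \<in> verts F' \<Longrightarrow> pos D (\<phi>' v) = pos F' v"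
    using c unfolding collapse_def by blast
  have cl: "opp F f \<in> flags F" "base F f \<in> verts F" if "f \<in> flags F" for f
    using fin that by (auto simp: finite_graph_def)
  have V: "verts F' = \<phi> ` verts F" and Fl: "flags F' = \<psi> ` flags F"
    and injV: "inj_on \<phi> (verts F)" and injF: "inj_on \<psi> (flags F)"
    using 1(1,2) by (auto simp: bij_betw_def)
  have inj: "\<psi> f = \<psi> g \<longleftrightarrow> f = g" if "f \<in> flags F" "g \<in> flags F" for f g
    using injF that by (auto simp: inj_on_def)
  have inj': "\<phi> f = \<phi> g \<longleftrightarrow> f = g" if "f \<in> verts F" "g \<in> verts F" for f g
    using injV that by (auto simp: inj_on_def)
  have B: "\<psi> f \<in> bounded_flags F' \<longleftrightarrow> f \<in> bounded_flags F" if "f \<in> flags F" for f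
    using 1(3) cl inj that by (auto simp: bounded_flags_def Fl)
  have Z: "\<psi> f \<in> contracted_flags F' \<longleftrightarrow> f \<in> contracted_flags F" if "f \<in> flags F" for f
    using B[OF that] 1(5) by (auto simp: contracted_flags_def)
  have Zs: "contracted_flags F' = \<psi> ` contracted_flags F"
  proof
    show "contracted_flags F' \<subseteq> \<psi> ` contracted_flags F"
    proof
      fix x assume x: "x \<in> contracted_flags F'"
      then have "x \<in> flags F'" by (auto simp: contracted_flags_def bounded_flags_def)
      then obtain f where "f \<in> flags F" "x = \<psi> f" by (auto simp: Fl)
      then show "x \<in> \<psi> ` contracted_flags F" using x Z by auto
    qed
  qed (use Z in \<open>auto simp: contracted_flags_def bounded_flags_def\<close>)
  have zsub: "contracted_flags F \<subseteq> flags F" by (auto simp: contracted_flags_def bounded_flags_def)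
  have R: "contracted_rel F' = {(\<phi> u, \<phi> v) |u v. (u, v) \<in> contracted_rel F}"
  proof -
    have "base F' (\<psi> f) = \<phi> (base F f) \<and> base F' (opp F' (\<psi> f)) = \<phi> (base F (opp F f))"
      if "f \<in> contracted_flags F" for f
      using 1(3) cl zsub that by auto
    then have "contracted_rel F' = (\<lambda>f. (\<phi> (base F f), \<phi> (base F (opp F f)))) ` contracted_flags F"
      unfolding contracted_rel_def Zs Setcompr_eq_image image_image by (intro image_cong) auto
    then show ?thesis unfolding contracted_rel_def by blast
  qed
  have to: "(\<phi> u, \<phi> v) \<in> (contracted_rel F')\<^sup>*" if "(u, v) \<in> (contracted_rel F)\<^sup>*" for u v
    using that
  proof induction
    case (step y z)
    then have "(\<phi> y, \<phi> z) \<in> contracted_rel F'" unfolding R by blast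
    then show ?case using step.IH by (rule rtrancl_into_rtrancl[rotated])
  qed simp
  have from_aux: "\<exists>v \<in> verts F. y = \<phi> v \<and> (u, v) \<in> (contracted_rel F)\<^sup>*"
    if "(\<phi> u, y) \<in> (contracted_rel F')\<^sup>*" "u \<in> verts F" for u y
    using that(1)
  proof induction
    case base then show ?case using that by auto
  next
    case (step y z)
    then obtain v where v: "v \<in> verts F" "y = \<phi> v" "(u, v) \<in> (contracted_rel F)\<^sup>*" by auto
    obtain a b where ab: "(a, b) \<in> contracted_rel F" "y = \<phi> a" "z = \<phi> b" using step(2) unfolding R by auto
    have "a \<in> verts F" "b \<in> verts F"
      using ab(1) cl zsub by (auto simp: contracted_rel_def subset_iff)
    then have "a = v" using inj' v ab by auto
    then have "(u, b) \<in> (contracted_rel F)\<^sup>*" using v(3) ab(1) by (metis rtrancl_into_rtrancl)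
    then show ?case using ab(3) \<open>b \<in> verts F\<close> by blast
  qed
  have rel: "(\<phi> u, \<phi> v) \<in> (contracted_rel F')\<^sup>* \<longleftrightarrow> (u, v) \<in> (contracted_rel F)\<^sup>*"
    if "u \<in> verts F" "v \<in> verts F" for u v
    using to from_aux[of u "\<phi> v"] inj' that by metis
  have bij: "bij_betw \<psi> (flags F - contracted_flags F) (flags F' - contracted_flags F')"
    using inj_on_image_set_diff[OF injF, of "flags F" "contracted_flags F"] zsub injF
    by (auto intro!: bij_betw_imageI intro: inj_on_subset simp: Fl Zs)
  have in': "\<psi> f \<in> flags F' - contracted_flags F'" if "f \<in> flags F - contracted_flags F" for f
    using bij that by (auto simp: bij_betw_def)
  show ?thesis unfolding collapse_def
  proof (rule exI[of _ "\<phi>' \<circ> \<phi>"], rule exI[of _ "\<psi>' \<circ> \<psi>"], intro conjI ballI)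
    show "(\<phi>' \<circ> \<phi>) ` verts F = verts D" using 2(1) V by (simp add: image_comp)
    show "((\<phi>' \<circ> \<phi>) u = (\<phi>' \<circ> \<phi>) v) = ((u, v) \<in> (contracted_rel F)\<^sup>*)" if "u \<in> verts F" "v \<in> verts F" for u v
      using 2(2)[of "\<phi> u" "\<phi> v"] rel that V by auto
    show "bij_betw (\<psi>' \<circ> \<psi>) (flags F - contracted_flags F) (flags D)"
      using bij_betw_trans[OF bij 2(3)] .
    fix f assume f: "f \<in> flags F - contracted_flags F"
    show "base D ((\<psi>' \<circ> \<psi>) f) = (\<phi>' \<circ> \<phi>) (base F f)" "opp D ((\<psi>' \<circ> \<psi>) f) = (\<psi>' \<circ> \<psi>) (opp F f)"
      "dir D ((\<psi>' \<circ> \<psi>) f) = dir F f"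
      using 2(4)[OF in'[OF f]] 1(3) f by auto
  next
    show "marks D = map (\<psi>' \<circ> \<psi>) (marks F)" by (simp add: 2(5) 1(4))
  next
    fix f assume f: "f \<in> bounded_flags F - contracted_flags F"
    then have "f \<in> flags F" by (auto simp: bounded_flags_def)
    then have "\<psi> f \<in> bounded_flags F' - contracted_flags F'" using f B Z by auto
    then show "len D (flag_edge D ((\<psi>' \<circ> \<psi>) f)) = len F (flag_edge F f)"
      using 2(6) 1(5) f by auto
  next
    fix v assume "v \<in> verts F"
    then show "pos D ((\<phi>' \<circ> \<phi>) v) = pos F v" using 2(7) 1(6) V by auto
  qed
qed

text \<open>
  Contracting in two stages gives the same curve as contracting at once, provided that the edges contracted
  in the first stage are among those contracted at once.
\<close>

lemma contract_relengthen:
  fixes C :: curve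
  assumes fin: "finite_graph C" and fits: "fits C l h"
    and z: "\<And>e. e \<in> bounded_edges C \<Longrightarrow> len C e = 0 \<Longrightarrow> l e = 0"
  shows "fits (contract C) l h"
    "collapse ((contract C)\<lparr>len := l, pos := h\<rparr>) (contract (C\<lparr>len := l, pos := h\<rparr>))"
proof -
  define C' where "C' = C\<lparr>len := l, pos := h\<rparr>"
  define D where "D = (contract C)\<lparr>len := l, pos := h\<rparr>"
  have C's [simp]: "verts C' = verts C" "flags C' = flags C" "base C' = base C" "opp C' = opp C"
    "marks C' = marks C" "dir C' = dir C" "len C' = l" "pos C' = h" "flag_edge C' = flag_edge C"
    "bounded_flags C' = bounded_flags C"
    by (auto simp: C'_def flag_edge_def bounded_flags_def)
  have Ds [simp]: "verts D = merged_vertex C ` verts C" "flags D = flags C - contracted_flags C"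
    "base D = merged_vertex C \<circ> base C" "opp D = opp C" "marks D = marks C" "dir D = dir C"
    "len D = l" "pos D = h" "flag_edge D = flag_edge C"
    "bounded_flags D = bounded_flags C - contracted_flags C"
    using bounded_flags_contract[of C] by (auto simp: D_def flag_edge_def bounded_flags_def)
  have fin': "finite_graph C'" using fin by (simp add: finite_graph_def)
  have fits': "fits C' (len C') h" using fits by (simp add: fits_def)
  have Z: "contracted_flags C \<subseteq> contracted_flags C'"
    using z by (auto simp: contracted_flags_def bounded_edges_def)
  then have RR: "contracted_rel C \<subseteq> contracted_rel C'"
    by (auto simp: contracted_rel_def)
  have mm: "merged_vertex C' (merged_vertex C v) = merged_vertex C' v" for v
    using contracted_rel_merged[of v C] rtrancl_mono[OF RR] merged_vertex_eq_iff[OF fin'] by (metis subsetD)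
  have h: "h (merged_vertex C v) = h v" for v
    using mm fits_merged[OF fits'] by metis
  show fits_con: "fits (contract C) l h"
    using fits h by (auto simp: fits_def bounded_flags_contract)
  have ZD: "contracted_flags D = contracted_flags C' - contracted_flags C"
    by (auto simp: contracted_flags_def)
  have fwd: "(merged_vertex C u, merged_vertex C v) \<in> (contracted_rel D)\<^sup>*"
    if "(u, v) \<in> (contracted_rel C')\<^sup>*" for u v
    using that
  proof induction
    case (step y z)
    then obtain f where f: "f \<in> contracted_flags C'" "y = base C f" "z = base C (opp C f)"
      by (auto simp: contracted_rel_def)
    show ?case
    proof (cases "f \<in> contracted_flags C")
      case True
      then have "(y, z) \<in> contracted_rel C" using f by (auto simp: contracted_rel_def)
      then have "merged_vertex C y = merged_vertex C z" using merged_vertex_eq_iff[OF fin] by blast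
      then show ?thesis using step.IH by simp
    next
      case False
      then have "(merged_vertex C y, merged_vertex C z) \<in> contracted_rel D"
        using f unfolding contracted_rel_def ZD by force
      then show ?thesis using step.IH by (rule rtrancl_into_rtrancl[rotated])
    qed
  qed simp
  have bwd: "merged_vertex C' u = merged_vertex C' v" if "(u, v) \<in> (contracted_rel D)\<^sup>*" for u v
    using that
  proof induction
    case (step y z)
    then obtain f where f: "f \<in> contracted_flags C'" "y = merged_vertex C (base C f)" "z = merged_vertex C (base C (opp C f))"
      by (auto simp: contracted_rel_def ZD)
    then have "(base C f, base C (opp C f)) \<in> contracted_rel C'" by (auto simp: contracted_rel_def)
    then have "merged_vertex C' (base C f) = merged_vertex C' (base C (opp C f))"
      using merged_vertex_eq_iff[OF fin'] by blast
    then show ?case using step.IH f mm by simp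
  qed simp
  have fwd': "(u, v) \<in> (contracted_rel D)\<^sup>*"
    if "merged_vertex C' u = merged_vertex C' v" "u \<in> verts D" "v \<in> verts D" for u v
  proof -
    have "merged_vertex C u = u" "merged_vertex C v = v" using that(2,3) merged_vertex_idem[OF fin] by auto
    moreover have "(u, v) \<in> (contracted_rel C')\<^sup>*" using that(1) merged_vertex_eq_iff[OF fin'] by simp
    ultimately show ?thesis using fwd[of u v] by simp
  qed
  have "collapse D (contract C')"
    unfolding collapse_def
  proof (rule exI[of _ "merged_vertex C'"], rule exI[of _ id], intro conjI ballI)
    show "merged_vertex C' ` verts D = verts (contract C')" by (simp add: image_image mm)
    show "(merged_vertex C' u = merged_vertex C' v) = ((u, v) \<in> (contracted_rel D)\<^sup>*)"
      if "u \<in> verts D" "v \<in> verts D" for u v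
      using fwd'[OF _ that] bwd by blast
    have "flags D - contracted_flags D = flags (contract C')" using ZD Z by auto
    then show "bij_betw id (flags D - contracted_flags D) (flags (contract C'))" by (simp only: bij_betw_id_iff)
    show "pos (contract C') (merged_vertex C' v) = pos D v" if "v \<in> verts D" for v
      using fits_merged[OF fits', of v] by simp
  qed (simp_all add: mm)
  then show "collapse ((contract C)\<lparr>len := l, pos := h\<rparr>) (contract (C\<lparr>len := l, pos := h\<rparr>))"
    unfolding D_def C'_def .
qed

section \<open>When a contraction is a curve of genus one\<close>

text \<open>
  Curves whose bounded edges may have length zero.  Genus and valences are left open because they are
  decided only after the contraction.
\<close>

definition weak_curves :: "nat \<Rightarrow> nat \<Rightarrow> curve set" where
  "weak_curves n d =
     {C. finite_graph C \<and> connected_graph C \<and>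
        length (marks C) = n \<and> distinct (marks C) \<and> set (marks C) \<subseteq> unbounded_edges C \<and>
        (\<forall>e\<in>bounded_edges C. 0 \<le> len C e) \<and> fits C (len C) (pos C) \<and>
        (\<forall>f\<in>bounded_flags C. dir C (opp C f) = - dir C f) \<and>
        (\<forall>f\<in>set (marks C). dir C f = 0) \<and>
        (\<forall>v\<in>verts C. (\<Sum>f\<in>flags_at C v. dir C f) = 0) \<and> has_degree d C}"

text \<open>
  The two flags of a contracted edge end up at the same merged vertex and have opposite directions. This is
  why balancing survives contraction.
\<close>

lemma sum_contracted_flags:
  fixes C :: curve
  assumes fin: "finite_graph C"
    and op: "\<forall>f\<in>bounded_flags C. dir C (opp C f) = - dir C f"
  shows "(\<Sum>f\<in>{f \<in> contracted_flags C. merged_vertex C (base C f) = w}. dir C f) = 0"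
proof -
  let ?A = "{f \<in> contracted_flags C. merged_vertex C (base C f) = w}"
  have m: "merged_vertex C (base C (opp C f)) = merged_vertex C (base C f)" if "f \<in> contracted_flags C" for f
  proof -
    have "(base C f, base C (opp C f)) \<in> contracted_rel C" using that by (auto simp: contracted_rel_def)
    then have "merged_vertex C (base C f) = merged_vertex C (base C (opp C f))"
      unfolding merged_vertex_eq_iff[OF fin] by (rule r_into_rtrancl)
    then show ?thesis by simp
  qed
  have oo: "opp C (opp C f) = f" "opp C f \<in> contracted_flags C" if "f \<in> contracted_flags C" for f
  proof -
    have "f \<in> flags C" using that by (simp add: contracted_flags_def bounded_flags_def)
    then show "opp C (opp C f) = f" using fin by (simp add: finite_graph_def)
  qed (rule contracted_flags_opp[OF fin that])
  have "(\<Sum>f\<in>?A. dir C f) = (\<Sum>f\<in>?A. dir C (opp C f))"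
    by (rule sum.reindex_bij_witness[of _ "opp C" "opp C"]) (simp_all add: m oo)
  also have "\<dots> = (\<Sum>f\<in>?A. - dir C f)"
    by (rule sum.cong) (use op in \<open>auto simp: contracted_flags_def\<close>)
  also have "\<dots> = - (\<Sum>f\<in>?A. dir C f)" by (rule sum_negf)
  finally have neg: "(\<Sum>f\<in>?A. dir C f) = - (\<Sum>f\<in>?A. dir C f)" .
  have "s = - s \<Longrightarrow> s = 0" for s :: "int \<times> int" by (cases s) (simp add: zero_prod_def)
  from this[OF neg] show ?thesis .
qed

text \<open>
  Genus and valences are the only defining conditions that contraction can destroy.
\<close>

lemma contract_genus_one:
  assumes C: "C \<in> weak_curves n d"
    and g: "genus (contract C) = 1"
    and v: "\<And>v. v \<in> verts (contract C) \<Longrightarrow> 3 \<le> valence (contract C) v"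
  shows "contract C \<in> genus_one_curves n d"
proof -
  note C' = C[unfolded weak_curves_def mem_Collect_eq]
  have fin: "finite_graph C" and fits: "fits C (len C) (pos C)" using C' by auto
  let ?D = "contract C"
  have cl: "opp C f \<in> flags C" "base C f \<in> verts C" "opp C (opp C f) = f" if "f \<in> flags C" for f
    using fin that by (auto simp: finite_graph_def)
  have zsub: "contracted_flags C \<subseteq> bounded_flags C" "bounded_flags C \<subseteq> flags C"
    by (auto simp: contracted_flags_def bounded_flags_def)
  have "connected_graph ?D"
    unfolding connected_graph_def
  proof (intro conjI ballI)
    show "verts ?D \<noteq> {}" using C' by (auto simp: connected_graph_def)
    fix u v assume "u \<in> verts ?D" "v \<in> verts ?D"
    then obtain u' v' where uv: "u = merged_vertex C u'" "v = merged_vertex C v'" "u' \<in> verts C" "v' \<in> verts C" by auto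
    then have "(u', v') \<in> {(base C f, base C (opp C f)) |f. f \<in> bounded_flags C}\<^sup>*"
      using C' by (auto simp: connected_graph_def)
    then have "(merged_vertex C u', merged_vertex C v') \<in> {(base ?D f, base ?D (opp ?D f)) |f. f \<in> bounded_flags ?D}\<^sup>*"
    proof induction
      case (step y z)
      then obtain f where f: "f \<in> bounded_flags C" "y = base C f" "z = base C (opp C f)" by auto
      show ?case
      proof (cases "f \<in> contracted_flags C")
        case True
        then have "(y, z) \<in> contracted_rel C" using f by (auto simp: contracted_rel_def)
        then have "merged_vertex C y = merged_vertex C z" using merged_vertex_eq_iff[OF fin] by blast
        then show ?thesis using step.IH by simp
      next
        case False
        then have "(merged_vertex C y, merged_vertex C z) \<in> {(base ?D f, base ?D (opp ?D f)) |f. f \<in> bounded_flags ?D}"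
          using f unfolding bounded_flags_contract by auto
        then show ?thesis using step.IH by (rule rtrancl_into_rtrancl[rotated])
      qed
    qed simp
    then show "(u, v) \<in> {(base ?D f, base ?D (opp ?D f)) |f. f \<in> bounded_flags ?D}\<^sup>*"
      by (simp add: uv)
  qed
  moreover have "\<forall>e\<in>bounded_edges ?D. 0 < len ?D e"
  proof
    fix e assume "e \<in> bounded_edges ?D"
    then obtain f where f: "f \<in> bounded_flags C" "f \<notin> contracted_flags C" "e = flag_edge C f"
      by (auto simp: bounded_edges_def bounded_flags_contract)
    then have "len C e \<noteq> 0" "len C e \<ge> 0" using C' by (auto simp: contracted_flags_def bounded_edges_def)
    then show "0 < len ?D e" by simp
  qed
  moreover have "fits ?D (len ?D) (pos ?D)"
    using contract_relengthen(1)[OF fin fits] by simp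
  moreover have "\<forall>v\<in>verts ?D. (\<Sum>f\<in>flags_at ?D v. dir ?D f) = 0"
  proof
    fix w assume "w \<in> verts ?D"
    define K where "K = {v \<in> verts C. merged_vertex C v = w}"
    have finK: "finite K" and finF: "finite (flags C)" using fin by (auto simp: finite_graph_def K_def)
    let ?Z = "{f \<in> contracted_flags C. merged_vertex C (base C f) = w}"
    have U: "(\<Union>v\<in>K. flags_at C v) = flags_at ?D w \<union> ?Z"
      using cl zsub by (auto simp: K_def flags_at_def)
    have fl: "finite (flags_at C v)" for v using finF by (auto simp: flags_at_def)
    have dj: "flags_at ?D w \<inter> ?Z = {}" by (auto simp: flags_at_def)
    have "(\<Sum>v\<in>K. \<Sum>f\<in>flags_at C v. dir C f) = (\<Sum>f\<in>(\<Union>v\<in>K. flags_at C v). dir C f)"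
      using finK fl by (intro sum.UNION_disjoint[symmetric]) (auto simp: flags_at_def)
    also have "\<dots> = (\<Sum>f\<in>flags_at ?D w. dir C f) + (\<Sum>f\<in>?Z. dir C f)"
      unfolding U using finF zsub dj
      by (intro sum.union_disjoint) (auto simp: flags_at_def intro: finite_subset)
    also have "(\<Sum>f\<in>?Z. dir C f) = 0" using sum_contracted_flags[OF fin] C' by blast
    finally have "(\<Sum>f\<in>flags_at ?D w. dir C f) = (\<Sum>v\<in>K. \<Sum>f\<in>flags_at C v. dir C f)" by simp
    also have "\<dots> = 0" using C' by (auto simp: K_def)
    finally show "(\<Sum>f\<in>flags_at ?D w. dir ?D f) = 0" by simp
  qed
  ultimately show ?thesis
    unfolding genus_one_curves_def planar_tropical_curve_def abstract_tropical_curve_def mem_Collect_eq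
    using finite_graph_contract[OF fin] v g C'
    by (simp add: has_degree_def unbounded_edges_contract bounded_flags_contract)
qed


section \<open>Curves in the same connected component\<close>

definition linked :: "nat \<Rightarrow> nat \<Rightarrow> curve \<Rightarrow> curve \<Rightarrow> bool" where
  "linked n d C D \<longleftrightarrow> C \<in> genus_one_curves n d \<and> D \<in> genus_one_curves n d \<and>
     connected_component_of (moduli_space n d) (iso_rel n d `` {C}) (iso_rel n d `` {D})"

lemma linked_sym: "linked n d C D \<Longrightarrow> linked n d D C"
  by (auto simp: linked_def connected_component_of_sym)

lemma linked_trans: "linked n d C D \<Longrightarrow> linked n d D E \<Longrightarrow> linked n d C E"
  unfolding linked_def by (elim conjE, intro conjI) (assumption | rule connected_component_of_trans)+

lemma iso_class_eq:
  assumes "C \<in> genus_one_curves n d" "isomorphic C D"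
  shows "iso_rel n d `` {C} = iso_rel n d `` {D}"
  using equiv_class_eq[OF equiv_iso_rel, of C D] assms genus_one_curves_isomorphic[OF assms]
  by (simp add: iso_rel_def)

lemma linked_isomorphic:
  assumes "C \<in> genus_one_curves n d" "isomorphic C D"
  shows "linked n d C D"
  unfolding linked_def iso_class_eq[OF assms, symmetric]
  using assms genus_one_curves_isomorphic[OF assms]
  by (auto simp: connected_component_of_refl topspace_moduli_space moduli_set_def intro!: quotientI)

text \<open>
  The lengths of \<open>C\<close> are positive and \<open>l\<close> is nonnegative, so all points of the segment between the
  two parameters except possibly its end have positive lengths.  They are in the cell of the type of
  \<open>C\<close>, and contraction changes nothing there; at the end of the segment the curve is \<open>E\<close> by assumption.
\<close>

lemma linked_degeneration:
  assumes C: "C \<in> genus_one_curves n d" and fits: "fits C l h"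
    and l0: "\<And>e. e \<in> bounded_edges C \<Longrightarrow> 0 \<le> l e"
    and E: "E \<in> genus_one_curves n d" and col: "collapse (C\<lparr>len := l, pos := h\<rparr>) E"
  shows "linked n d C E"
proof -
  note Cf = C[THEN genus_one_curves_imp(1)] and Cc = C[THEN genus_one_curves_imp(2)]
    and Cm = C[THEN genus_one_curves_imp(3)] and Cfit = C[THEN genus_one_curves_imp(4)]
    and Clen = C[THEN genus_one_curves_imp(5)]
  obtain r where r: "r \<in> verts C" using Cc by (auto simp: connected_graph_def)
  define \<alpha> where "\<alpha> = combinatorial_type.truncate C"
  define L where "L t = (\<lambda>e. (1 - t) * len C e + t * l e)" for t
  define H where "H t = (\<lambda>v. (1 - t) *\<^sub>R pos C v + t *\<^sub>R h v)" for t
  define x where "x t = (H t r, restrict (L t) (bounded_edges C))" for t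
  define D where "D t = param_curve (\<alpha>, r) (x t)" for t
  define Ct where "Ct t = C\<lparr>len := L t, pos := H t\<rparr>" for t
  have bf: "flag_edge C f \<in> bounded_edges C" if "f \<in> bounded_flags C" for f
    using that by (auto simp: bounded_edges_def)
  have fitsH: "fits C (L t) (H t)" for t
    unfolding fits_def
  proof
    fix f assume f: "f \<in> bounded_flags C"
    have "pos C (base C (opp C f)) = pos C (base C f) + len C (flag_edge C f) *\<^sub>R real_vec (dir C f)"
      "h (base C (opp C f)) = h (base C f) + l (flag_edge C f) *\<^sub>R real_vec (dir C f)"
      using f Cfit fits by (auto simp: fits_def)
    then show "H t (base C (opp C f)) = H t (base C f) + L t (flag_edge C f) *\<^sub>R real_vec (dir C f)"
      by (simp add: H_def L_def algebra_simps)
  qed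
  have fitsR: "fits C (restrict (L t) (bounded_edges C)) (H t)" for t
    using fitsH bf by (auto simp: fits_def)
  then have ex: "\<exists>h. h r = H t r \<and> fits \<alpha> (restrict (L t) (bounded_edges C)) h" for t
    by (auto simp: \<alpha>_def graph_simps_truncate)
  have pl: "placement \<alpha> r (H t r) (restrict (L t) (bounded_edges C)) v = H t v" if "v \<in> verts C" for t v
  proof -
    have "placement \<alpha> r (H t r) (restrict (L t) (bounded_edges C)) r = H t r"
      "fits C (restrict (L t) (bounded_edges C)) (placement \<alpha> r (H t r) (restrict (L t) (bounded_edges C)))"
      using someI_ex[OF ex[of t]] by (auto simp: placement_def \<alpha>_def graph_simps_truncate)
    then show ?thesis using fits_unique[OF Cc _ fitsR r _ that] by auto
  qed
  have Deq: "D t = \<lparr>verts = verts C, flags = flags C, base = base C, opp = opp C,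
          marks = marks C, dir = dir C, len = restrict (L t) (bounded_edges C),
          pos = placement \<alpha> r (H t r) (restrict (L t) (bounded_edges C))\<rparr>" for t
    by (simp add: D_def x_def param_curve_def \<alpha>_def combinatorial_type.defs)
  have Dfin: "finite_graph (D t)" "finite_graph (Ct t)" for t
    using Cf by (auto simp: finite_graph_def Deq Ct_def)
  have Dmarks: "set (marks (D t)) \<subseteq> unbounded_edges (D t)" for t
    using C by (auto simp: Deq unbounded_edges_def genus_one_curves_def planar_tropical_curve_def
        abstract_tropical_curve_def)
  have DC: "isomorphic (D t) (Ct t)" for t
    unfolding isomorphic_def
    by (rule exI[of _ id], rule exI[of _ id])
      (use bf pl in \<open>auto simp: Deq Ct_def bounded_flags_def flag_edge_def\<close>)
  have Ct_simps: "bounded_flags (Ct t) = bounded_flags C" "unbounded_edges (Ct t) = unbounded_edges C"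
    "flag_edge (Ct t) = flag_edge C" "bounded_edges (Ct t) = bounded_edges C" "flags_at (Ct t) = flags_at C" for t
    by (auto simp: Ct_def bounded_flags_def unbounded_edges_def flag_edge_def bounded_edges_def flags_at_def)
  have Lpos: "0 < L t e" if "e \<in> bounded_edges C" "0 \<le> t" "t < 1" for t e
    using Clen[OF that(1)] l0[OF that(1)] that by (auto simp: L_def intro!: add_pos_nonneg)
  have Cts: "Ct t \<in> genus_one_curves n d" if "0 \<le> t" "t < 1" for t
  proof -
    have rel: "{(base (Ct t) f, base (Ct t) (opp (Ct t) f)) |f. f \<in> bounded_flags (Ct t)} =
       {(base C f, base C (opp C f)) |f. f \<in> bounded_flags C}"
      unfolding Ct_simps by (simp add: Ct_def)
    have "connected_graph (Ct t)"
      using Cc unfolding connected_graph_def rel by (simp add: Ct_def)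
    moreover have "fits (Ct t) (len (Ct t)) (pos (Ct t))"
      using fitsH[of t] unfolding fits_def Ct_simps by (simp add: Ct_def)
    moreover have "genus (Ct t) = 1" "has_degree d (Ct t)"
      using C by (auto simp: genus_def genus_one_curves_def has_degree_def Ct_simps) (auto simp: Ct_def)
    moreover have "\<forall>e\<in>bounded_edges (Ct t). 0 < len (Ct t) e"
      using Lpos that unfolding Ct_simps by (simp add: Ct_def)
    ultimately show ?thesis
      using C Dfin(2)[of t] unfolding genus_one_curves_def mem_Collect_eq planar_tropical_curve_def
        abstract_tropical_curve_def valence_def Ct_simps
      by (simp add: Ct_def)
  qed
  have "collapse (Ct t) (Ct t)" if "0 \<le> t" "t < 1" for t
  proof -
    have "contracted_flags (Ct t) = {}"
    proof -
      have "len (Ct t) = L t" by (simp add: Ct_def)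
      then show ?thesis using Lpos[OF bf that] unfolding contracted_flags_def Ct_simps by force
    qed
    then show ?thesis unfolding collapse_def
      by (intro exI[of _ id]) (auto simp: contracted_rel_def)
  qed
  moreover have "collapse (Ct 1) E" using col by (simp add: Ct_def L_def H_def)
  ultimately have colD: "collapse (D t) (if t < 1 then Ct t else E)" if "t \<in> {0..1}" for t
    using isomorphic_collapse[OF DC Dfin(1) Dfin(2) _ Dmarks] that by (cases "t = 1") auto
  have mem: "contract (D t) \<in> genus_one_curves n d"
    "isomorphic (contract (D t)) (if t < 1 then Ct t else E)" if "t \<in> {0..1}" for t
  proof -
    show iso: "isomorphic (contract (D t)) (if t < 1 then Ct t else E)"
      by (rule collapse_isomorphic[OF Dfin(1) colD[OF that]])
    have "set (marks (contract (D t))) \<subseteq> flags (contract (D t))"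
      using Dmarks[of t] by (auto simp: unbounded_edges_def contracted_flags_def bounded_flags_def)
    from isomorphic_sym[OF iso finite_graph_contract[OF Dfin(1)] this]
    show "contract (D t) \<in> genus_one_curves n d"
      by (rule genus_one_curves_isomorphic[rotated]) (use Cts E that in auto)
  qed
  define \<gamma> where "\<gamma> t = ((\<alpha>, r), x t)" for t
  have idx: "(\<alpha>, r) \<in> (SIGMA \<alpha> : types n d. verts \<alpha>)"
    using C r by (auto simp: types_def \<alpha>_def combinatorial_type.defs)
  have be: "bounded_edges \<alpha> = bounded_edges C" by (simp add: \<alpha>_def graph_simps_truncate)
  have Lnn: "0 \<le> L t e" if "e \<in> bounded_edges C" "t \<in> {0..1}" for t e
    using Clen[OF that(1)] l0[OF that(1)] that by (auto simp: L_def intro!: add_nonneg_nonneg)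
  have "x t \<in> cell n d (\<alpha>, r)" if "t \<in> {0..1}" for t
    using mem(1)[OF that] ex[of t] Lnn[OF _ that]
    by (auto simp: cell_def x_def D_def be)
  moreover have "continuous_map (top_of_set {0..1}) (prod_topology euclidean
      (product_topology (\<lambda>_. euclideanreal) (bounded_edges C))) x"
    unfolding x_def H_def L_def
    by (intro continuous_map_pairedI) (auto simp: continuous_map_componentwise intro!: continuous_intros)
  ultimately have "continuous_map (top_of_set {0..1}) (cell_topology n d (\<alpha>, r)) x"
    by (auto simp: cell_topology_def continuous_map_in_subtopology be)
  then have "continuous_map (top_of_set {0..1}) (cells n d) (Pair (\<alpha>, r) \<circ> x)"
    unfolding cells_def
    using continuous_map_component_injection[OF idx] by (rule continuous_map_compose)
  then have "continuous_map (top_of_set {0..1}) (moduli_space n d) (curve_class n d \<circ> (Pair (\<alpha>, r) \<circ> x))"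
    unfolding moduli_space_def
    by (rule continuous_map_compose[OF _ quotient_imp_continuous_map[OF quotient_map_quotient_topology]])
  then have "connectedin (moduli_space n d) ((curve_class n d \<circ> (Pair (\<alpha>, r) \<circ> x)) ` {0..1})"
    by (rule connectedin_continuous_map_image) (simp add: connectedin_subtopology)
  moreover have "(curve_class n d \<circ> (Pair (\<alpha>, r) \<circ> x)) 0 = iso_rel n d `` {C}"
  proof -
    have "Ct 0 = C" by (simp add: Ct_def L_def H_def)
    then show ?thesis using iso_class_eq[OF mem[of 0]] by (simp add: curve_class_def D_def)
  qed
  moreover have "(curve_class n d \<circ> (Pair (\<alpha>, r) \<circ> x)) 1 = iso_rel n d `` {E}"
    using iso_class_eq[OF mem[of 1]] by (simp add: curve_class_def D_def)
  ultimately have "connected_component_of (moduli_space n d) (iso_rel n d `` {C}) (iso_rel n d `` {E})"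
    unfolding connected_component_of_def by (metis atLeastAtMost_iff imageI order_refl zero_le_one)
  then show ?thesis using C E by (simp add: linked_def)
qed

section \<open>Pruning a curve to its cycle\<close>

definition bounded_at :: "curve \<Rightarrow> nat \<Rightarrow> nat set" where
  "bounded_at C v = {f \<in> bounded_flags C. base C f = v}"

text \<open>
  The edge of \<open>f\<close> is a bridge with nothing but unbounded edges behind it.  Hence its length is not
  constrained by the cycle and can shrink to zero while all other vertices keep their positions.
  The merged vertex has valence at least \<open>3 + 3 - 2\<close>.
\<close>

lemma prune_leaf:
  assumes C: "C \<in> genus_one_curves n d" and v: "v \<in> verts C" and leaf: "bounded_at C v = {f}"
  shows "\<exists>D. linked n d C D \<and> card (verts D) < card (verts C)"
proof -
  note C' = C[unfolded genus_one_curves_def planar_tropical_curve_def abstract_tropical_curve_def mem_Collect_eq]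
  have fin: "finite_graph C" and fits: "fits C (len C) (pos C)" using C' by auto
  have cl: "opp C f \<in> flags C" "base C f \<in> verts C" "opp C (opp C f) = f" if "f \<in> flags C" for f
    using fin that by (auto simp: finite_graph_def)
  have bfl: "f \<in> flags C" "opp C f \<in> bounded_flags C" "opp C (opp C f) = f" "opp C f \<noteq> f"
    if "f \<in> bounded_flags C" for f
    using that cl by (auto simp: bounded_flags_def)
  have f: "f \<in> bounded_flags C" "base C f = v" using leaf by (auto simp: bounded_at_def)
  have uniq: "g = f" if "g \<in> bounded_flags C" "base C g = v" for g
    using leaf that by (auto simp: bounded_at_def)
  define w where "w = base C (opp C f)"
  have wv: "w \<noteq> v" using uniq[of "opp C f"] bfl[OF f(1)] by (auto simp: w_def)
  have w: "w \<in> verts C" using bfl[OF f(1)] cl by (auto simp: w_def)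
  define e where "e = flag_edge C f"
  have e: "e \<in> bounded_edges C" using f by (auto simp: e_def bounded_edges_def)
  have ee: "flag_edge C g = e \<longleftrightarrow> g = f \<or> g = opp C f" if "g \<in> bounded_flags C" for g
    using bfl[OF f(1)] bfl[OF that] by (auto simp: e_def flag_edge_def doubleton_eq_iff)
  define l where "l = (len C)(e := 0)"
  define h where "h = (pos C)(v := pos C w)"
  define F where "F = C\<lparr>len := l, pos := h\<rparr>"
  have F_simps [simp]: "verts F = verts C" "flags F = flags C" "base F = base C" "opp F = opp C"
    "marks F = marks C" "dir F = dir C" "len F = l" "pos F = h" "flag_edge F = flag_edge C"
    "bounded_flags F = bounded_flags C" "unbounded_edges F = unbounded_edges C"
    "bounded_edges F = bounded_edges C" "flags_at F = flags_at C"
    by (auto simp: F_def flag_edge_def bounded_flags_def unbounded_edges_def bounded_edges_def flags_at_def)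
  have Ffin: "finite_graph F" using fin by (simp add: finite_graph_def)
  have fits': "fits C l h"
    unfolding fits_def
  proof
    fix g assume g: "g \<in> bounded_flags C"
    show "h (base C (opp C g)) = h (base C g) + l (flag_edge C g) *\<^sub>R real_vec (dir C g)"
    proof (cases "g = f \<or> g = opp C f")
      case True
      then have "l (flag_edge C g) = 0" using ee[OF g] by (simp add: l_def)
      moreover have "{base C g, base C (opp C g)} = {v, w}"
        using True f bfl[OF f(1)] by (auto simp: w_def)
      then have "h (base C (opp C g)) = h (base C g)" by (auto simp: h_def doubleton_eq_iff)
      ultimately show ?thesis by simp
    next
      case False
      then have "flag_edge C g \<noteq> e" using ee[OF g] by simp
      moreover have "base C g \<noteq> v" "base C (opp C g) \<noteq> v"
        using False uniq[of g] uniq[of "opp C g"] g bfl[OF g] by auto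
      ultimately show ?thesis using fits g by (simp add: l_def h_def fits_def)
    qed
  qed
  have l0: "0 \<le> l g" if "g \<in> bounded_edges C" for g using C' that by (auto simp: l_def less_imp_le)
  have Z: "contracted_flags F = {f, opp C f}"
  proof -
    have "l (flag_edge C g) = 0 \<longleftrightarrow> flag_edge C g = e" if "g \<in> bounded_flags C" for g
    proof -
      have "0 < len C (flag_edge C g)" using C' that by (auto simp: bounded_edges_def)
      then show ?thesis by (auto simp: l_def)
    qed
    then show ?thesis using ee f bfl[OF f(1)] by (auto simp: contracted_flags_def)
  qed
  have rel: "contracted_rel F = {(v, w), (w, v)}"
    using f bfl[OF f(1)] by (auto simp: contracted_rel_def Z w_def)
  have relst: "(x, y) \<in> (contracted_rel F)\<^sup>* \<longleftrightarrow> x = y \<or> {x, y} = {v, w}" for x y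
  proof
    assume "(x, y) \<in> (contracted_rel F)\<^sup>*"
    then show "x = y \<or> {x, y} = {v, w}"
      by induction (auto simp: rel doubleton_eq_iff)
  next
    assume "x = y \<or> {x, y} = {v, w}"
    then show "(x, y) \<in> (contracted_rel F)\<^sup>*"
      by (auto simp: rel doubleton_eq_iff)
  qed
  define m where "m = merged_vertex F"
  have m: "m x = m y \<longleftrightarrow> x = y \<or> {x, y} = {v, w}" for x y
    unfolding m_def merged_vertex_eq_iff[OF Ffin] by (rule relst)
  have finV: "finite (verts C)" and finFl: "finite (flags C)" using fin by (auto simp: finite_graph_def)
  have img: "m ` verts C = m ` (verts C - {v})"
  proof -
    have "m v = m w" by (simp add: m)
    then have "m v \<in> m ` (verts C - {v})" using w wv by (simp add: image_iff) blast
    moreover have "m ` verts C = insert (m v) (m ` (verts C - {v}))" using v by auto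
    ultimately show ?thesis by auto
  qed
  have inj: "inj_on m (verts C - {v})" by (auto simp: m inj_on_def doubleton_eq_iff)
  have cV: "card (verts (contract F)) = card (verts C) - 1"
    using card_image[OF inj] v finV by (simp add: m_def[symmetric] img)
  have "bounded_edges (contract F) = bounded_edges C - {e}"
    using ee by (auto simp: bounded_edges_def bounded_flags_contract Z)
  moreover have "finite (bounded_edges C)"
    using finFl by (auto simp: bounded_edges_def bounded_flags_def)
  ultimately have cE: "card (bounded_edges (contract F)) = card (bounded_edges C) - 1" using e by simp
  have pos: "card (verts C) > 0" "card (bounded_edges C) > 0"
    using v finV e \<open>finite (bounded_edges C)\<close> by (auto simp: card_gt_0_iff)
  have "genus (contract F) = genus C" unfolding genus_def cV cE using pos by simp
  then have g: "genus (contract F) = 1" using C' by simp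
  have val: "3 \<le> valence (contract F) x" if "x \<in> verts (contract F)" for x
  proof -
    have "x \<in> m ` (verts C - {v})" using that img by (simp add: m_def)
    then obtain u where u: "u \<in> verts C" "u \<noteq> v" "x = m u" by blast
    have fa: "flags_at (contract F) x = {g \<in> flags C - {f, opp C f}. m (base C g) = m u}"
      by (auto simp: flags_at_def Z u m_def)
    have fat: "finite (flags_at C y)" for y using finFl by (auto simp: flags_at_def)
    have val3: "3 \<le> card (flags_at C y)" if "y \<in> verts C" for y using C' that by (auto simp: valence_def)
    show ?thesis
    proof (cases "u = w")
      case True
      have "flags_at (contract F) x = (flags_at C v \<union> flags_at C w) - {f, opp C f}"
        unfolding fa using True wv by (auto simp: m flags_at_def doubleton_eq_iff)
      moreover have "card (flags_at C v \<union> flags_at C w) = card (flags_at C v) + card (flags_at C w)"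
        using fat wv by (intro card_Un_disjoint) (auto simp: flags_at_def)
      moreover have "card (flags_at C v \<union> flags_at C w) - card {f, opp C f} \<le> card ((flags_at C v \<union> flags_at C w) - {f, opp C f})"
        by (rule diff_card_le_card_Diff) simp
      moreover have "card {f, opp C f} \<le> 2" by (simp add: card_insert_if)
      ultimately show ?thesis using val3[OF v] val3[OF w] by (simp add: valence_def)
    next
      case False
      have "flags_at (contract F) x = flags_at C u"
        unfolding fa using False u f by (auto simp: m flags_at_def doubleton_eq_iff w_def)
      then show ?thesis using val3[OF u(1)] by (simp add: valence_def)
    qed
  qed
  have "connected_graph F" using C' by (simp add: connected_graph_def)
  then have "F \<in> weak_curves n d"
    using C' Ffin fits' l0 by (simp add: weak_curves_def has_degree_def fits_def)
  from contract_genus_one[OF this g val] have D: "contract F \<in> genus_one_curves n d" .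
  have "linked n d C (contract F)"
    by (rule linked_degeneration[OF C fits' l0 D])
      (use collapse_contract[OF Ffin] fits' in \<open>simp_all add: F_def[symmetric] fits_def\<close>)
  moreover have "card (verts (contract F)) < card (verts C)" unfolding cV using pos by simp
  ultimately show ?thesis by blast
qed

lemma card_bounded_flags:
  fixes C :: curve
  assumes "finite_graph C"
  shows "card (bounded_flags C) = 2 * card (bounded_edges C)"
proof -
  have op: "opp C f \<in> bounded_flags C" "opp C (opp C f) = f" "opp C f \<noteq> f" if "f \<in> bounded_flags C" for f
    using that assms by (auto simp: bounded_flags_def finite_graph_def)
  have fin: "finite (bounded_flags C)" using assms by (auto simp: finite_graph_def bounded_flags_def)
  have "\<Union> (bounded_edges C) = bounded_flags C"
    using op by (auto simp: bounded_edges_def flag_edge_def)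
  moreover have "2 * card (bounded_edges C) = card (\<Union> (bounded_edges C))"
  proof (rule card_partition)
    show "finite (bounded_edges C)" "finite (\<Union> (bounded_edges C))"
      using fin calculation by (auto simp: bounded_edges_def)
    show "card c = 2" if c: "c \<in> bounded_edges C" for c
    proof -
      obtain f where f: "f \<in> bounded_flags C" "c = {f, opp C f}"
        using c by (auto simp: bounded_edges_def flag_edge_def)
      have "f \<noteq> opp C f" using op(3)[OF f(1)] by metis
      then show ?thesis using f by simp
    qed
    show "c1 \<inter> c2 = {}" if c: "c1 \<in> bounded_edges C" "c2 \<in> bounded_edges C" "c1 \<noteq> c2" for c1 c2
    proof -
      obtain f g where fg: "f \<in> bounded_flags C" "g \<in> bounded_flags C" "c1 = {f, opp C f}" "c2 = {g, opp C g}"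
        using c by (auto simp: bounded_edges_def flag_edge_def)
      have "c1 = c2" if "f = g \<or> f = opp C g \<or> opp C f = g \<or> opp C f = opp C g"
        using that op[OF fg(1)] op[OF fg(2)] fg(3,4) by (metis insert_commute)
      then show ?thesis using c fg(3,4) by auto
    qed
  qed
  ultimately show ?thesis by simp
qed

text \<open>
  In genus one there are as many bounded edges as vertices, so a vertex has two bounded flags on average.
  When no leaf is left, every vertex has at least two of them, hence exactly two.
\<close>

lemma linked_to_cycle:
  assumes "C \<in> genus_one_curves n d"
  shows "\<exists>D. linked n d C D \<and> (\<forall>v\<in>verts D. card (bounded_at D v) = 2)"
  using assms
proof (induction "card (verts C)" arbitrary: C rule: less_induct)
  case less
  note C = less.prems
  note C' = C[unfolded genus_one_curves_def planar_tropical_curve_def abstract_tropical_curve_def mem_Collect_eq]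
  have fin: "finite_graph C" using C' by auto
  then have finV: "finite (verts C)" and finB: "finite (bounded_flags C)"
    by (auto simp: finite_graph_def bounded_flags_def)
  show ?case
  proof (cases "\<exists>v\<in>verts C. card (bounded_at C v) = 1")
    case True
    then obtain v f where "v \<in> verts C" "bounded_at C v = {f}" by (auto simp: card_1_singleton_iff)
    from prune_leaf[OF C this] obtain D where D: "linked n d C D" "card (verts D) < card (verts C)" by blast
    then have "D \<in> genus_one_curves n d" by (simp add: linked_def)
    from less.hyps[OF D(2) this] show ?thesis using D(1) linked_trans by blast
  next
    case False
    have un: "bounded_flags C = (\<Union>v\<in>verts C. bounded_at C v)"
      using fin by (auto simp: bounded_at_def bounded_flags_def finite_graph_def)
    have "card (bounded_flags C) = (\<Sum>v\<in>verts C. card (bounded_at C v))"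
      unfolding un using finV finB by (intro card_UN_disjoint) (auto simp: bounded_at_def)
    moreover have "card (bounded_flags C) = 2 * card (verts C)"
      using C' card_bounded_flags[OF fin] by (auto simp: genus_def)
    ultimately have sum: "(\<Sum>v\<in>verts C. card (bounded_at C v)) = (\<Sum>v\<in>verts C. 2)" by simp
    have ge: "2 \<le> card (bounded_at C v)" if v: "v \<in> verts C" for v
    proof (rule ccontr)
      assume "\<not> 2 \<le> card (bounded_at C v)"
      then have "card (bounded_at C v) = 0" using False v
        by (metis One_nat_def Suc_1 less_2_cases not_less)
      then have em: "bounded_at C v = {}" using finB by (auto simp: bounded_at_def)
      have "u = v" if "u \<in> verts C" for u
      proof -
        have "(v, u) \<in> {(base C f, base C (opp C f)) |f. f \<in> bounded_flags C}\<^sup>*"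
          using C' v that by (auto simp: connected_graph_def)
        then show ?thesis
          by (cases rule: converse_rtranclE) (use em in \<open>auto simp: bounded_at_def\<close>)
      qed
      then have "verts C = {v}" using v by blast
      then show False using sum em by simp
    qed
    have "card (bounded_at C v) = 2" if "v \<in> verts C" for v
    proof (rule ccontr)
      assume "card (bounded_at C v) \<noteq> 2"
      then have "(\<Sum>v\<in>verts C. 2) < (\<Sum>v\<in>verts C. card (bounded_at C v))"
        using ge that finV by (intro sum_strict_mono_ex1) (auto intro!: bexI[of _ v] simp: le_neq_implies_less)
      then show False using sum by simp
    qed
    moreover have "linked n d C C" using linked_isomorphic[OF C isomorphic_refl] .
    ultimately show ?thesis by blast
  qed
qed

text \<open>
  The traversal crosses an edge and leaves the vertex reached by its other bounded flag. It cannot run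
  into an earlier vertex other than the first one, as both bounded flags there are already in
  use, and it meets all vertices because the vertices visited have no further bounded flags.
\<close>

lemma cycle_traversal:
  fixes C :: curve
  assumes fin: "finite_graph C" and con: "connected_graph C"
    and two: "\<And>v. v \<in> verts C \<Longrightarrow> card (bounded_at C v) = 2"
  obtains K :: nat and fs where "0 < K" "bij_betw (\<lambda>i. base C (fs i)) {..<K} (verts C)"
    "\<And>i. i < K \<Longrightarrow> fs i \<in> bounded_flags C"
    "\<And>i. i < K \<Longrightarrow> base C (opp C (fs i)) = base C (fs (Suc i mod K))"
    "bounded_flags C = fs ` {..<K} \<union> (\<lambda>i. opp C (fs i)) ` {..<K}"
    "\<And>i j. i < K \<Longrightarrow> j < K \<Longrightarrow> fs i \<noteq> opp C (fs j)"
proof -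
  have op: "opp C f \<in> bounded_flags C" "opp C (opp C f) = f" "opp C f \<noteq> f" "base C f \<in> verts C"
    if "f \<in> bounded_flags C" for f
    using that fin by (auto simp: bounded_flags_def finite_graph_def)
  have "\<exists>g. g \<in> bounded_flags C \<and> base C g = base C f \<and> g \<noteq> f \<and>
      (\<forall>g'\<in>bounded_flags C. base C g' = base C f \<longrightarrow> g' = f \<or> g' = g)" if f: "f \<in> bounded_flags C" for f
  proof -
    obtain a b where ab: "bounded_at C (base C f) = {a, b}" "a \<noteq> b"
      using two[OF op(4)[OF f]] by (auto simp: card_2_iff)
    have "f \<in> bounded_at C (base C f)" using f by (simp add: bounded_at_def)
    then have "f = a \<or> f = b" using ab by auto
    moreover have "a \<in> bounded_at C (base C f)" "b \<in> bounded_at C (base C f)"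
      "\<And>g'. g' \<in> bounded_flags C \<Longrightarrow> base C g' = base C f \<Longrightarrow> g' = a \<or> g' = b"
      using ab(1) by (auto simp: bounded_at_def)
    ultimately show ?thesis using ab(2) unfolding bounded_at_def mem_Collect_eq by metis
  qed
  then have "\<exists>oth. \<forall>f\<in>bounded_flags C. oth f \<in> bounded_flags C \<and> base C (oth f) = base C f \<and> oth f \<noteq> f \<and>
      (\<forall>g'\<in>bounded_flags C. base C g' = base C f \<longrightarrow> g' = f \<or> g' = oth f)"
    by (intro bchoice ballI)
  then obtain oth where "\<forall>f\<in>bounded_flags C. oth f \<in> bounded_flags C \<and> base C (oth f) = base C f \<and> oth f \<noteq> f \<and>
      (\<forall>g'\<in>bounded_flags C. base C g' = base C f \<longrightarrow> g' = f \<or> g' = oth f)" ..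
  then have oth: "oth f \<in> bounded_flags C" "base C (oth f) = base C f" "oth f \<noteq> f"
      "\<And>g. g \<in> bounded_flags C \<Longrightarrow> base C g = base C f \<Longrightarrow> g = f \<or> g = oth f"
    if "f \<in> bounded_flags C" for f
    using that by blast+
  obtain v0 where v0: "v0 \<in> verts C" using con by (auto simp: connected_graph_def)
  then obtain f0 where f0: "f0 \<in> bounded_flags C" "base C f0 = v0"
    using two[OF v0] by (fastforce simp: card_2_iff bounded_at_def)
  define fs where "fs i = ((\<lambda>f. oth (opp C f)) ^^ i) f0" for i
  have Suc: "fs (Suc i) = oth (opp C (fs i))" for i by (simp add: fs_def)
  have B: "fs i \<in> bounded_flags C" for i
    by (induction i) (use f0 op oth in \<open>simp_all add: fs_def\<close>)
  define b where "b i = base C (fs i)" for i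
  have b_Suc: "b (Suc i) = base C (opp C (fs i))" for i
    using oth(2)[OF op(1)[OF B]] by (simp add: b_def Suc)
  have ne: "fs (Suc i) \<noteq> opp C (fs i)" for i using oth(3)[OF op(1)[OF B]] by (simp add: Suc)
  have at: "g = fs (Suc i) \<or> g = opp C (fs i)" if "g \<in> bounded_flags C" "base C g = b (Suc i)" for g i
    using oth(4)[OF op(1)[OF B[of i]] that(1)] that(2) b_Suc by (auto simp: Suc)
  have bV: "b i \<in> verts C" for i using op(4)[OF B] by (simp add: b_def)
  have "\<exists>k>0. \<exists>j<k. b k = b j"
  proof -
    have "finite (verts C)" using fin by (simp add: finite_graph_def)
    then have "\<not> inj b" using bV by (metis finite_imageD finite_subset image_subsetI infinite_UNIV_nat)
    then obtain x y where "x \<noteq> y" "b x = b y" by (auto simp: inj_on_def)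
    then show ?thesis by (metis gr0I linorder_neqE_nat not_less0)
  qed
  define K where "K = (LEAST k. 0 < k \<and> (\<exists>j<k. b k = b j))"
  have K: "0 < K" "\<exists>j<K. b K = b j"
    using LeastI_ex[of "\<lambda>k. 0 < k \<and> (\<exists>j<k. b k = b j)"] \<open>\<exists>k>0. \<exists>j<k. b k = b j\<close>
    by (auto simp: K_def)
  have minK: "\<not> (\<exists>j<k. b k = b j)" if "k < K" for k
    using not_less_Least[of k "\<lambda>k. 0 < k \<and> (\<exists>j<k. b k = b j)"] that by (auto simp: K_def)
  have inj: "i = j" if "i < K" "j < K" "b i = b j" for i j
    using minK[OF that(1)] minK[OF that(2)] that(3) by (metis linorder_neqE_nat)
  obtain m where m: "K = Suc m" using K(1) by (cases K) auto
  obtain j where j: "j < K" "b K = b j" using K by blast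
  \<comment> \<open>The first repeated vertex is the starting vertex.\<close>
  have "j = 0"
  proof (rule ccontr)
    assume "j \<noteq> 0"
    then obtain i where i: "j = Suc i" by (cases j) auto
    have "opp C (fs m) = fs (Suc i) \<or> opp C (fs m) = opp C (fs i)"
      using at[OF op(1)[OF B]] b_Suc[of m] j(2) by (simp add: m i)
    then show False
    proof
      assume eq: "opp C (fs m) = fs (Suc i)"
      then have eq': "fs m = opp C (fs (Suc i))" using op(2)[OF B] by metis
      then have bm: "b m = b (Suc (Suc i))" by (simp add: b_Suc) (simp add: b_def)
      show False
      proof (cases "Suc i = m")
        case True then show False using eq op(3)[OF B] by simp
      next
        case False
        then have "Suc (Suc i) < K" using j(1) by (simp add: i m)
        then have "m = Suc (Suc i)" using inj[of m "Suc (Suc i)"] bm by (simp add: m)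
        then show False using eq' ne by simp
      qed
    next
      assume "opp C (fs m) = opp C (fs i)"
      then have "fs m = fs i" using op(2)[OF B] by metis
      then have "b m = b i" by (simp add: b_def)
      then have "m = i" using inj[of m i] j(1) by (simp add: m i)
      then show False using j(1) by (simp add: m i)
    qed
  qed
  then have bK: "b K = b 0" using j by simp
  \<comment> \<open>The traversal does not return along the edge of its first step.\<close>
  have ne0: "opp C (fs m) \<noteq> fs 0"
  proof
    assume eq: "opp C (fs m) = fs 0"
    then have eq': "fs m = opp C (fs 0)" using op(2)[OF B] by metis
    then have bm: "b m = b (Suc 0)" by (simp add: b_Suc) (simp add: b_def)
    show False
    proof (cases m)
      case 0 then show False using eq op(3)[OF B] by simp
    next
      case (Suc m')
      then have "m = Suc 0" using inj[of m "Suc 0"] bm by (simp add: m)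
      then show False using eq' ne by simp
    qed
  qed
  have at0: "g = fs 0 \<or> g = opp C (fs m)" if "g \<in> bounded_flags C" "base C g = b 0" for g
  proof -
    have "opp C (fs m) \<in> bounded_flags C" "base C (opp C (fs m)) = b 0"
      using op(1)[OF B] b_Suc[of m] bK by (simp_all add: m)
    then show ?thesis using oth(4)[OF B[of 0]] that ne0 by (metis b_def)
  qed
  have cover: "g \<in> fs ` {..<K} \<union> (\<lambda>i. opp C (fs i)) ` {..<K}"
    if g: "g \<in> bounded_flags C" "base C g \<in> b ` {..<K}" for g
  proof -
    obtain i where i: "i < K" "base C g = b i" using g(2) by auto
    show ?thesis
    proof (cases i)
      case 0
      then show ?thesis using at0[OF that(1)] i K(1) by (auto simp: m)
    next
      case (Suc i')
      then show ?thesis using at[OF that(1), of i'] i by auto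
    qed
  qed
  have b_mod: "base C (opp C (fs i)) = b (Suc i mod K)" if "i < K" for i
    using that b_Suc[of i] bK by (cases "Suc i = K") auto
  have V: "b ` {..<K} = verts C"
  proof
    show "b ` {..<K} \<subseteq> verts C" using bV by auto
    show "verts C \<subseteq> b ` {..<K}"
    proof
      fix v assume "v \<in> verts C"
      then have "(b 0, v) \<in> {(base C f, base C (opp C f)) |f. f \<in> bounded_flags C}\<^sup>*"
        using con bV[of 0] by (auto simp: connected_graph_def)
      then show "v \<in> b ` {..<K}"
      proof induction
        case base then show ?case using K(1) by auto
      next
        case (step y z)
        then obtain g where g: "g \<in> bounded_flags C" "y = base C g" "z = base C (opp C g)" by auto
        from cover[OF g(1)] step.IH g(2) consider i where "i < K" "g = fs i" | i where "i < K" "g = opp C (fs i)"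
          by auto
        then show ?case
        proof cases
          case 1 then show ?thesis using g b_mod[of i] K(1) by auto
        next
          case 2 then have "z = b i" using g op(2)[OF B] by (simp add: b_def)
          then show ?thesis using 2 by auto
        qed
      qed
    qed
  qed
  show ?thesis
  proof (rule that[of K fs])
    show "0 < K" by (rule K(1))
    show "bij_betw (\<lambda>i. base C (fs i)) {..<K} (verts C)"
      using V inj by (auto simp: bij_betw_def inj_on_def b_def)
    show "fs i \<in> bounded_flags C" if "i < K" for i by (rule B)
    show "base C (opp C (fs i)) = base C (fs (Suc i mod K))" if "i < K" for i
      using b_mod[OF that] by (simp add: b_def)
    show "bounded_flags C = fs ` {..<K} \<union> (\<lambda>i. opp C (fs i)) ` {..<K}"
      using cover B op V by auto
    show "fs i \<noteq> opp C (fs j)" if "i < K" "j < K" for i j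
    proof
      assume eq: "fs i = opp C (fs j)"
      then have bi: "b i = b (Suc j mod K)" using b_mod[OF that(2)] by (simp add: b_def)
      then have "i = Suc j mod K" using inj that(1) K(1) by simp
      then show False using eq ne[of j] ne0 that by (cases "Suc j = K") (auto simp: m)
    qed
  qed
qed

section \<open>Necklaces\<close>

text \<open>
  In a necklace the ends are numbered by their places in this list.  The first \<open>n\<close> are the marked ones.
\<close>

definition end_dirs :: "nat \<Rightarrow> nat \<Rightarrow> (int \<times> int) list" where
  "end_dirs n d = replicate n 0 @ replicate d (1, 1) @ replicate d (-1, 0) @ replicate d (0, -1)"

text \<open>
  The direction of the cycle after the \<open>t\<close>-th end of the list \<open>xs\<close>. The vector \<open>v\<close> is the direction before the
  first end and, as all end directions add up to zero, also the one after the last end.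
\<close>

definition edge_dir :: "(int \<times> int) list \<Rightarrow> nat list \<Rightarrow> int \<times> int \<Rightarrow> nat \<Rightarrow> int \<times> int" where
  "edge_dir ds xs v t = v - sum_list (map ((!) ds) (take (Suc t) xs))"

definition position :: "'a list \<Rightarrow> 'a \<Rightarrow> nat" where
  "position xs x = (THE t. t < length xs \<and> xs ! t = x)"

text \<open>
  Vertex \<open>t\<close> carries the end \<open>xs ! t\<close>, and an edge of the cycle leads from it to the cyclically next vertex.
  With \<open>N\<close> ends, the flags below \<open>N\<close> are the ends, and \<open>N + t\<close> and \<open>2 * N + t\<close> are the first and the
  second flag of the edge after vertex \<open>t\<close>; so \<open>Min e - N\<close> recovers \<open>t\<close> from this edge.
\<close>

definition necklace ::
  "nat \<Rightarrow> nat \<Rightarrow> nat list \<Rightarrow> int \<times> int \<Rightarrow> (nat \<Rightarrow> real) \<Rightarrow> (nat \<Rightarrow> real \<times> real) \<Rightarrow> curve" where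
  "necklace n d xs v l h = (let N = length xs; ds = end_dirs n d in
     \<lparr>verts = {..<N}, flags = {..<3 * N},
      base = (\<lambda>f. if f < N then position xs f else if f < 2 * N then f - N else Suc (f - 2 * N) mod N),
      opp = (\<lambda>f. if f < N then f else if f < 2 * N then f + N else f - N),
      marks = [0..<n],
      dir = (\<lambda>f. if f < N then ds ! f else if f < 2 * N then edge_dir ds xs v (f - N)
               else - edge_dir ds xs v (f - 2 * N)),
      len = (\<lambda>e. l (Min e - N)), pos = h\<rparr>)"

definition arrangement :: "nat \<Rightarrow> nat \<Rightarrow> nat list \<Rightarrow> bool" where
  "arrangement n d xs \<longleftrightarrow> distinct xs \<and> set xs = {..<n + 3 * d}"

definition closes ::
  "nat \<Rightarrow> nat \<Rightarrow> nat list \<Rightarrow> int \<times> int \<Rightarrow> (nat \<Rightarrow> real) \<Rightarrow> (nat \<Rightarrow> real \<times> real) \<Rightarrow> bool" where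
  "closes n d xs v l h \<longleftrightarrow>
     (\<forall>t<length xs. 0 \<le> l t) \<and> (\<exists>t<length xs. 0 < l t) \<and>
     (\<forall>t<length xs. h (Suc t mod length xs) = h t + l t *\<^sub>R real_vec (edge_dir (end_dirs n d) xs v t))"

lemma real_vec_simps [simp]:
  "real_vec 0 = 0" "real_vec (a + b) = real_vec a + real_vec b"
  "real_vec (- a) = - real_vec a" "real_vec (a - b) = real_vec a - real_vec b"
  by (cases a; cases b; simp add: real_vec_def zero_prod_def)+

lemma length_end_dirs [simp]: "length (end_dirs n d) = n + 3 * d"
  by (simp add: end_dirs_def)

lemma sum_list_replicate_pair: "sum_list (replicate k (a, b)) = (of_nat k * a, of_nat k * b)"
  for a b :: int
  by (induction k) (simp_all add: algebra_simps zero_prod_def)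

lemma sum_list_end_dirs: "sum_list (end_dirs n d) = 0"
proof -
  have "sum_list (replicate n (0 :: int \<times> int)) = 0" by (induction n) auto
  then show ?thesis by (simp add: end_dirs_def sum_list_replicate_pair) (simp add: zero_prod_def)
qed

lemma arrangement_length: "arrangement n d xs \<Longrightarrow> length xs = n + 3 * d"
  by (metis arrangement_def card_lessThan distinct_card)

lemma arrangement_mset: "arrangement n d xs \<longleftrightarrow> mset xs = mset [0..<n + 3 * d]"
  unfolding arrangement_def
  by (metis atLeast_upt distinct_upt mset_eq_imp_distinct_iff mset_eq_setD set_eq_iff_mset_eq_distinct)

lemma sum_list_arrangement:
  assumes "arrangement n d xs"
  shows "sum_list (map ((!) (end_dirs n d)) xs) = 0"
proof -
  have "mset (map ((!) (end_dirs n d)) xs) = mset (map ((!) (end_dirs n d)) [0..<length (end_dirs n d)])"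
    using assms unfolding arrangement_mset by simp
  then show ?thesis by (metis map_nth sum_list_end_dirs sum_mset_sum_list)
qed

lemma edge_dir_last:
  assumes "arrangement n d xs" "0 < length xs"
  shows "edge_dir (end_dirs n d) xs v (length xs - 1) = v"
  using assms sum_list_arrangement[OF assms(1)] by (simp add: edge_dir_def)

lemma edge_dir_Suc:
  assumes "Suc t < length xs"
  shows "edge_dir ds xs v (Suc t) = edge_dir ds xs v t - ds ! (xs ! Suc t)"
  using assms by (simp add: edge_dir_def take_Suc_conv_app_nth algebra_simps)

lemma position_eq:
  assumes "distinct xs" "t < length xs"
  shows "position xs (xs ! t) = t"
  unfolding position_def by (rule the_equality) (use assms in \<open>auto simp: nth_eq_iff_index_eq\<close>)

lemma position_nth:
  assumes "distinct xs" "x \<in> set xs"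
  shows "position xs x < length xs" "xs ! position xs x = x"
  using assms position_eq[OF assms(1)] by (auto simp: in_set_conv_nth)

lemma third_cases:
  fixes f N :: nat
  assumes "f < 3 * N"
  shows "f < N \<or> (\<exists>t<N. f = N + t) \<or> (\<exists>t<N. f = 2 * N + t)"
proof -
  have "f < N \<or> f = N + (f - N) \<and> f - N < N \<or> f = 2 * N + (f - 2 * N) \<and> f - 2 * N < N"
    using assms by arith
  then show ?thesis by blast
qed

context
  fixes n d :: nat and xs :: "nat list" and v :: "int \<times> int"
    and l :: "nat \<Rightarrow> real" and h :: "nat \<Rightarrow> real \<times> real" and N :: nat and F :: curve
  assumes arr: "arrangement n d xs" and d: "1 \<le> d" and cls: "closes n d xs v l h"
  defines "N \<equiv> length xs" and "F \<equiv> necklace n d xs v l h"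
begin

private lemma N_eq: "N = n + 3 * d" and N: "N \<ge> 3" "n \<le> N" "0 < N"
  using arrangement_length[OF arr] d by (auto simp: N_def)

private lemma xs: "distinct xs" "set xs = {..<N}"
  using arr by (auto simp: arrangement_def N_eq)

private lemma F_simps [simp]:
  "verts F = {..<N}" "flags F = {..<3 * N}"
  "base F f = (if f < N then position xs f else if f < 2 * N then f - N else Suc (f - 2 * N) mod N)"
  "opp F f = (if f < N then f else if f < 2 * N then f + N else f - N)"
  "marks F = [0..<n]"
  "dir F f = (if f < N then end_dirs n d ! f else if f < 2 * N then edge_dir (end_dirs n d) xs v (f - N)
               else - edge_dir (end_dirs n d) xs v (f - 2 * N))"
  "len F e = l (Min e - N)" "pos F = h"
  by (simp_all add: F_def necklace_def Let_def N_def)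

private lemma flag_cases:
  assumes "f < 3 * N"
  obtains "f < N" | t where "t < N" "f = N + t" | t where "t < N" "f = 2 * N + t"
  using third_cases[OF assms] that by blast

lemma necklace_bounded: "bounded_flags F = (\<lambda>t. N + t) ` {..<N} \<union> (\<lambda>t. 2 * N + t) ` {..<N}"
proof -
  have "bounded_flags F = {N..<3 * N}" using N by (auto simp: bounded_flags_def)
  also have "\<dots> = (\<lambda>t. N + t) ` {..<N} \<union> (\<lambda>t. 2 * N + t) ` {..<N}"
    by (auto elim!: flag_cases)
  finally show ?thesis .
qed

lemma necklace_unbounded: "unbounded_edges F = {..<N}"
  using N by (auto simp: unbounded_edges_def split: if_splits)

lemma necklace_flag_edge:
  "t < N \<Longrightarrow> flag_edge F (N + t) = {N + t, 2 * N + t}" "t < N \<Longrightarrow> flag_edge F (2 * N + t) = {N + t, 2 * N + t}"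
  by (auto simp: flag_edge_def)

lemma necklace_finite: "finite_graph F"
  unfolding finite_graph_def
proof (intro conjI ballI)
  fix f assume "f \<in> flags F"
  then have "f < 3 * N" by simp
  moreover have "position xs f < N" if "f < N" using position_nth(1)[of xs f] xs that by (simp add: N_def)
  ultimately show "base F f \<in> verts F" "opp F f \<in> flags F" "opp F (opp F f) = f"
    using N(3) by (auto elim!: flag_cases)
qed auto

private lemma connected_F: "connected_graph F"
proof -
  let ?R = "{(base F f, base F (opp F f)) |f. f \<in> bounded_flags F}"
  have step: "(t, Suc t mod N) \<in> ?R" "(Suc t mod N, t) \<in> ?R" if "t < N" for t
  proof -
    show "(t, Suc t mod N) \<in> ?R"
      by (rule CollectI, rule exI[of _ "N + t"]) (use that in \<open>simp add: necklace_bounded\<close>)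
    show "(Suc t mod N, t) \<in> ?R"
      by (rule CollectI, rule exI[of _ "2 * N + t"]) (use that in \<open>simp add: necklace_bounded\<close>)
  qed
  have z: "(0, t) \<in> ?R\<^sup>* \<and> (t, 0) \<in> ?R\<^sup>*" if "t < N" for t
    using that
  proof (induction t)
    case (Suc t)
    then have "(t, Suc t) \<in> ?R" "(Suc t, t) \<in> ?R" using step[of t] by auto
    then show ?case using Suc by (meson Suc_lessD converse_rtrancl_into_rtrancl rtrancl_into_rtrancl)
  qed simp
  have "(u, v) \<in> ?R\<^sup>*" if "u \<in> verts F" "v \<in> verts F" for u v
    by (rule rtrancl_trans[OF conjunct2[OF z] conjunct1[OF z]]) (use that in simp_all)
  moreover have "verts F \<noteq> {}" using N(3) by auto
  ultimately show ?thesis unfolding connected_graph_def by blast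
qed

lemma necklace_fits: "fits F (len F) (pos F)"
  unfolding fits_def necklace_bounded
proof (intro ballI)
  fix f assume "f \<in> (\<lambda>t. N + t) ` {..<N} \<union> (\<lambda>t. 2 * N + t) ` {..<N}"
  then obtain t where t: "t < N" "f = N + t \<or> f = 2 * N + t" by auto
  have "h (Suc t mod N) = h t + l t *\<^sub>R real_vec (edge_dir (end_dirs n d) xs v t)"
    using cls t by (auto simp: closes_def N_def)
  moreover have "len F (flag_edge F f) = l t" using t by (auto simp: necklace_flag_edge)
  ultimately show "pos F (base F (opp F f)) = pos F (base F f) + len F (flag_edge F f) *\<^sub>R real_vec (dir F f)"
    using t by (auto simp del: F_simps(7))
qed

private lemma flags_at_F:
  assumes "t < N"
  shows "flags_at F t = {xs ! t, N + t, 2 * N + (if t = 0 then N - 1 else t - 1)}"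
proof -
  have x: "xs ! t < N" using assms xs by (metis N_def lessThan_iff nth_mem)
  have p: "position xs f = t \<longleftrightarrow> f = xs ! t" if "f < N" for f
  proof
    assume "position xs f = t"
    then show "f = xs ! t" using position_nth(2)[of xs f] xs that by simp
  next
    assume "f = xs ! t"
    then show "position xs f = t" using position_eq[of xs t] xs(1) assms by (simp add: N_def)
  qed
  have s: "Suc u mod N = t \<longleftrightarrow> u = (if t = 0 then N - 1 else t - 1)" if "u < N" for u
    using that assms N by (cases "Suc u = N") auto
  show ?thesis
  proof (intro set_eqI iffI)
    fix f assume "f \<in> flags_at F t"
    then have f: "f < 3 * N" "base F f = t" by (auto simp: flags_at_def)
    from f(1) show "f \<in> {xs ! t, N + t, 2 * N + (if t = 0 then N - 1 else t - 1)}"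
      by (rule flag_cases) (use f(2) p s in auto)
  next
    fix f assume "f \<in> {xs ! t, N + t, 2 * N + (if t = 0 then N - 1 else t - 1)}"
    then show "f \<in> flags_at F t"
      using p[OF x] x assms s[of "if t = 0 then N - 1 else t - 1"] N by (auto simp: flags_at_def)
  qed
qed

lemma necklace_weak: "F \<in> weak_curves n d"
proof -
  have "set (marks F) \<subseteq> unbounded_edges F" "distinct (marks F)" "length (marks F) = n"
    using N by (auto simp: necklace_unbounded)
  moreover have "\<forall>e\<in>bounded_edges F. 0 \<le> len F e"
    using cls by (auto simp: bounded_edges_def necklace_bounded necklace_flag_edge closes_def N_def[symmetric])
  moreover have "\<forall>f\<in>bounded_flags F. dir F (opp F f) = - dir F f"
    by (auto simp: necklace_bounded)
  moreover have "\<forall>f\<in>set (marks F). dir F f = 0"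
    using N by (auto simp: end_dirs_def nth_append)
  moreover have "\<forall>t\<in>verts F. (\<Sum>f\<in>flags_at F t. dir F f) = 0"
  proof
    fix t assume "t \<in> verts F"
    then have t: "t < N" by simp
    have x: "xs ! t < N" using t xs by (metis N_def lessThan_iff nth_mem)
    have "(\<Sum>f\<in>flags_at F t. dir F f) = end_dirs n d ! (xs ! t) + edge_dir (end_dirs n d) xs v t
        - edge_dir (end_dirs n d) xs v (if t = 0 then N - 1 else t - 1)"
      unfolding flags_at_F[OF t] using t x by auto
    also have "\<dots> = 0"
    proof (cases t)
      case 0
      have "edge_dir (end_dirs n d) xs v (N - 1) = v" using edge_dir_last[OF arr] N by (simp add: N_def)
      moreover have "edge_dir (end_dirs n d) xs v 0 = v - end_dirs n d ! (xs ! 0)"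
        using N by (cases xs) (auto simp: edge_dir_def N_def)
      ultimately show ?thesis by (simp add: 0)
    next
      case (Suc s)
      then show ?thesis using edge_dir_Suc[of s xs] t by (simp add: N_def)
    qed
    finally show "(\<Sum>f\<in>flags_at F t. dir F f) = 0" .
  qed
  moreover have "has_degree d F"
  proof -
    have U: "unbounded_edges F - set (marks F) = set [n..<N]" using N by (auto simp: necklace_unbounded)
    have "image_mset (dir F) (mset_set (set [n..<N])) = image_mset ((!) (end_dirs n d)) (mset [n..<N])"
      by (subst mset_set_set) (auto intro!: image_mset_cong)
    also have "\<dots> = mset (drop n (map ((!) (end_dirs n d)) [0..<N]))"
      by (simp add: drop_map)
    also have "map ((!) (end_dirs n d)) [0..<N] = end_dirs n d"
      using map_nth[of "end_dirs n d"] by (simp add: N_eq)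
    also have "mset (drop n (end_dirs n d)) =
       replicate_mset d (1, 1) + replicate_mset d (-1, 0) + replicate_mset d (0, -1)"
      by (simp add: end_dirs_def)
    finally show ?thesis unfolding has_degree_def U .
  qed
  ultimately show ?thesis
    using necklace_finite connected_F necklace_fits by (simp add: weak_curves_def)
qed

lemma necklace_contracted_flags:
  "contracted_flags F = (\<lambda>t. N + t) ` {t. t < N \<and> l t = 0} \<union> (\<lambda>t. 2 * N + t) ` {t. t < N \<and> l t = 0}"
  unfolding contracted_flags_def necklace_bounded by (auto simp: necklace_flag_edge)

lemma necklace_contracted_rel:
  "contracted_rel F = (\<Union>t\<in>{t. t < N \<and> l t = 0}. {(t, Suc t mod N), (Suc t mod N, t)})"
proof -
  have "contracted_rel F = (\<lambda>f. (base F f, base F (opp F f))) ` contracted_flags F"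
    unfolding contracted_rel_def by blast
  also have "\<dots> = (\<lambda>t. (base F (N + t), base F (opp F (N + t)))) ` {t. t < N \<and> l t = 0} \<union>
     (\<lambda>t. (base F (2 * N + t), base F (opp F (2 * N + t)))) ` {t. t < N \<and> l t = 0}"
    unfolding necklace_contracted_flags by (simp only: image_Un image_image)
  also have "(\<lambda>t. (base F (N + t), base F (opp F (N + t)))) ` {t. t < N \<and> l t = 0} =
     (\<lambda>t. (t, Suc t mod N)) ` {t. t < N \<and> l t = 0}"
    by (rule image_cong) auto
  also have "(\<lambda>t. (base F (2 * N + t), base F (opp F (2 * N + t)))) ` {t. t < N \<and> l t = 0} =
     (\<lambda>t. (Suc t mod N, t)) ` {t. t < N \<and> l t = 0}"
    by (rule image_cong) auto
  finally show ?thesis by blast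
qed

lemma necklace_merged_Suc:
  assumes "t < N" "l t = 0"
  shows "merged_vertex F (Suc t mod N) = merged_vertex F t"
proof -
  have "(Suc t mod N, t) \<in> contracted_rel F" using assms by (auto simp: necklace_contracted_rel)
  then show ?thesis unfolding merged_vertex_eq_iff[OF necklace_finite] by (rule r_into_rtrancl)
qed

private definition "S = {t. t < N \<and> l t \<noteq> 0}"

private lemma S: "S \<noteq> {}" "finite S" "S \<subseteq> {..<N}"
  using cls by (auto simp: S_def closes_def N_def)

text \<open>
  Walking forward along contracted edges ends at an edge of positive length, and so does walking backward.
  Thus each merged vertex has a flag of each kind, in addition to its ends.
\<close>

private lemma merged_forward: "t < N \<Longrightarrow> \<exists>s\<in>S. merged_vertex F s = merged_vertex F t"
proof -
  obtain s0 where s0: "s0 \<in> S" using S by auto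
  have "t < N \<Longrightarrow> (t + k) mod N = s0 \<Longrightarrow> \<exists>s\<in>S. merged_vertex F s = merged_vertex F t" for k t
  proof (induction k arbitrary: t)
    case 0
    then show ?case using s0 by auto
  next
    case (Suc k)
    show ?case
    proof (cases "t \<in> S")
      case False
      then have "l t = 0" using Suc.prems by (auto simp: S_def)
      from necklace_merged_Suc[OF Suc.prems(1) this] Suc.IH[of "Suc t mod N"] Suc.prems N show ?thesis
        by (auto simp: mod_simps)
    qed auto
  qed
  moreover have "(t + (N - t + s0)) mod N = s0" if "t < N"
    using that s0 S by auto
  ultimately show "t < N \<Longrightarrow> \<exists>s\<in>S. merged_vertex F s = merged_vertex F t" by blast
qed

private lemma merged_backward: "t < N \<Longrightarrow> \<exists>s\<in>S. merged_vertex F (Suc s mod N) = merged_vertex F t"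
proof -
  obtain s0 where s0: "s0 \<in> S" using S by auto
  have "\<exists>s\<in>S. merged_vertex F (Suc s mod N) = merged_vertex F ((Suc s0 + k) mod N)" for k
  proof (induction k)
    case 0
    then show ?case using s0 by auto
  next
    case (Suc k)
    let ?u = "(Suc s0 + k) mod N"
    have u: "?u < N" "Suc ?u mod N = (Suc s0 + Suc k) mod N" using N by (auto simp: mod_simps)
    show ?case
    proof (cases "?u \<in> S")
      case True
      then show ?thesis using u by metis
    next
      case False
      then have "l ?u = 0" using u by (auto simp: S_def)
      from necklace_merged_Suc[OF u(1) this] Suc.IH u show ?thesis by metis
    qed
  qed
  moreover have "(Suc s0 + (t + N - Suc s0)) mod N = t" if "t < N"
    using that s0 S by auto
  ultimately show "t < N \<Longrightarrow> \<exists>s\<in>S. merged_vertex F (Suc s mod N) = merged_vertex F t" by metis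
qed

text \<open>
  The number \<open>c t\<close> of edges of positive length before \<open>t\<close>, taken modulo the total number of such edges, is
  constant along contracted edges, also on the way from the last vertex to the first one.  It separates the
  edges of positive length, so that after contraction there are as many vertices as edges.
\<close>

private lemma merged_inj: "inj_on (merged_vertex F) S"
proof (rule inj_onI)
  define c where "c t = card {s \<in> S. s < t}" for t
  have c_Suc: "c (Suc t) = c t" if "l t = 0" for t
  proof -
    have "{s \<in> S. s < Suc t} = {s \<in> S. s < t}" using that by (auto simp: S_def less_Suc_eq)
    then show ?thesis by (simp add: c_def)
  qed
  have cN: "c N = card S" using S by (auto simp: c_def intro!: arg_cong[of _ _ card])
  have step: "c (Suc t mod N) mod card S = c t mod card S" if "t < N" "l t = 0" for t
  proof (cases "Suc t = N")
    case True
    then have "c t = card S" using c_Suc[OF that(2)] cN by simp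
    moreover have "c 0 = 0" by (simp add: c_def)
    ultimately show ?thesis using True by simp
  next
    case False
    then show ?thesis using that c_Suc by simp
  qed
  have inv: "c t mod card S = c t' mod card S" if "(t, t') \<in> (contracted_rel F)\<^sup>*" for t t'
    using that by induction (use step in \<open>auto simp: necklace_contracted_rel\<close>)
  have less: "c s < c t" if "s \<in> S" "s < t" for s t
  proof -
    have "{u \<in> S. u < s} \<subset> {u \<in> S. u < t}" using that by auto
    then show ?thesis unfolding c_def using S by (intro psubset_card_mono) auto
  qed
  fix s s' assume s: "s \<in> S" "s' \<in> S" "merged_vertex F s = merged_vertex F s'"
  have "c s < card S" "c s' < card S" using less[of s N] less[of s' N] s S cN by auto
  moreover have "c s mod card S = c s' mod card S"
    using inv s(3) merged_vertex_eq_iff[OF necklace_finite] by blast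
  ultimately have "c s = c s'" by simp
  then show "s = s'" using less[of s s'] less[of s' s] s by (metis less_irrefl linorder_neqE_nat)
qed

lemma contract_necklace: "contract F \<in> genus_one_curves n d"
proof (rule contract_genus_one[OF necklace_weak])
  have V: "verts (contract F) = merged_vertex F ` S"
    using merged_forward S by (auto simp: image_iff) metis
  have bf: "bounded_flags (contract F) = (\<lambda>t. N + t) ` S \<union> (\<lambda>t. 2 * N + t) ` S"
    unfolding bounded_flags_contract necklace_bounded necklace_contracted_flags by (auto simp: S_def)
  have "bounded_edges (contract F) = (\<lambda>t. {N + t, 2 * N + t}) ` S"
  proof -
    have "flag_edge F ` ((\<lambda>t. N + t) ` S) = (\<lambda>t. {N + t, 2 * N + t}) ` S"
      "flag_edge F ` ((\<lambda>t. 2 * N + t) ` S) = (\<lambda>t. {N + t, 2 * N + t}) ` S"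
      unfolding image_image by (rule image_cong; use S necklace_flag_edge in auto)+
    then show ?thesis unfolding bounded_edges_def bf by (simp add: image_Un)
  qed
  moreover have "inj_on (\<lambda>t. {N + t, 2 * N + t}) S"
    using S by (auto simp: inj_on_def doubleton_eq_iff)
  ultimately show "genus (contract F) = 1"
    by (simp add: genus_def V[simplified] card_image merged_inj)
  fix x assume "x \<in> verts (contract F)"
  then obtain s where s: "s \<in> S" "x = merged_vertex F s" using V by auto
  have sN: "s < N" using s S by auto
  obtain s' where s': "s' \<in> S" "merged_vertex F (Suc s' mod N) = x"
    using merged_backward[OF sN] s by auto
  have s'N: "s' < N" using s' S by auto
  have xs: "xs ! s < N" "position xs (xs ! s) = s"
    using sN xs position_eq[of xs s] nth_mem[of s xs] by (simp_all add: N_def)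
  have "{xs ! s, N + s, 2 * N + s'} \<subseteq> flags_at (contract F) x"
    unfolding flags_at_def necklace_contracted_flags contract_simps
    using s s' sN s'N xs by (auto simp: S_def necklace_contracted_flags)
  moreover have "finite (flags_at (contract F) x)" by (auto simp: flags_at_def)
  moreover have "card {xs ! s, N + s, 2 * N + s'} = 3" using xs sN s'N by auto
  ultimately show "3 \<le> valence (contract F) x" unfolding valence_def by (metis card_mono)
qed

end

lemma necklace_simps [simp]:
  "verts (necklace n d xs v l h) = {..<length xs}"
  "flags (necklace n d xs v l h) = {..<3 * length xs}"
  "base (necklace n d xs v l h) f =
     (if f < length xs then position xs f else if f < 2 * length xs then f - length xs
      else Suc (f - 2 * length xs) mod length xs)"
  "opp (necklace n d xs v l h) f =
     (if f < length xs then f else if f < 2 * length xs then f + length xs else f - length xs)"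
  "marks (necklace n d xs v l h) = [0..<n]"
  "dir (necklace n d xs v l h) f =
     (if f < length xs then end_dirs n d ! f
      else if f < 2 * length xs then edge_dir (end_dirs n d) xs v (f - length xs)
      else - edge_dir (end_dirs n d) xs v (f - 2 * length xs))"
  "len (necklace n d xs v l h) e = l (Min e - length xs)"
  "pos (necklace n d xs v l h) = h"
  by (simp_all add: necklace_def Let_def)

section \<open>Changing the lengths and the order of a necklace\<close>

lemma necklace_update:
  "(necklace n d xs v l h)\<lparr>len := len (necklace n d xs v l' h'), pos := h'\<rparr> = necklace n d xs v l' h'"
  by (simp add: necklace_def Let_def)

text \<open>
  Contracting the remaining edges of length zero in a second stage turns the first curve into the second one.
\<close>

lemma necklace_degenerate:
  assumes arr: "arrangement n d xs" and d: "1 \<le> d"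
    and c: "closes n d xs v l h" and c': "closes n d xs v l' h'"
    and z: "\<And>t. t < length xs \<Longrightarrow> l t = 0 \<Longrightarrow> l' t = 0"
  shows "linked n d (contract (necklace n d xs v l h)) (contract (necklace n d xs v l' h'))"
proof -
  let ?F = "necklace n d xs v l h" and ?F' = "necklace n d xs v l' h'"
  have fin: "finite_graph ?F" by (rule necklace_finite[OF arr d c])
  have "fits ?F' (len ?F') (pos ?F')" by (rule necklace_fits[OF arr d c'])
  then have fits: "fits ?F (len ?F') h'" by (simp add: fits_def bounded_flags_def flag_edge_def)
  have e: "\<exists>t<length xs. e = {length xs + t, 2 * length xs + t}" if "e \<in> bounded_edges ?F" for e
    using that necklace_flag_edge[OF arr d c]
    by (auto simp: bounded_edges_def necklace_bounded[OF arr d c])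
  have z': "len ?F' e = 0" if "e \<in> bounded_edges ?F" "len ?F e = 0" for e
    using e[OF that(1)] that(2) z by auto
  have con: "contract ?F' \<in> genus_one_curves n d" by (rule contract_necklace[OF arr d c'])
  have sub: "bounded_edges (contract ?F) \<subseteq> bounded_edges ?F"
    by (auto simp: bounded_edges_def bounded_flags_contract)
  have nn: "0 \<le> len ?F' e" if "e \<in> bounded_edges (contract ?F)" for e
  proof -
    have "e \<in> bounded_edges ?F" using sub that by blast
    from e[OF this] obtain t where "t < length xs" "e = {length xs + t, 2 * length xs + t}" by blast
    then show ?thesis using c' by (simp add: closes_def)
  qed
  have col: "collapse ((contract ?F)\<lparr>len := len ?F', pos := h'\<rparr>) (contract ?F')"
    using contract_relengthen(2)[OF fin fits z'] by (simp only: necklace_update)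
  show ?thesis
    using linked_degeneration[OF contract_necklace[OF arr d c] contract_relengthen(1)[OF fin fits z'] nn con col] .
qed

text \<open>
  At the mean of two length functions an edge has length zero only if it has length zero for both of them, so
  the two given curves are degenerations of a common one.
\<close>

lemma necklace_lengths_linked:
  assumes arr: "arrangement n d xs" and d: "1 \<le> d"
    and c: "closes n d xs v l h" and c': "closes n d xs v l' h'"
  shows "linked n d (contract (necklace n d xs v l h)) (contract (necklace n d xs v l' h'))"
proof -
  define l'' where "l'' t = (l t + l' t) / 2" for t
  define h'' where "h'' t = (1 / 2) *\<^sub>R (h t + h' t)" for t
  have nn: "0 \<le> l t" "0 \<le> l' t" if "t < length xs" for t
    using c c' that by (auto simp: closes_def)
  have c'': "closes n d xs v l'' h''"
    unfolding closes_def
  proof (intro conjI allI impI)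
    show "\<exists>t<length xs. 0 < l'' t"
      using c nn by (auto simp: closes_def l''_def intro!: add_pos_nonneg)
    fix t assume t: "t < length xs"
    show "0 \<le> l'' t" using nn[OF t] by (simp add: l''_def)
    have "h (Suc t mod length xs) = h t + l t *\<^sub>R real_vec (edge_dir (end_dirs n d) xs v t)"
      "h' (Suc t mod length xs) = h' t + l' t *\<^sub>R real_vec (edge_dir (end_dirs n d) xs v t)"
      using c c' t by (auto simp: closes_def)
    then show "h'' (Suc t mod length xs) = h'' t + l'' t *\<^sub>R real_vec (edge_dir (end_dirs n d) xs v t)"
      by (simp add: h''_def l''_def algebra_simps add_divide_distrib)
  qed
  have z: "l t = 0" "l' t = 0" if "t < length xs" "l'' t = 0" for t
    using nn[OF that(1)] that(2) by (simp_all add: l''_def)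
  show ?thesis
    using necklace_degenerate[OF arr d c'' c z(1)] necklace_degenerate[OF arr d c'' c' z(2)]
      linked_sym linked_trans by blast
qed

text \<open>
  By \<open>necklace_lengths_linked\<close> the component reached by an arrangement with given directions does not depend on
  the lengths.  Therefore one choice of lengths on either side is enough, and the relation is transitive.
\<close>

definition deformable :: "nat \<Rightarrow> nat \<Rightarrow> nat list \<Rightarrow> int \<times> int \<Rightarrow> nat list \<Rightarrow> int \<times> int \<Rightarrow> bool" where
  "deformable n d xs v xs' v' \<longleftrightarrow> arrangement n d xs \<and> arrangement n d xs' \<and>
     (\<exists>l h l' h'. closes n d xs v l h \<and> closes n d xs' v' l' h' \<and>
       linked n d (contract (necklace n d xs v l h)) (contract (necklace n d xs' v' l' h')))"

lemma deformable_trans: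
  assumes "1 \<le> d" "deformable n d xs v xs' v'" "deformable n d xs' v' xs'' v''"
  shows "deformable n d xs v xs'' v''"
proof -
  from assms(2) obtain l h l1 h1 where 1: "arrangement n d xs" "arrangement n d xs'" "closes n d xs v l h"
      "closes n d xs' v' l1 h1" "linked n d (contract (necklace n d xs v l h)) (contract (necklace n d xs' v' l1 h1))"
    by (auto simp: deformable_def)
  from assms(3) obtain l2 h2 l3 h3 where 2: "arrangement n d xs''" "closes n d xs' v' l2 h2"
      "closes n d xs'' v'' l3 h3" "linked n d (contract (necklace n d xs' v' l2 h2)) (contract (necklace n d xs'' v'' l3 h3))"
    by (auto simp: deformable_def)
  have "linked n d (contract (necklace n d xs' v' l1 h1)) (contract (necklace n d xs' v' l2 h2))"
    by (rule necklace_lengths_linked[OF 1(2) assms(1) 1(4) 2(2)])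
  then show ?thesis unfolding deformable_def using 1 2 linked_trans by blast
qed

lemma merged_vertex_contracted_rel:
  "merged_vertex C v = (LEAST w. (v, w) \<in> (contracted_rel C)\<^sup>*)"
  by (simp add: merged_vertex_def contracted_rel_def)

lemma position_append:
  assumes "distinct (ys @ zs)"
  shows "x \<in> set ys \<Longrightarrow> position (ys @ zs) x < length ys"
    "x \<in> set zs \<Longrightarrow> position (ys @ zs) x = length ys + position zs x"
proof -
  assume "x \<in> set ys"
  then obtain t where "t < length ys" "x = ys ! t" by (auto simp: in_set_conv_nth)
  then show "position (ys @ zs) x < length ys"
    using position_eq[OF assms, of t] by (simp add: nth_append)
next
  assume "x \<in> set zs"
  then obtain t where "t < length zs" "x = zs ! t" by (auto simp: in_set_conv_nth)
  then show "position (ys @ zs) x = length ys + position zs x"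
    using position_eq[OF assms, of "length ys + t"] position_eq[of zs t] assms by (simp add: nth_append)
qed

text \<open>
  All ends of the block \<open>ys\<close> are at the same vertex after contraction.  The directions
  of the edges inside the block change with the order, but these edges have length zero.
\<close>

lemma reorder_block:
  assumes arr: "arrangement n d (ys @ zs)" and d: "1 \<le> d" and m: "mset ys' = mset ys"
    and c: "closes n d (ys @ zs) v l h"
    and z: "\<And>t. Suc t < length ys \<Longrightarrow> l t = 0"
  shows "deformable n d (ys @ zs) v (ys' @ zs) v"
proof -
  let ?ds = "end_dirs n d"
  have arr': "arrangement n d (ys' @ zs)" using arr m by (simp add: arrangement_mset)
  have len: "length ys' = length ys" using m by (rule mset_eq_length)
  have set: "set ys' = set ys" using m by (rule mset_eq_setD)
  have ed: "edge_dir ?ds (ys' @ zs) v t = edge_dir ?ds (ys @ zs) v t" if "\<not> Suc t < length ys" for t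
  proof -
    have "sum_list (map ((!) ?ds) ys') = sum_list (map ((!) ?ds) ys)"
      by (metis m mset_map sum_mset_sum_list)
    then show ?thesis using that len by (simp add: edge_dir_def)
  qed
  have scaled: "l t *\<^sub>R real_vec (edge_dir ?ds (ys' @ zs) v t) = l t *\<^sub>R real_vec (edge_dir ?ds (ys @ zs) v t)" for t
    using ed[of t] z[of t] by (cases "Suc t < length ys") auto
  have c': "closes n d (ys' @ zs) v l h" using c by (simp add: closes_def len scaled)
  let ?F = "necklace n d (ys @ zs) v l h" and ?F' = "necklace n d (ys' @ zs) v l h"
  let ?N = "length (ys @ zs)"
  have N: "length (ys' @ zs) = ?N" using len by simp
  have rel: "contracted_rel ?F' = contracted_rel ?F"
    unfolding necklace_contracted_rel[OF arr d c] necklace_contracted_rel[OF arr' d c'] N ..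
  then have mv: "merged_vertex ?F' = merged_vertex ?F"
    by (intro ext) (simp add: merged_vertex_contracted_rel)
  have zf: "contracted_flags ?F' = contracted_flags ?F"
    unfolding necklace_contracted_flags[OF arr d c] necklace_contracted_flags[OF arr' d c'] N ..
  have block: "merged_vertex ?F t = merged_vertex ?F 0" if "t < length ys" for t
    using that
  proof (induction t)
    case (Suc t)
    then have "merged_vertex ?F (Suc t mod ?N) = merged_vertex ?F t"
      using z[of t] by (intro necklace_merged_Suc[OF arr d c]) auto
    then show ?case using Suc by simp
  qed simp
  have pos: "merged_vertex ?F (position (ys' @ zs) f) = merged_vertex ?F (position (ys @ zs) f)"
    if "f < ?N" for f
  proof -
    have d1: "distinct (ys @ zs)" "distinct (ys' @ zs)" using arr arr' by (auto simp: arrangement_def)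
    have "f \<in> set ys \<union> set zs"
      using that arr arrangement_length[OF arr] by (auto simp: arrangement_def)
    then show ?thesis
      using position_append[OF d1(1), of f] position_append[OF d1(2), of f] block len set
      by auto
  qed
  have base: "merged_vertex ?F (base ?F' f) = merged_vertex ?F (base ?F f)" for f
    using pos[of f] N by simp
  have dir: "dir ?F' f = dir ?F f" if "f \<in> flags ?F - contracted_flags ?F" for f
  proof -
    have lt: "edge_dir ?ds (ys' @ zs) v t = edge_dir ?ds (ys @ zs) v t" if "t < ?N" "l t \<noteq> 0" for t
      using z[of t] ed[of t] that by blast
    have "f < 3 * ?N" using that by simp
    then consider "f < ?N" | t where "t < ?N" "f = ?N + t" | t where "t < ?N" "f = 2 * ?N + t"
      using third_cases by blast
    then show ?thesis
    proof cases
      case 2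
      then have "l t \<noteq> 0" using that by (auto simp: necklace_contracted_flags[OF arr d c])
      then show ?thesis using lt[OF 2(1)] 2 N by simp
    next
      case 3
      then have "l t \<noteq> 0" using that by (auto simp: necklace_contracted_flags[OF arr d c])
      then show ?thesis using lt[OF 3(1)] 3 N by simp
    qed (use N in simp)
  qed
  have "isomorphic (contract ?F) (contract ?F')"
    unfolding isomorphic_def
  proof (rule exI[of _ id], rule exI[of _ id], intro conjI ballI)
    show "bij_betw id (verts (contract ?F)) (verts (contract ?F'))"
      "bij_betw id (flags (contract ?F)) (flags (contract ?F'))"
      unfolding contract_simps mv zf using N by simp_all
    fix f assume f: "f \<in> flags (contract ?F)"
    show "base (contract ?F') (id f) = id (base (contract ?F) f)"
      unfolding contract_simps mv using base[of f] by simp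
    show "opp (contract ?F') (id f) = id (opp (contract ?F) f)" using N by simp
    show "dir (contract ?F') (id f) = dir (contract ?F) f" using dir[of f] f by simp
  next
    fix f assume "f \<in> bounded_flags (contract ?F)"
    show "len (contract ?F') (flag_edge (contract ?F') (id f)) = len (contract ?F) (flag_edge (contract ?F) f)"
      using N by (simp add: flag_edge_def)
  qed simp_all
  then show ?thesis unfolding deformable_def
    using linked_isomorphic[OF contract_necklace[OF arr d c]] arr arr' c c' by blast
qed

text \<open>
  The same necklace, read from its second vertex.
\<close>

lemma rotate_necklace:
  assumes arr: "arrangement n d (x # ys)" and d: "1 \<le> d" and c: "closes n d (x # ys) v l h"
  shows "deformable n d (x # ys) v (ys @ [x]) (v - end_dirs n d ! x)"
proof -
  let ?ds = "end_dirs n d"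
  define N where "N = length (x # ys)"
  define s where "s t = Suc t mod N" for t
  define v' where "v' = v - ?ds ! x"
  define l' where "l' = l \<circ> s"
  define h' where "h' = h \<circ> s"
  have N: "0 < N" "length (x # ys) = N" "length (ys @ [x]) = N" by (simp_all add: N_def)
  have arr': "arrangement n d (ys @ [x])" using arr by (simp add: arrangement_mset)
  have sN: "s t < N" for t using N by (simp add: s_def)
  have s_cases: "s t = Suc t \<and> Suc t < N \<or> s t = 0 \<and> t = N - 1" if "t < N" for t
    using that by (cases "Suc t = N") (auto simp: s_def)
  have ed: "edge_dir ?ds (ys @ [x]) v' t = edge_dir ?ds (x # ys) v (s t)" if t: "t < N" for t
  proof (cases "Suc t = N")
    case True
    then have "t = length (ys @ [x]) - 1" by (simp add: N_def)
    then have "edge_dir ?ds (ys @ [x]) v' t = v'" using edge_dir_last[OF arr'] by simp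
    then show ?thesis using True by (simp add: s_def edge_dir_def v'_def)
  next
    case False
    then have "s t = Suc t" "Suc t < N" using t by (simp_all add: s_def)
    then show ?thesis by (simp add: edge_dir_def v'_def N_def algebra_simps)
  qed
  have bij: "bij_betw s {..<N} {..<N}"
  proof (rule bij_betw_imageI)
    show inj: "inj_on s {..<N}"
      using s_cases by (intro inj_onI) (metis Suc_inject lessThan_iff nat.simps(3))
    show "s ` {..<N} = {..<N}"
      by (rule endo_inj_surj[OF _ _ inj]) (use sN in auto)
  qed
  have c': "closes n d (ys @ [x]) v' l' h'"
    unfolding closes_def N(3)
  proof (intro conjI allI impI)
    obtain t where t: "t < N" "0 < l t" using c by (auto simp: closes_def N_def)
    then have "t \<in> s ` {..<N}" using bij by (auto simp: bij_betw_def)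
    then show "\<exists>t<N. 0 < l' t" using t by (auto simp: l'_def)
    fix t assume t: "t < N"
    show "0 \<le> l' t" using c sN[of t] by (auto simp: l'_def closes_def N_def)
    have "h (Suc (s t) mod N) = h (s t) + l (s t) *\<^sub>R real_vec (edge_dir ?ds (x # ys) v (s t))"
      using c sN[of t] by (auto simp: closes_def N_def)
    then show "h' (Suc t mod N) = h' t + l' t *\<^sub>R real_vec (edge_dir ?ds (ys @ [x]) v' t)"
      unfolding ed[OF t] by (simp add: h'_def l'_def) (simp add: s_def)
  qed
  let ?F = "necklace n d (x # ys) v l h" and ?F' = "necklace n d (ys @ [x]) v' l' h'"
  define \<psi> where "\<psi> f = (if f < N then f else if f < 2 * N then N + s (f - N) else 2 * N + s (f - 2 * N))" for f
  have dist: "distinct (x # ys)" "distinct (ys @ [x])" using arr by (auto simp: arrangement_def)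
  have set: "set (x # ys) = {..<N}" using arr arrangement_length[OF arr] by (simp add: arrangement_def N_def)
  have pos: "position (x # ys) f = s (position (ys @ [x]) f)" if "f < N" for f
  proof -
    have "f \<in> set (x # ys)" using that set by simp
    then consider "f = x" | "f \<in> set ys" by auto
    then show ?thesis
    proof cases
      case 1
      then show ?thesis
        using position_eq[OF dist(1), of 0] position_eq[OF dist(2), of "length ys"] by (simp add: s_def N_def)
    next
      case 2
      then show ?thesis
        using position_append(2)[of "[x]" ys f] position_append(1)[of ys "[x]" f]
          position_nth[of ys f] position_eq[OF dist(2), of "position ys f"] dist
        by (simp add: s_def N_def nth_append)
    qed
  qed
  have \<psi>: "\<psi> f < N" if "f < N" for f using that by (simp add: \<psi>_def)
  have \<psi>': "\<psi> (N + t) = N + s t" "\<psi> (2 * N + t) = 2 * N + s t" if "t < N" for t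
    using that by (auto simp: \<psi>_def)
  have bij\<psi>: "bij_betw \<psi> {..<3 * N} {..<3 * N}"
  proof (rule bij_betw_imageI)
    show inj: "inj_on \<psi> {..<3 * N}"
    proof (rule inj_onI)
      fix f g assume "f \<in> {..<3 * N}" "g \<in> {..<3 * N}" and eq: "\<psi> f = \<psi> g"
      then have fg: "f < 3 * N" "g < 3 * N" by auto
      have injs: "t = u" if "s t = s u" "t < N" "u < N" for t u
        using bij that by (auto simp: bij_betw_def inj_on_def)
      show "f = g"
        using third_cases[OF fg(1)] third_cases[OF fg(2)] eq sN injs unfolding \<psi>_def
        by (elim disjE exE conjE) (auto, (metis add_lessD1 less_irrefl not_add_less1 trans_less_add1)+)
    qed
    show "\<psi> ` {..<3 * N} = {..<3 * N}"
    proof (rule endo_inj_surj[OF _ _ inj])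
      show "\<psi> ` {..<3 * N} \<subseteq> {..<3 * N}"
      proof (rule image_subsetI)
        fix f assume "f \<in> {..<3 * N}"
        then have "f < 3 * N" by simp
        moreover have "s (f - N) < N" "s (f - 2 * N) < N" by (rule sN)+
        ultimately show "\<psi> f \<in> {..<3 * N}" by (auto simp: \<psi>_def)
      qed
    qed simp
  qed
  have iso: "isomorphic ?F' ?F"
    unfolding isomorphic_def
  proof (rule exI[of _ s], rule exI[of _ \<psi>], intro conjI ballI)
    show "bij_betw s (verts ?F') (verts ?F)" "bij_betw \<psi> (flags ?F') (flags ?F)"
      using bij bij\<psi> unfolding necklace_simps N by simp_all
    show "marks ?F = map \<psi> (marks ?F')"
      using arrangement_length[OF arr] unfolding necklace_simps
      by (intro map_idI[symmetric]) (simp add: \<psi>_def N_def)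
    fix f assume "f \<in> flags ?F'"
    then have "f < 3 * N" by (simp add: N_def)
    from third_cases[OF this]
    have "base ?F (\<psi> f) = s (base ?F' f) \<and> opp ?F (\<psi> f) = \<psi> (opp ?F' f) \<and> dir ?F (\<psi> f) = dir ?F' f"
    proof (elim disjE exE conjE)
      assume f: "f < N"
      then show ?thesis using pos[OF f] unfolding necklace_simps N by (simp add: \<psi>_def)
    next
      fix t assume t: "t < N" "f = N + t"
      then have "\<psi> (N + t + N) = N + s t + N" 
      proof -
        have "N + t + N = 2 * N + t" "N + s t + N = 2 * N + s t" by simp_all
        then show ?thesis using \<psi>'(2)[OF t(1)] by metis
      qed
      then show ?thesis using t sN[of t] ed[OF t(1)] \<psi>'[OF t(1)] unfolding necklace_simps N by simp
    next
      fix t assume t: "t < N" "f = 2 * N + t"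
      then show ?thesis using sN[of t] ed[OF t(1)] \<psi>'[OF t(1)] unfolding necklace_simps N
        by (simp add: s_def[symmetric] mult_2)
    qed
    then show "base ?F (\<psi> f) = s (base ?F' f)" "opp ?F (\<psi> f) = \<psi> (opp ?F' f)" "dir ?F (\<psi> f) = dir ?F' f"
      by blast+
  next
    fix t assume "t \<in> verts ?F'"
    show "pos ?F (s t) = pos ?F' t" by (simp add: h'_def)
  next
    fix f assume "f \<in> bounded_flags ?F'"
    then obtain t where t: "t < N" "f = N + t \<or> f = 2 * N + t"
      unfolding necklace_bounded[OF arr' d c'] N by auto
    have "flag_edge ?F' f = {N + t, 2 * N + t}"
      using t necklace_flag_edge[OF arr' d c'] unfolding N by blast
    moreover have "flag_edge ?F (\<psi> f) = {N + s t, 2 * N + s t}"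
      using t \<psi>'[OF t(1)] sN[of t] necklace_flag_edge[OF arr d c] unfolding N by auto
    ultimately show "len ?F (flag_edge ?F (\<psi> f)) = len ?F' (flag_edge ?F' f)"
      unfolding necklace_simps N by (simp add: l'_def)
  qed
  have mk: "set (marks ?F') \<subseteq> unbounded_edges ?F'"
    unfolding necklace_unbounded[OF arr' d c'] using arrangement_length[OF arr'] by auto
  have "collapse ?F' (contract ?F)"
    by (rule isomorphic_collapse[OF iso necklace_finite[OF arr' d c'] necklace_finite[OF arr d c]
        collapse_contract[OF necklace_finite[OF arr d c] necklace_fits[OF arr d c]] mk])
  from collapse_isomorphic[OF necklace_finite[OF arr' d c'] this]
  have "linked n d (contract ?F') (contract ?F)"
    using linked_isomorphic contract_necklace[OF arr' d c'] by blast
  then show ?thesis unfolding deformable_def v'_def[symmetric] using arr arr' c c' linked_sym by blast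
qed

section \<open>Positive relations between vectors of the plane\<close>

text \<open>
  Cramer's identity \<open>det X Y *\<^sub>R A + det Y A *\<^sub>R X + det A X *\<^sub>R Y = 0\<close> is a relation of the desired kind as soon as its
  coefficients are nonnegative.  If \<open>A \<noteq> 0\<close> and the numbers \<open>det A X\<close> for \<open>X\<close> in \<open>B, C, D\<close> all vanish, these vectors are
  multiples of \<open>A\<close>, not all of them positive.  Otherwise, if \<open>b, c, d\<close> are positive, both signs occur among
  them, and the determinants of the cyclically consecutive pairs of \<open>B, C, D\<close> have the same
  sign, say nonnegative; then \<open>det A X\<close> changes from positive to nonpositive at one of these pairs.
\<close>

lemma plane_exchange:
  fixes A B C D :: "real \<times> real"
  assumes nn: "0 \<le> b" "0 \<le> c" "0 \<le> d" "0 < b + c + d" and rel: "b *\<^sub>R B + c *\<^sub>R C + d *\<^sub>R D = 0"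
  shows "\<exists>X\<in>{B, C, D}. \<exists>Y\<in>{B, C, D}. \<exists>\<alpha> \<beta> \<gamma>. 0 \<le> \<alpha> \<and> 0 \<le> \<beta> \<and> 0 \<le> \<gamma> \<and> 0 < \<alpha> + \<beta> + \<gamma> \<and>
    \<alpha> *\<^sub>R A + \<beta> *\<^sub>R X + \<gamma> *\<^sub>R Y = 0" (is "?P")
proof -
  define det where "det X Y = fst X * snd Y - snd X * fst Y" for X Y :: "real \<times> real"
  have wit: ?P if "X \<in> {B, C, D}" "Y \<in> {B, C, D}" "0 \<le> \<alpha>" "0 \<le> \<beta>" "0 \<le> \<gamma>" "0 < \<alpha> + \<beta> + \<gamma>"
    "\<alpha> *\<^sub>R A + \<beta> *\<^sub>R X + \<gamma> *\<^sub>R Y = 0" for X Y \<alpha> \<beta> \<gamma>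
    using that by blast
  have cramer: "det X Y *\<^sub>R A + det Y A *\<^sub>R X + det A X *\<^sub>R Y = 0" for X Y
    by (simp add: det_def prod_eq_iff algebra_simps)
  have use: ?P if "X \<in> {B, C, D}" "Y \<in> {B, C, D}" "0 \<le> det X Y" "0 \<le> det A X" "det A Y \<le> 0"
    "0 < det X Y \<or> 0 < det A X \<or> det A Y < 0" for X Y
  proof -
    have "det Y A = - det A Y" by (simp add: det_def)
    then show ?thesis using that by (intro wit[OF that(1,2,3) _ that(4) _ cramer]) auto
  qed
  have lin: "det U (x *\<^sub>R X + y *\<^sub>R Y + z *\<^sub>R Z) = x * det U X + y * det U Y + z * det U Z" for U x y z X Y Z
    by (simp add: det_def algebra_simps)
  have zero: "b * det U B + c * det U C + d * det U D = 0" for U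
    using lin[of U b B c C d D] rel by (simp add: det_def)
  consider "A = 0" | "A \<noteq> 0" "det A B = 0" "det A C = 0" "det A D = 0"
    | "det A B \<noteq> 0 \<or> det A C \<noteq> 0 \<or> det A D \<noteq> 0" by blast
  then show ?P
  proof cases
    case 1
    then show ?P by (intro wit[of B B 1 0 0]) auto
  next
    case 2
    have par: "\<exists>x. X = x *\<^sub>R A" if "det A X = 0" for X
    proof (cases "fst A = 0")
      case True
      then have "snd A \<noteq> 0" using 2(1) by (auto simp: prod_eq_iff)
      then show ?thesis using that True by (intro exI[of _ "snd X / snd A"]) (simp add: prod_eq_iff det_def)
    next
      case False
      then show ?thesis using that
        by (intro exI[of _ "fst X / fst A"]) (simp add: prod_eq_iff det_def field_simps)
    qed
    obtain x y z where xyz: "B = x *\<^sub>R A" "C = y *\<^sub>R A" "D = z *\<^sub>R A" using par 2(2-4) by metis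
    have "(b * x + c * y + d * z) *\<^sub>R A = 0" using rel by (simp add: xyz algebra_simps)
    then have s: "b * x + c * y + d * z = 0" using 2(1) by simp
    have "x \<le> 0 \<or> y \<le> 0 \<or> z \<le> 0"
    proof (rule ccontr)
      assume "\<not> (x \<le> 0 \<or> y \<le> 0 \<or> z \<le> 0)"
      then have p: "0 < x" "0 < y" "0 < z" by auto
      then have "0 \<le> b * x" "0 \<le> c * y" "0 \<le> d * z" using nn by auto
      moreover have "0 < b * x \<or> 0 < c * y \<or> 0 < d * z"
      proof -
        have "0 < b \<or> 0 < c \<or> 0 < d" using nn by linarith
        then show ?thesis using p by auto
      qed
      ultimately show False using s by linarith
    qed
    then show ?P
    proof (elim disjE)
      assume "x \<le> 0" then show ?P by (intro wit[of B B "- x" 1 0]) (auto simp: xyz)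
    next
      assume "y \<le> 0" then show ?P by (intro wit[of C C "- y" 1 0]) (auto simp: xyz)
    next
      assume "z \<le> 0" then show ?P by (intro wit[of D D "- z" 1 0]) (auto simp: xyz)
    qed
  next
    case 3
    show ?P
    proof (cases "b = 0 \<or> c = 0 \<or> d = 0")
      case True
      then show ?P
      proof (elim disjE)
        assume "b = 0" then show ?P using rel nn by (intro wit[of C D 0 c d]) auto
      next
        assume "c = 0" then show ?P using rel nn by (intro wit[of B D 0 b d]) auto
      next
        assume "d = 0" then show ?P using rel nn by (intro wit[of B C 0 b c]) auto
      qed
    next
      case False
      then have pos: "0 < b" "0 < c" "0 < d" using nn by auto
      have anti: "det X Y = - det Y X" "det X X = 0" for X Y by (simp_all add: det_def)
      \<comment> \<open>By the given relation, the three determinants are \<open>b\<close>, \<open>c\<close>, \<open>d\<close> times the same number.\<close>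
      define \<delta> where "\<delta> = det B C / d"
      have CD: "det C D = b * \<delta>"
        using zero[of C] anti(1)[of C B] anti(2)[of C] pos by (simp add: \<delta>_def field_simps)
      have DB: "det D B = c * \<delta>"
        using zero[of B] anti(1)[of D B] anti(2)[of B] pos by (simp add: \<delta>_def field_simps)
      have BC: "det B C = d * \<delta>" using pos by (simp add: \<delta>_def)
      have "\<exists>X\<in>{B, C, D}. 0 < det A X" "\<exists>X\<in>{B, C, D}. det A X < 0"
      proof -
        have s: "b * det A B + c * det A C + d * det A D = 0" by (rule zero)
        show "\<exists>X\<in>{B, C, D}. 0 < det A X"
        proof (rule ccontr)
          assume "\<not> ?thesis"
          then have le: "det A B \<le> 0" "det A C \<le> 0" "det A D \<le> 0" by auto
          then have "b * det A B \<le> 0" "c * det A C \<le> 0" "d * det A D \<le> 0" using pos by (auto simp: mult_le_0_iff)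
          then have "b * det A B = 0" "c * det A C = 0" "d * det A D = 0" using s by linarith+
          then show False using 3 pos by auto
        qed
        show "\<exists>X\<in>{B, C, D}. det A X < 0"
        proof (rule ccontr)
          assume "\<not> ?thesis"
          then have le: "det A B \<ge> 0" "det A C \<ge> 0" "det A D \<ge> 0" by auto
          then have "b * det A B \<ge> 0" "c * det A C \<ge> 0" "d * det A D \<ge> 0" using pos by auto
          then have "b * det A B = 0" "c * det A C = 0" "d * det A D = 0" using s by linarith+
          then show False using 3 pos by auto
        qed
      qed
      then have signs: "0 < det A B \<or> 0 < det A C \<or> 0 < det A D" "det A B < 0 \<or> det A C < 0 \<or> det A D < 0"
        by auto
      show ?P
      proof (cases "0 \<le> \<delta>")
        case True
        then have "0 \<le> det B C" "0 \<le> det C D" "0 \<le> det D B" using pos BC CD DB by auto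
        moreover have "0 < det A B \<and> det A C \<le> 0 \<or> 0 < det A C \<and> det A D \<le> 0 \<or> 0 < det A D \<and> det A B \<le> 0"
          using signs by linarith
        ultimately show ?P
          by (elim disjE) (rule use[of B C] use[of C D] use[of D B]; simp; fail)+
      next
        case False
        then have "0 \<le> det C B" "0 \<le> det D C" "0 \<le> det B D"
          using pos BC CD DB anti(1)[of C B] anti(1)[of D C] anti(1)[of B D] by (auto simp: mult_le_0_iff)
        moreover have "0 < det A C \<and> det A B \<le> 0 \<or> 0 < det A D \<and> det A C \<le> 0 \<or> 0 < det A B \<and> det A D \<le> 0"
          using signs by linarith
        ultimately show ?P
          by (elim disjE) (rule use[of C B] use[of D C] use[of B D]; simp; fail)+
      qed
    qed
  qed
qed

text \<open>
  Caratheodory's theorem reduces a relation to three vectors, and \<open>plane_exchange\<close> trades one of them for the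
  prescribed vector \<open>A\<close>.  The coefficient of \<open>A\<close> may be zero.
\<close>

lemma positive_relation_through:
  fixes p :: "'i \<Rightarrow> real \<times> real"
  assumes fin: "finite I" and nn: "\<And>i. i \<in> I \<Longrightarrow> 0 \<le> l i" and pos: "\<exists>i\<in>I. 0 < l i"
    and rel: "(\<Sum>i\<in>I. l i *\<^sub>R p i) = 0"
  shows "\<exists>i\<in>I. \<exists>j\<in>I. \<exists>\<alpha> \<beta> \<gamma>. 0 \<le> \<alpha> \<and> 0 \<le> \<beta> \<and> 0 \<le> \<gamma> \<and> 0 < \<alpha> + \<beta> + \<gamma> \<and>
    \<alpha> *\<^sub>R A + \<beta> *\<^sub>R p i + \<gamma> *\<^sub>R p j = 0"
proof -
  define s where "s = sum l I"
  have s: "0 < s" using fin nn pos by (auto simp: s_def intro: sum_pos2)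
  have "(\<Sum>i\<in>I. (l i / s) *\<^sub>R p i) \<in> convex hull (p ` I)"
  proof (rule convex_sum[OF fin convex_convex_hull])
    show "(\<Sum>i\<in>I. l i / s) = 1" using s by (simp add: s_def sum_divide_distrib[symmetric])
  qed (use nn s in \<open>auto intro: hull_inc\<close>)
  moreover have "(\<Sum>i\<in>I. (l i / s) *\<^sub>R p i) = (1 / s) *\<^sub>R (\<Sum>i\<in>I. l i *\<^sub>R p i)"
    by (simp add: scaleR_sum_right)
  ultimately have "0 \<in> convex hull (p ` I)" using rel by simp
  then obtain S where S: "finite S" "S \<subseteq> p ` I" "card S \<le> 3" "0 \<in> convex hull S"
    unfolding caratheodory[of "p ` I"] by auto
  have "S \<noteq> {}" using S(4) by auto
  then have "card S = 1 \<or> card S = 2 \<or> card S = 3" using S(1,3) card_0_eq[OF S(1)] by arith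
  then have "\<exists>B C D. S = {B, C, D}"
  proof (elim disjE)
    assume "card S = 1"
    then obtain B where "S = {B, B, B}" by (auto simp: card_1_singleton_iff)
    then show ?thesis by blast
  next
    assume "card S = 2"
    then obtain B C where "S = {B, C, C}" by (auto simp: card_2_iff)
    then show ?thesis by blast
  next
    assume "card S = 3"
    then show ?thesis unfolding card_3_iff by blast
  qed
  then obtain B C D where BCD: "S = {B, C, D}" by blast
  obtain b c d where bcd: "0 \<le> b" "0 \<le> c" "0 \<le> d" "b + c + d = 1" "b *\<^sub>R B + c *\<^sub>R C + d *\<^sub>R D = 0"
    using S(4) unfolding BCD convex_hull_3 by force
  have "0 < b + c + d" using bcd(4) by simp
  from plane_exchange[OF bcd(1-3) this bcd(5), of A] obtain X Y \<alpha> \<beta> \<gamma> where XY: "X \<in> S" "Y \<in> S"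
    "0 \<le> \<alpha>" "0 \<le> \<beta>" "0 \<le> \<gamma>" "0 < \<alpha> + \<beta> + \<gamma>" "\<alpha> *\<^sub>R A + \<beta> *\<^sub>R X + \<gamma> *\<^sub>R Y = 0"
    unfolding BCD[symmetric] by blast
  then obtain i j where "i \<in> I" "j \<in> I" "X = p i" "Y = p j" using S(2) by blast
  then show ?thesis using XY by blast
qed


section \<open>Moving an edge of the cycle to direction zero\<close>

lemma closes_imp_sum:
  assumes "closes n d xs v l h"
  shows "(\<Sum>t<length xs. l t *\<^sub>R real_vec (edge_dir (end_dirs n d) xs v t)) = 0"
proof -
  let ?N = "length xs"
  have "l t *\<^sub>R real_vec (edge_dir (end_dirs n d) xs v t) = h (Suc t mod ?N) - h (t mod ?N)" if "t < ?N" for t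
    using assms that by (simp add: closes_def)
  then have "(\<Sum>t<?N. l t *\<^sub>R real_vec (edge_dir (end_dirs n d) xs v t)) = (\<Sum>t<?N. h (Suc t mod ?N) - h (t mod ?N))"
    by simp
  also have "\<dots> = h (?N mod ?N) - h (0 mod ?N)" by (rule sum_lessThan_telescope)
  finally show ?thesis by simp
qed

lemma sum_imp_closes:
  assumes "\<And>t. t < length xs \<Longrightarrow> 0 \<le> l t" "\<exists>t<length xs. 0 < l t"
    and "(\<Sum>t<length xs. l t *\<^sub>R real_vec (edge_dir (end_dirs n d) xs v t)) = 0"
  shows "\<exists>h. closes n d xs v l h"
proof -
  define h where "h t = (\<Sum>s<t. l s *\<^sub>R real_vec (edge_dir (end_dirs n d) xs v s))" for t
  have "h (Suc t mod length xs) = h t + l t *\<^sub>R real_vec (edge_dir (end_dirs n d) xs v t)" if "t < length xs" for t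
  proof (cases "Suc t = length xs")
    case True
    have "h (Suc t) = 0" using assms(3) by (simp add: h_def True)
    moreover have "h (Suc t) = h t + l t *\<^sub>R real_vec (edge_dir (end_dirs n d) xs v t)" by (simp add: h_def)
    ultimately show ?thesis using True by (simp add: h_def[of 0])
  qed (use that in \<open>simp add: h_def\<close>)
  then show ?thesis using assms(1,2) by (auto simp: closes_def)
qed

definition total :: "nat \<Rightarrow> nat \<Rightarrow> nat list \<Rightarrow> int \<times> int" where
  "total n d xs = sum_list (map ((!) (end_dirs n d)) xs)"

lemma total_simps [simp]:
  "total n d [] = 0" "total n d (x # xs) = end_dirs n d ! x + total n d xs"
  "total n d (xs @ ys) = total n d xs + total n d ys"
  by (simp_all add: total_def)

lemma total_mset: "mset xs = mset ys \<Longrightarrow> total n d xs = total n d ys"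
  unfolding total_def by (metis mset_map sum_mset_sum_list)

lemma total_arrangement: "arrangement n d xs \<Longrightarrow> total n d xs = 0"
  unfolding total_def by (rule sum_list_arrangement)

text \<open>
  The point \<open>0\<close> is in the convex hull of three vertices of the lattice path of an arrangement
  \<open>ys @ us @ zs\<close>: the starting point \<open>v\<close>, the vertex reached after \<open>ys\<close>, and the vertex from which \<open>zs\<close> leads
  back to \<open>v\<close>.
\<close>

definition cut_relation :: "nat \<Rightarrow> nat \<Rightarrow> nat list \<Rightarrow> nat list \<Rightarrow> int \<times> int \<Rightarrow> bool" where
  "cut_relation n d ys zs v \<longleftrightarrow>
     (\<exists>\<alpha> \<beta> \<gamma>. 0 \<le> \<alpha> \<and> 0 \<le> \<beta> \<and> 0 \<le> \<gamma> \<and> 0 < \<alpha> + \<beta> + \<gamma> \<and>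
        \<alpha> *\<^sub>R real_vec v + \<beta> *\<^sub>R real_vec (v - total n d ys) +
        \<gamma> *\<^sub>R real_vec (v + total n d zs) = 0)"

lemma edge_dir_before:
  assumes arr: "arrangement n d (ys @ zs)" and d: "1 \<le> d"
  defines "N \<equiv> length (ys @ zs)"
  shows "edge_dir (end_dirs n d) (ys @ zs) v ((length ys + (N - 1)) mod N) = v - total n d ys"
proof (cases "ys = []")
  case True
  have "0 < N" using arrangement_length[OF arr] d by (simp add: N_def)
  then show ?thesis using True edge_dir_last[OF arr, of v] by (simp add: N_def)
next
  case False
  then have "length ys + (N - 1) = (length ys - 1) + N" "length ys - 1 < N"
    by (cases ys; simp add: N_def)+
  then have "(length ys + (N - 1)) mod N = length ys - 1" by (metis mod_add_self2 mod_less)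
  then show ?thesis using False by (simp add: edge_dir_def total_def)
qed

text \<open>
  The three coefficients of the relation are lengths for the necklace that are concentrated on
  the three edges at the cuts.  Hence all ends of \<open>ys1\<close> are at the same vertex.
\<close>

lemma cut_relation_reorder:
  assumes arr: "arrangement n d (ys1 @ ys2 @ ys3)" and d: "1 \<le> d"
    and cut: "cut_relation n d ys1 ys3 v" and m: "mset ys1' = mset ys1"
  shows "deformable n d (ys1 @ ys2 @ ys3) v (ys1' @ ys2 @ ys3) v"
proof -
  let ?xs = "ys1 @ ys2 @ ys3"
  define N where "N = length ?xs"
  have N: "0 < N" using arrangement_length[OF arr] d by (simp add: N_def)
  \<comment> \<open>Edge \<open>q k\<close> is the one before vertex \<open>k\<close>; for \<open>k = 0\<close> this is the last edge.\<close>
  define q where "q k = (k + (N - 1)) mod N" for k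
  have q: "q k < N" for k using N by (simp add: q_def)
  let ?e = "\<lambda>t. real_vec (edge_dir (end_dirs n d) ?xs v t)"
  obtain \<alpha> \<beta> \<gamma> where r: "0 \<le> \<alpha>" "0 \<le> \<beta>" "0 \<le> \<gamma>" "0 < \<alpha> + \<beta> + \<gamma>"
    "\<alpha> *\<^sub>R real_vec v + \<beta> *\<^sub>R real_vec (v - total n d ys1) + \<gamma> *\<^sub>R real_vec (v + total n d ys3) = 0"
    using cut by (auto simp: cut_relation_def)
  have tot: "v + total n d ys3 = v - total n d (ys1 @ ys2)"
  proof -
    have "total n d (ys1 @ ys2) + total n d ys3 = 0" using total_arrangement[OF arr] by (simp add: add.assoc)
    then show ?thesis by (simp add: algebra_simps add_eq_0_iff)
  qed
  have e: "?e (q 0) = real_vec v" "?e (q (length ys1)) = real_vec (v - total n d ys1)"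
    "?e (q (length (ys1 @ ys2))) = real_vec (v + total n d ys3)"
    using edge_dir_before[of n d "[]" ?xs v] edge_dir_before[of n d ys1 "ys2 @ ys3" v]
      edge_dir_before[of n d "ys1 @ ys2" ys3 v] arr d
    by (simp_all add: q_def N_def tot)
  define l where "l t = (if t = q 0 then \<alpha> else 0) + (if t = q (length ys1) then \<beta> else 0) +
    (if t = q (length (ys1 @ ys2)) then \<gamma> else 0)" for t
  have "\<exists>h. closes n d ?xs v l h"
  proof (rule sum_imp_closes)
    show "0 \<le> l t" for t using r by (simp add: l_def)
    have "0 < \<alpha> \<or> 0 < \<beta> \<or> 0 < \<gamma>" using r by linarith
    then have "0 < l (q 0) \<or> 0 < l (q (length ys1)) \<or> 0 < l (q (length (ys1 @ ys2)))"
      using r by (auto simp: l_def intro: add_pos_nonneg add_nonneg_pos)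
    then show "\<exists>t<length ?xs. 0 < l t" using q unfolding N_def by metis
    have "(\<Sum>t<N. l t *\<^sub>R ?e t) = \<alpha> *\<^sub>R ?e (q 0) + \<beta> *\<^sub>R ?e (q (length ys1)) + \<gamma> *\<^sub>R ?e (q (length (ys1 @ ys2)))"
    proof -
      have delta: "(\<Sum>t<N. (if t = q k then x else 0) *\<^sub>R ?e t) = x *\<^sub>R ?e (q k)" for k x
      proof -
        have "(\<Sum>t<N. (if t = q k then x else 0) *\<^sub>R ?e t) = (\<Sum>t<N. if t = q k then x *\<^sub>R ?e (q k) else 0)"
          by (rule sum.cong) auto
        then show ?thesis using q by simp
      qed
      show ?thesis unfolding l_def scaleR_add_left sum.distrib delta ..
    qed
    then show "(\<Sum>t<length ?xs. l t *\<^sub>R ?e t) = 0" using r(5) unfolding e N_def by simp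
  qed
  then obtain h where c: "closes n d ?xs v l h" by blast
  show ?thesis
  proof (rule reorder_block[OF _ d m])
    show "arrangement n d ?xs" by (rule arr)
    show "closes n d ?xs v l h" by (rule c)
    fix t assume t: "Suc t < length ys1"
    have qk: "q k = k - 1" if "0 < k" "k \<le> N" for k
    proof -
      have "k + (N - 1) = (k - 1) + N" "k - 1 < N" using that by auto
      then show ?thesis unfolding q_def by (metis mod_add_self2 mod_less)
    qed
    have "q 0 = N - 1" using N by (simp add: q_def)
    moreover have "q (length ys1) = length ys1 - 1" "q (length (ys1 @ ys2)) = length (ys1 @ ys2) - 1"
    proof -
      have "0 < length ys1" "0 < length (ys1 @ ys2)" "length ys1 \<le> N" "length (ys1 @ ys2) \<le> N"
        using t by (simp_all only: length_append N_def)
      then show "q (length ys1) = length ys1 - 1" "q (length (ys1 @ ys2)) = length (ys1 @ ys2) - 1"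
        by (blast intro: qk)+
    qed
    ultimately show "l t = 0" using t by (auto simp: l_def N_def)
  qed
qed

lemma deformable_closes:
  assumes "deformable n d xs v xs' v'"
  obtains l h where "arrangement n d xs'" "closes n d xs' v' l h"
  using assms by (auto simp: deformable_def)

lemma deformable_refl:
  assumes "arrangement n d xs" "1 \<le> d" "closes n d xs v l h"
  shows "deformable n d xs v xs v"
  unfolding deformable_def using assms necklace_lengths_linked by blast

lemma rotate_list:
  assumes "arrangement n d (ys @ zs)" "1 \<le> d" "closes n d (ys @ zs) v l h"
  shows "deformable n d (ys @ zs) v (zs @ ys) (v - total n d ys)"
  using assms
proof (induction ys arbitrary: zs v l h)
  case Nil
  then show ?case using deformable_refl by simp
next
  case (Cons y ys)
  have 1: "deformable n d (y # ys @ zs) v ((ys @ zs) @ [y]) (v - end_dirs n d ! y)"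
    using rotate_necklace[of n d y "ys @ zs"] Cons.prems by simp
  then obtain l' h' where "arrangement n d (ys @ (zs @ [y]))" "closes n d (ys @ (zs @ [y])) (v - end_dirs n d ! y) l' h'"
    by (rule deformable_closes) simp
  from Cons.IH[OF this(1) Cons.prems(2) this(2)] 1 show ?case
    using deformable_trans[OF Cons.prems(2)] by (fastforce simp: algebra_simps)
qed

text \<open>
  Moving the ends \<open>w\<close> of the first block to its front makes \<open>v - total n d w\<close> a vertex of the path, from which
  the path can then be read.
\<close>

lemma advance:
  assumes arr: "arrangement n d (ys1 @ ys2 @ ys3)" and d: "1 \<le> d"
    and cut: "cut_relation n d ys1 ys3 v" and m: "mset ys1 = mset (w @ zs)"
  shows "deformable n d (ys1 @ ys2 @ ys3) v (zs @ ys2 @ ys3 @ w) (v - total n d w)"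
proof -
  have 1: "deformable n d (ys1 @ ys2 @ ys3) v (w @ zs @ ys2 @ ys3) v"
    using cut_relation_reorder[OF arr d cut m[symmetric]] by simp
  then obtain l h where "arrangement n d (w @ (zs @ ys2 @ ys3))" "closes n d (w @ (zs @ ys2 @ ys3)) v l h"
    by (rule deformable_closes)
  from rotate_list[OF this(1) d this(2)] show ?thesis using deformable_trans[OF d 1] by simp
qed

text \<open>
  The mirror image of \<open>advance\<close>: the third block becomes the first one when the path is read from the
  starting point of this block, and its ends \<open>w\<close> are moved to its end, next to \<open>v\<close>.
\<close>

lemma retreat:
  assumes arr: "arrangement n d (ys1 @ ys2 @ ys3)" and d: "1 \<le> d" and c: "closes n d (ys1 @ ys2 @ ys3) v l h"
    and cut: "cut_relation n d ys1 ys3 v" and m: "mset ys3 = mset (zs @ w)"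
  shows "deformable n d (ys1 @ ys2 @ ys3) v (w @ ys1 @ ys2 @ zs) (v + total n d w)"
proof -
  let ?v = "v + total n d ys3"
  have tot: "total n d ys1 + total n d ys2 + total n d ys3 = 0"
    using total_arrangement[OF arr] by (simp only: total_simps add.assoc)
  then have v: "?v = v - total n d (ys1 @ ys2)" by (simp add: algebra_simps add_eq_0_iff)
  have 1: "deformable n d (ys1 @ ys2 @ ys3) v (ys3 @ ys1 @ ys2) ?v"
    using rotate_list[of n d "ys1 @ ys2" ys3 v] arr d c unfolding v by simp
  have arr': "arrangement n d (ys3 @ ys1 @ ys2)" using arr by (simp add: arrangement_mset ac_simps)
  have cut': "cut_relation n d ys3 ys2 ?v"
  proof -
    obtain \<alpha> \<beta> \<gamma> where r: "0 \<le> \<alpha>" "0 \<le> \<beta>" "0 \<le> \<gamma>" "0 < \<alpha> + \<beta> + \<gamma>"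
      "\<alpha> *\<^sub>R real_vec v + \<beta> *\<^sub>R real_vec (v - total n d ys1) + \<gamma> *\<^sub>R real_vec (v + total n d ys3) = 0"
      using cut by (auto simp: cut_relation_def)
    have "?v - total n d ys3 = v" by simp
    moreover have "?v + total n d ys2 = v - total n d ys1"
      using tot by (simp add: algebra_simps add_eq_0_iff)
    ultimately show ?thesis unfolding cut_relation_def
      using r by (intro exI[of _ \<gamma>] exI[of _ \<alpha>] exI[of _ \<beta>]) (simp only:, simp add: add_ac)
  qed
  have 2: "deformable n d (ys3 @ ys1 @ ys2) ?v (zs @ w @ ys1 @ ys2) ?v"
    using cut_relation_reorder[OF arr' d cut' m[symmetric]] by simp
  then obtain l' h' where "arrangement n d (zs @ (w @ ys1 @ ys2))" "closes n d (zs @ (w @ ys1 @ ys2)) ?v l' h'"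
    by (rule deformable_closes)
  from rotate_list[OF this(1) d this(2)]
  have 3: "deformable n d (zs @ w @ ys1 @ ys2) ?v (w @ ys1 @ ys2 @ zs) (v + total n d w)"
    using total_mset[OF m, of n d] by (simp add: algebra_simps)
  show ?thesis by (rule deformable_trans[OF d deformable_trans[OF d 1 2] 3])
qed

lemma obtain_cut:
  assumes arr: "arrangement n d xs" and c: "closes n d xs v l h"
  obtains ys1 ys2 ys3 where "xs = ys1 @ ys2 @ ys3" "cut_relation n d ys1 ys3 v"
proof -
  let ?p = "\<lambda>t. real_vec (edge_dir (end_dirs n d) xs v t)"
  have "\<exists>i\<in>{..<length xs}. \<exists>j\<in>{..<length xs}. \<exists>\<alpha> \<beta> \<gamma>. 0 \<le> \<alpha> \<and> 0 \<le> \<beta> \<and> 0 \<le> \<gamma> \<and> 0 < \<alpha> + \<beta> + \<gamma> \<and>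
    \<alpha> *\<^sub>R real_vec v + \<beta> *\<^sub>R ?p i + \<gamma> *\<^sub>R ?p j = 0"
    using positive_relation_through[of "{..<length xs}" l ?p "real_vec v"] c closes_imp_sum[OF c]
    by (auto simp: closes_def)
  then obtain i j \<alpha> \<beta> \<gamma> where r: "0 \<le> \<alpha>" "0 \<le> \<beta>" "0 \<le> \<gamma>" "0 < \<alpha> + \<beta> + \<gamma>"
    "\<alpha> *\<^sub>R real_vec v + \<beta> *\<^sub>R ?p i + \<gamma> *\<^sub>R ?p j = 0" by blast
  have "\<exists>i j \<alpha> \<beta> \<gamma>. i \<le> j \<and> 0 \<le> \<alpha> \<and> 0 \<le> \<beta> \<and> 0 \<le> \<gamma> \<and> 0 < \<alpha> + \<beta> + \<gamma> \<and>
    \<alpha> *\<^sub>R real_vec v + \<beta> *\<^sub>R ?p i + \<gamma> *\<^sub>R ?p j = 0"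
  proof (cases "i \<le> j")
    case True
    then show ?thesis using r by blast
  next
    case False
    moreover have "\<alpha> *\<^sub>R real_vec v + \<gamma> *\<^sub>R ?p j + \<beta> *\<^sub>R ?p i = 0" using r(5) by (simp add: add_ac)
    moreover have "0 < \<alpha> + \<gamma> + \<beta>" "j \<le> i" using r(4) False by auto
    ultimately show ?thesis using r(1-3) by blast
  qed
  then obtain i j \<alpha> \<beta> \<gamma> where r: "i \<le> j" "0 \<le> \<alpha>" "0 \<le> \<beta>" "0 \<le> \<gamma>" "0 < \<alpha> + \<beta> + \<gamma>"
    "\<alpha> *\<^sub>R real_vec v + \<beta> *\<^sub>R ?p i + \<gamma> *\<^sub>R ?p j = 0" by blast
  define ys1 where "ys1 = take (Suc i) xs"
  define ys2 where "ys2 = take (j - i) (drop (Suc i) xs)"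
  define ys3 where "ys3 = drop (Suc j) xs"
  have split: "take (Suc j) xs = ys1 @ ys2"
    using take_add[of "Suc i" "j - i" xs] r(1) by (simp add: ys1_def ys2_def)
  then have xs: "xs = ys1 @ ys2 @ ys3" using append_take_drop_id[of "Suc j" xs] by (simp add: ys3_def)
  have "total n d (take (Suc j) xs) + total n d ys3 = 0"
    using total_arrangement[OF arr] unfolding split by (simp add: xs add.assoc)
  then have "v + total n d ys3 = edge_dir (end_dirs n d) xs v j"
    by (simp add: edge_dir_def total_def[symmetric] algebra_simps add_eq_0_iff)
  moreover have "v - total n d ys1 = edge_dir (end_dirs n d) xs v i"
    by (simp add: edge_dir_def total_def ys1_def)
  ultimately have "cut_relation n d ys1 ys3 v" unfolding cut_relation_def using r by metis
  then show ?thesis using that xs by blast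
qed

definition end_vectors :: "(int \<times> int) set" where
  "end_vectors = {(1, 1), (-1, 0), (0, -1)}"

text \<open>
  The vectors of \<open>end_vectors\<close> and their negatives are the neighbours of \<open>0\<close> in a triangular lattice, cutting
  the plane into six sectors.  The number \<open>m\<close> is the distance of \<open>v\<close> from \<open>0\<close> in this lattice; the
  representation is kept because its sector determines which ends bring \<open>v\<close> closer to \<open>0\<close>.
\<close>

definition hex_distance :: "nat \<Rightarrow> int \<times> int \<Rightarrow> bool" where
  "hex_distance m v \<longleftrightarrow>
     (\<exists>e\<in>end_vectors. \<exists>f\<in>end_vectors. e \<noteq> f \<and>
        (\<exists>a b. a + b = m \<and> v = (int b * fst f - int a * fst e, int b * snd f - int a * snd e)))"

lemma hex_distance_exists: "\<exists>m. hex_distance m v"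
proof -
  obtain x y where v: "v = (x, y)" by (cases v)
  have intro: ?thesis if "e \<in> end_vectors" "f \<in> end_vectors" "e \<noteq> f" "0 \<le> a" "0 \<le> b"
    "x = b * fst f - a * fst e" "y = b * snd f - a * snd e" for e f and a b :: int
    unfolding hex_distance_def using that
    by (intro exI[of _ "nat a + nat b"] bexI[of _ e] bexI[of _ f] conjI exI[of _ "nat a"] exI[of _ "nat b"])
      (auto simp: v)
  consider "x \<le> y" "y \<le> 0" | "y \<le> x" "x \<le> 0" | "0 \<le> y" "y \<le> x" | "y \<le> 0" "0 \<le> x"
    | "0 \<le> x" "x \<le> y" | "x \<le> 0" "0 \<le> y" by linarith
  then show ?thesis
  proof cases
    case 1 then show ?thesis by (intro intro[of "(1, 1)" "(-1, 0)" "- y" "y - x"]) (auto simp: end_vectors_def)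
  next
    case 2 then show ?thesis by (intro intro[of "(1, 1)" "(0, -1)" "- x" "x - y"]) (auto simp: end_vectors_def)
  next
    case 3 then show ?thesis by (intro intro[of "(-1, 0)" "(1, 1)" "x - y" y]) (auto simp: end_vectors_def)
  next
    case 4 then show ?thesis by (intro intro[of "(-1, 0)" "(0, -1)" x "- y"]) (auto simp: end_vectors_def)
  next
    case 5 then show ?thesis by (intro intro[of "(0, -1)" "(1, 1)" "y - x" x]) (auto simp: end_vectors_def)
  next
    case 6 then show ?thesis by (intro intro[of "(0, -1)" "(-1, 0)" y "- x"]) (auto simp: end_vectors_def)
  qed
qed

lemma end_dirs_nth:
  assumes "x < n + 3 * d"
  shows "end_dirs n d ! x \<in> insert 0 end_vectors"
proof -
  have "end_dirs n d ! x \<in> set (end_dirs n d)" using assms by simp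
  then show ?thesis by (auto simp: end_dirs_def end_vectors_def)
qed

lemma end_vectors_functional:
  assumes "e \<in> end_vectors" "f \<in> end_vectors" "e \<noteq> f"
  shows "\<exists>p q :: int. \<forall>w\<in>insert 0 end_vectors.
    p * fst w + q * snd w = (if w = e then -1 else if w = f then 1 else 0)"
proof -
  have "\<exists>p\<in>{-1, 0, 1}. \<exists>q\<in>{-1, 0, 1}. \<forall>w\<in>insert 0 end_vectors.
    p * fst w + q * snd w = (if w = e then -1 else if w = f then 1 else (0 :: int))"
    using assms by (auto simp: end_vectors_def zero_prod_def)
  then show ?thesis by blast
qed

text \<open>
  The linear form with value \<open>-1\<close> at \<open>e\<close>, \<open>1\<close> at \<open>f\<close> and \<open>0\<close> at the third vector is \<open>a + b\<close> at \<open>v\<close>.  It does not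
  decrease when steps of \<open>ys\<close> are subtracted or steps of \<open>zs\<close> are added, so it is positive at all three vertices.
\<close>

lemma no_cut_relation:
  assumes ef: "e \<in> end_vectors" "f \<in> end_vectors" "e \<noteq> f"
    and v: "v = (int b * fst f - int a * fst e, int b * snd f - int a * snd e)" and ab: "0 < a + b"
    and ys: "set ys \<subseteq> {..<n + 3 * d}" "\<And>x. x \<in> set ys \<Longrightarrow> end_dirs n d ! x \<noteq> f"
    and zs: "set zs \<subseteq> {..<n + 3 * d}" "\<And>x. x \<in> set zs \<Longrightarrow> end_dirs n d ! x \<noteq> e"
  shows "\<not> cut_relation n d ys zs v"
proof
  assume "cut_relation n d ys zs v"
  then obtain \<alpha> \<beta> \<gamma> where r: "0 \<le> \<alpha>" "0 \<le> \<beta>" "0 \<le> \<gamma>" "0 < \<alpha> + \<beta> + \<gamma>"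
    "\<alpha> *\<^sub>R real_vec v + \<beta> *\<^sub>R real_vec (v - total n d ys) + \<gamma> *\<^sub>R real_vec (v + total n d zs) = 0"
    by (auto simp: cut_relation_def)
  obtain p q :: int where pq: "\<And>w. w \<in> insert 0 end_vectors \<Longrightarrow>
      p * fst w + q * snd w = (if w = e then -1 else if w = f then 1 else 0)"
    using end_vectors_functional[OF ef] by blast
  define g where "g u = p * fst u + q * snd u" for u :: "int \<times> int"
  define G where "G u = p * fst u + q * snd u" for u :: "real \<times> real"
  have g_add: "g (u + u') = g u + g u'" for u u' by (simp add: g_def algebra_simps)
  have g0: "g 0 = 0" by (simp add: g_def)
  have "g e = -1" "g f = 1" using pq[of e] pq[of f] ef by (auto simp: g_def)
  moreover have "g v = int b * g f - int a * g e" by (simp add: g_def v algebra_simps)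
  ultimately have gv: "0 < g v" using ab by simp linarith
  have gy: "g (total n d ys) \<le> 0" using ys
  proof (induction ys)
    case (Cons x ys)
    have "g (end_dirs n d ! x) \<le> 0" using pq[OF end_dirs_nth[of x n d]] Cons.prems by (auto simp: g_def)
    then show ?case using Cons by (simp add: g_add)
  qed (simp add: g0)
  have gz: "0 \<le> g (total n d zs)" using zs
  proof (induction zs)
    case (Cons x zs)
    have "0 \<le> g (end_dirs n d ! x)" using pq[OF end_dirs_nth[of x n d]] Cons.prems by (auto simp: g_def)
    then show ?case using Cons by (simp add: g_add)
  qed (simp add: g0)
  have G: "G (real_vec u) = real_of_int (g u)" for u by (cases u) (simp add: G_def g_def real_vec_def)
  have G0: "G 0 = 0" by (simp add: G_def)
  have lin: "G (x *\<^sub>R X + y *\<^sub>R Y + z *\<^sub>R Z) = x * G X + y * G Y + z * G Z" for x y z X Y Z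
    by (simp add: G_def algebra_simps)
  have "g (v - total n d ys) + g (total n d ys) = g v" using g_add[of "v - total n d ys" "total n d ys"] by simp
  then have gB: "0 < g (v - total n d ys)" using gv gy by linarith
  have gC: "0 < g (v + total n d zs)" using gv gz by (simp add: g_add)
  have "\<alpha> * g v + \<beta> * g (v - total n d ys) + \<gamma> * g (v + total n d zs) = 0"
    using lin[of \<alpha> "real_vec v" \<beta> "real_vec (v - total n d ys)" \<gamma> "real_vec (v + total n d zs)"] G0
    unfolding r(5) G by simp
  moreover have "0 \<le> \<alpha> * g v" "0 \<le> \<beta> * g (v - total n d ys)" "0 \<le> \<gamma> * g (v + total n d zs)"
    using r(1-3) gv gB gC by simp_all
  moreover have "0 < \<alpha> * g v \<or> 0 < \<beta> * g (v - total n d ys) \<or> 0 < \<gamma> * g (v + total n d zs)"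
  proof -
    have "0 < \<alpha> \<or> 0 < \<beta> \<or> 0 < \<gamma>" using r by linarith
    then show ?thesis using gv gB gC by auto
  qed
  ultimately show False by linarith
qed

lemma mset_extract:
  assumes "x \<in> set ys"
  shows "\<exists>zs. mset ys = mset (x # zs)"
  using assms by (intro exI[of _ "remove1 x ys"]) simp

lemma mset_extract2:
  assumes "x \<in> set ys" "y \<in> set ys" "x \<noteq> y"
  shows "\<exists>zs. mset ys = mset ([x, y] @ zs)"
proof -
  obtain us where us: "mset ys = mset (x # us)" using mset_extract[OF assms(1)] by blast
  then have "y \<in> set us" using mset_eq_setD[OF us] assms(2,3) by auto
  from mset_extract[OF this] obtain zs where "mset us = mset (y # zs)" by blast
  then show ?thesis using us by (intro exI[of _ zs]) simp
qed

lemma end_vectors_third: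
  assumes "e \<in> end_vectors" "f \<in> end_vectors" "e \<noteq> f"
  obtains g where "g \<in> end_vectors" "g \<noteq> e" "g \<noteq> f" "e + f + g = 0"
proof (rule that[of "- e - f"])
  show "- e - f \<in> end_vectors" "- e - f \<noteq> e" "- e - f \<noteq> f"
    using assms by (auto simp: end_vectors_def)
qed simp

text \<open>
  Induction on the distance between \<open>0\<close> and a vertex of the path.  At distance zero all the length can be put
  on one edge, and then the order of the ends is irrelevant.
\<close>

lemma reach_standard:
  assumes d: "1 \<le> d" and "hex_distance m v" and "arrangement n d xs" "closes n d xs v l h"
  shows "deformable n d xs v [0..<n + 3 * d] 0"
  using assms(2-)
proof (induction m arbitrary: xs v l h)
  case 0
  then have v: "v = 0" by (auto simp: hex_distance_def zero_prod_def)
  have "cut_relation n d xs [] 0"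
    unfolding cut_relation_def by (intro exI[of _ 1] exI[of _ 0]) simp
  moreover have "mset [0..<n + 3 * d] = mset xs" using 0 by (simp add: arrangement_mset)
  ultimately show ?case
    using cut_relation_reorder[of n d xs "[]" "[]" 0 "[0..<n + 3 * d]"] 0 d unfolding v by simp
next
  case (Suc m)
  note arr = Suc.prems(2) and c = Suc.prems(3)
  obtain ys1 ys2 ys3 where xs: "xs = ys1 @ ys2 @ ys3" and cut: "cut_relation n d ys1 ys3 v"
    using obtain_cut[OF arr c] .
  note arr' = arr[unfolded xs] and c' = c[unfolded xs]
  have sub: "set ys1 \<subseteq> {..<n + 3 * d}" "set ys3 \<subseteq> {..<n + 3 * d}"
    using arr' by (auto simp: arrangement_def)
  let ?D = "\<lambda>x. end_dirs n d ! x"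
  have fwd: ?case if "mset ys1 = mset (w @ zs)" "hex_distance m (v - total n d w)" for w zs
  proof -
    have 1: "deformable n d xs v (zs @ ys2 @ ys3 @ w) (v - total n d w)"
      unfolding xs by (rule advance[OF arr' d cut that(1)])
    then obtain l' h' where "arrangement n d (zs @ ys2 @ ys3 @ w)"
      "closes n d (zs @ ys2 @ ys3 @ w) (v - total n d w) l' h'" by (rule deformable_closes)
    from deformable_trans[OF d 1 Suc.IH[OF that(2) this]] show ?thesis .
  qed
  have bwd: ?case if "mset ys3 = mset (w @ zs)" "hex_distance m (v + total n d w)" for w zs
  proof -
    have "mset ys3 = mset (zs @ w)" using that(1) by simp
    then have 1: "deformable n d xs v (w @ ys1 @ ys2 @ zs) (v + total n d w)"
      unfolding xs by (rule retreat[OF arr' d c' cut])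
    then obtain l' h' where "arrangement n d (w @ ys1 @ ys2 @ zs)"
      "closes n d (w @ ys1 @ ys2 @ zs) (v + total n d w) l' h'" by (rule deformable_closes)
    from deformable_trans[OF d 1 Suc.IH[OF that(2) this]] show ?thesis .
  qed
  obtain e f a b where ef: "e \<in> end_vectors" "f \<in> end_vectors" "e \<noteq> f" "a + b = Suc m"
    "v = (int b * fst f - int a * fst e, int b * snd f - int a * snd e)"
    using Suc.prems(1) unfolding hex_distance_def by blast
  obtain g where g: "g \<in> end_vectors" "g \<noteq> e" "g \<noteq> f" "e + f + g = 0"
    using end_vectors_third[OF ef(1-3)] .
  have less_f: "hex_distance m (v - f)" if "0 < b"
    unfolding hex_distance_def
    using ef that by (intro bexI[of _ e] bexI[of _ f] conjI exI[of _ a] exI[of _ "b - 1"])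
      (auto simp: prod_eq_iff of_nat_diff algebra_simps)
  have less_e: "hex_distance m (v + e)" if "0 < a"
    unfolding hex_distance_def
    using ef that by (intro bexI[of _ e] bexI[of _ f] conjI exI[of _ "a - 1"] exI[of _ b])
      (auto simp: prod_eq_iff of_nat_diff algebra_simps)
  show ?case
  proof (cases "0 < b \<and> (\<exists>x\<in>set ys1. ?D x = f)")
    case True
    then obtain x where x: "x \<in> set ys1" "?D x = f" by blast
    from mset_extract[OF x(1)] obtain zs where "mset ys1 = mset ([x] @ zs)" by auto
    then show ?thesis using fwd[of "[x]" zs] less_f True x by simp
  next
    case no_f: False
    show ?thesis
    proof (cases "0 < a \<and> (\<exists>x\<in>set ys3. ?D x = e)")
      case True
      then obtain x where x: "x \<in> set ys3" "?D x = e" by blast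
      from mset_extract[OF x(1)] obtain zs where "mset ys3 = mset ([x] @ zs)" by auto
      then show ?thesis using bwd[of "[x]" zs] less_e True x by simp
    next
      case no_e: False
      \<comment> \<open>With \<open>a = 0\<close> or \<open>b = 0\<close> one of \<open>e\<close> and \<open>f\<close> may be replaced by the third vector.\<close>
      have contra: False if "e' \<in> end_vectors" "f' \<in> end_vectors" "e' \<noteq> f'"
        "v = (int b * fst f' - int a * fst e', int b * snd f' - int a * snd e')"
        "\<And>x. x \<in> set ys1 \<Longrightarrow> ?D x \<noteq> f'" "\<And>x. x \<in> set ys3 \<Longrightarrow> ?D x \<noteq> e'" for e' f'
        using no_cut_relation[OF that(1-4) _ sub(1) that(5) sub(2) that(6)] cut ef(4) by simp
      consider "0 < a" "0 < b" | "b = 0" | "a = 0" by blast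
      then show ?thesis
      proof cases
        case 1
        then show ?thesis using contra[OF ef(1-3,5)] no_e no_f by blast
      next
        case 2
        then have a: "0 < a" using ef(4) by simp
        have "\<exists>x\<in>set ys1. ?D x = f" using contra[OF ef(1-3,5)] no_e a by blast
        moreover have "\<exists>x\<in>set ys1. ?D x = g"
          using contra[of e g] ef g no_e a 2 by auto
        ultimately obtain x y where xy: "x \<in> set ys1" "?D x = f" "y \<in> set ys1" "?D y = g" by blast
        then have "x \<noteq> y" using g by auto
        from mset_extract2[OF xy(1,3) this] obtain zs where "mset ys1 = mset ([x, y] @ zs)" by blast
        then show ?thesis
        proof (rule fwd)
          have "v - total n d [x, y] = v + e"
        proof -
          have "f + g = - e" using g(4) by (metis add.assoc add.commute add_eq_0_iff)
          then show ?thesis using xy by simp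
        qed
          then show "hex_distance m (v - total n d [x, y])" using less_e[OF a] by (simp only:)
        qed
      next
        case 3
        then have b: "0 < b" using ef(4) by simp
        have "\<exists>x\<in>set ys3. ?D x = e" using contra[OF ef(1-3,5)] no_f b by blast
        moreover have "\<exists>x\<in>set ys3. ?D x = g"
          using contra[of g f] ef g no_f b 3 by auto
        ultimately obtain x y where xy: "x \<in> set ys3" "?D x = e" "y \<in> set ys3" "?D y = g" by blast
        then have "x \<noteq> y" using g by auto
        from mset_extract2[OF xy(1,3) this] obtain zs where "mset ys3 = mset ([x, y] @ zs)" by blast
        then show ?thesis
        proof (rule bwd)
          have "v + total n d [x, y] = v - f"
        proof -
          have "e + g = - f" using g(4) by (metis add.assoc add.commute add_eq_0_iff)
          then show ?thesis using xy by simp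
        qed
          then show "hex_distance m (v + total n d [x, y])" using less_f[OF b] by (simp only:)
        qed
      qed
    qed
  qed
qed

section \<open>A curve that is a cycle comes from a necklace\<close>

lemma list_with_image:
  assumes fin: "finite A" and m: "image_mset f (mset_set A) = mset ys"
  shows "\<exists>xs. distinct xs \<and> set xs = A \<and> map f xs = ys"
proof -
  obtain xs where xs: "distinct xs" "set xs = A" using finite_distinct_list[OF fin] by blast
  have "mset xs = mset_set A" using mset_set_set[OF xs(1)] xs(2) by simp
  then have "mset (map f xs) = mset ys" using m by simp
  from mset_eq_permutation[OF this[symmetric]] obtain p where
    p: "p permutes {..<length (map f xs)}" "permute_list p (map f xs) = ys" by blast
  then have p': "p permutes {..<length xs}" by simp
  show ?thesis
    using xs p p' by (intro exI[of _ "permute_list p xs"])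
      (simp add: permute_list_map[OF p'] set_permute_list distinct_permute_list)
qed

lemma enumerate_ends:
  assumes C: "C \<in> genus_one_curves n d"
  obtains es where "distinct es" "set es = unbounded_edges C" "map (dir C) es = end_dirs n d" "take n es = marks C"
proof -
  note C' = C[unfolded genus_one_curves_def planar_tropical_curve_def abstract_tropical_curve_def mem_Collect_eq]
  have fin: "finite (unbounded_edges C - set (marks C))"
    using C' by (auto simp: finite_graph_def unbounded_edges_def)
  have "image_mset (dir C) (mset_set (unbounded_edges C - set (marks C))) =
      mset (replicate d (1, 1) @ replicate d (-1, 0) @ replicate d (0, -1))"
    using C' by (simp add: has_degree_def)
  from list_with_image[OF fin this] obtain us where us: "distinct us" "set us = unbounded_edges C - set (marks C)"
    "map (dir C) us = replicate d (1, 1) @ replicate d (-1, 0) @ replicate d (0, -1)" by blast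
  have "map (dir C) (marks C) = replicate n 0"
    using C' by (intro replicate_eqI) auto
  then show ?thesis
    using C' us by (intro that[of "marks C @ us"]) (auto simp: end_dirs_def)
qed

text \<open>
  The ends are sorted by the position of their vertex in the traversal of the cycle, so each vertex
  corresponds to a block of consecutive ends.  The edge after the last end of a block gets the length of the edge
  of \<open>C\<close> leaving this vertex, the edges inside a block get length zero.
\<close>

lemma cycle_is_necklace:
  assumes C: "C \<in> genus_one_curves n d" and d: "1 \<le> d"
    and two: "\<And>v. v \<in> verts C \<Longrightarrow> card (bounded_at C v) = 2"
  shows "\<exists>xs v l h. arrangement n d xs \<and> closes n d xs v l h \<and> isomorphic (contract (necklace n d xs v l h)) C"
proof -
  note C' = C[unfolded genus_one_curves_def planar_tropical_curve_def abstract_tropical_curve_def mem_Collect_eq]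
  have fin: "finite_graph C" and con: "connected_graph C" and fits: "fits C (len C) (pos C)"
    using C' by auto
  have op: "opp C f \<in> bounded_flags C" "opp C (opp C f) = f" "opp C f \<noteq> f"
      "dir C (opp C f) = - dir C f" "f \<in> flags C" "0 < len C (flag_edge C f)"
    if "f \<in> bounded_flags C" for f
    using that C' by (auto simp: bounded_flags_def finite_graph_def bounded_edges_def)
  obtain K fs where K: "0 < K" and w_bij: "bij_betw (\<lambda>i. base C (fs i)) {..<K} (verts C)"
    and fs: "\<And>i. i < K \<Longrightarrow> fs i \<in> bounded_flags C"
    and nxt: "\<And>i. i < K \<Longrightarrow> base C (opp C (fs i)) = base C (fs (Suc i mod K))"
    and B: "bounded_flags C = fs ` {..<K} \<union> (\<lambda>i. opp C (fs i)) ` {..<K}"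
    and ne: "\<And>i j. i < K \<Longrightarrow> j < K \<Longrightarrow> fs i \<noteq> opp C (fs j)"
    using cycle_traversal[OF fin con two] by metis
  define w where "w i = base C (fs i)" for i
  have w_inj: "i = j" if "w i = w j" "i < K" "j < K" for i j
    using w_bij that by (auto simp: bij_betw_def inj_on_def w_def)
  have w_img: "w ` {..<K} = verts C" using w_bij by (auto simp: bij_betw_def w_def)
  have fs_inj: "inj_on fs {..<K}" using w_inj by (auto simp: inj_on_def w_def)
  obtain es where es: "distinct es" "set es = unbounded_edges C" "map (dir C) es = end_dirs n d" "take n es = marks C"
    using enumerate_ends[OF C] .
  define N where "N = n + 3 * d"
  have les: "length es = N" using arg_cong[OF es(3), of length] by (simp add: N_def)
  have N: "0 < N" using d by (simp add: N_def)
  have es_un: "es ! x \<in> unbounded_edges C" "es ! x \<in> flags C" "opp C (es ! x) = es ! x" if "x < N" for x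
    using nth_mem[of x es] that les es(2) by (auto simp: unbounded_edges_def)
  have es_dir: "dir C (es ! x) = end_dirs n d ! x" if "x < N" for x
    using that les es(3) by (metis nth_map)
  have es_base: "base C (es ! x) \<in> verts C" if "x < N" for x
    using es_un(2)[OF that] fin by (simp add: finite_graph_def)
  define blk where "blk x = inv_into {..<K} w (base C (es ! x))" for x
  have blk: "blk x < K" "w (blk x) = base C (es ! x)" if "x < N" for x
    using es_base[OF that] w_img by (auto simp: blk_def f_inv_into_f inv_into_into[of _ w "{..<K}", simplified])
  have blk_surj: "\<exists>x<N. blk x = i" if i: "i < K" for i
  proof -
    have v: "w i \<in> verts C" using i w_img by auto
    have "card (bounded_at C (w i)) < card (flags_at C (w i))"
      using two[OF v] C' v unfolding valence_def by fastforce
    moreover have "finite (bounded_at C (w i))" using two[OF v] by (metis card.infinite zero_neq_numeral)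
    ultimately have "\<not> flags_at C (w i) \<subseteq> bounded_at C (w i)" using card_mono not_less by metis
    then obtain f where f: "f \<in> flags C" "base C f = w i" "f \<in> unbounded_edges C"
      by (auto simp: flags_at_def bounded_at_def bounded_flags_def unbounded_edges_def)
    then obtain x where x: "x < N" "es ! x = f" using es(2) les by (metis in_set_conv_nth)
    then have "w (blk x) = w i" using blk(2) f(2) by simp
    then have "blk x = i" using w_inj blk(1)[OF x(1)] i by blast
    then show ?thesis using x by blast
  qed
  define xs where "xs = sort_key blk [0..<N]"
  have xs: "distinct xs" "set xs = {..<N}" "length xs = N" "sorted (map blk xs)"
    by (auto simp: xs_def)
  have arr: "arrangement n d xs" using xs by (simp add: arrangement_def N_def)
  define \<kappa> where "\<kappa> t = blk (xs ! t)" for t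
  have xs_less: "xs ! t < N" if "t < N" for t using nth_mem[of t xs] xs that by auto
  have \<kappa>_less: "\<kappa> t < K" if "t < N" for t using blk(1) xs_less that by (simp add: \<kappa>_def)
  have mono: "\<kappa> s \<le> \<kappa> t" if "s \<le> t" "t < N" for s t
    using sorted_nth_mono[OF xs(4), of s t] that xs(3) by (simp add: \<kappa>_def)
  have \<kappa>_surj: "\<exists>t<N. \<kappa> t = i" if i: "i < K" for i
  proof -
    obtain x where x: "x < N" "blk x = i" using blk_surj[OF i] by blast
    then have "x \<in> set xs" using xs by simp
    then obtain t where "t < N" "xs ! t = x" using xs(3) by (auto simp: in_set_conv_nth)
    with x show ?thesis by (auto simp: \<kappa>_def)
  qed
  have \<kappa>_0: "\<kappa> 0 = 0"
  proof -
    obtain t where "t < N" "\<kappa> t = 0" using \<kappa>_surj[OF K] by blast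
    then show ?thesis using mono[of 0 t] by simp
  qed
  have \<kappa>_N: "\<kappa> (N - 1) = K - 1"
  proof -
    obtain t where "t < N" "\<kappa> t = K - 1" using \<kappa>_surj[of "K - 1"] K by auto
    moreover from this have "t \<le> N - 1" by simp
    ultimately show ?thesis using mono[of t "N - 1"] \<kappa>_less[of "N - 1"] N by simp
  qed
  have \<kappa>_Suc: "\<kappa> (Suc t) \<le> Suc (\<kappa> t)" if "Suc t < N" for t
  proof (rule ccontr)
    assume "\<not> \<kappa> (Suc t) \<le> Suc (\<kappa> t)"
    then have less: "Suc (\<kappa> t) < \<kappa> (Suc t)" by simp
    then have "Suc (\<kappa> t) < K" using \<kappa>_less[OF that] by simp
    then obtain u where u: "u < N" "\<kappa> u = Suc (\<kappa> t)" using \<kappa>_surj by blast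
    show False
    proof (cases "u \<le> t")
      case True
      then show False using mono[of u t] u that by simp
    next
      case False
      then show False using mono[of "Suc t" u] u less by simp
    qed
  qed
  define final where "final t \<longleftrightarrow> t = N - 1 \<or> \<kappa> (Suc t) \<noteq> \<kappa> t" for t
  have final: "\<kappa> (Suc t mod N) = Suc (\<kappa> t) mod K" if "t < N" "final t" for t
  proof (cases "t = N - 1")
    case True
    then show ?thesis using \<kappa>_0 \<kappa>_N N K by simp
  next
    case False
    then have t: "Suc t < N" using that by simp
    then have "\<kappa> (Suc t) = Suc (\<kappa> t)"
      using \<kappa>_Suc[OF t] mono[of t "Suc t"] that False by (simp add: final_def)
    then show ?thesis using \<kappa>_less[OF t] t by simp
  qed
  have not_final: "Suc t < N" "\<kappa> (Suc t) = \<kappa> t" "\<kappa> (Suc t mod N) = \<kappa> t" if "t < N" "\<not> final t" for t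
  proof -
    show 1: "Suc t < N" "\<kappa> (Suc t) = \<kappa> t" using that by (auto simp: final_def)
    then show "\<kappa> (Suc t mod N) = \<kappa> t" by simp
  qed
  have final_le: "s \<le> t" if "s < N" "t < N" "final t" "\<kappa> s \<le> \<kappa> t" for s t
  proof (rule ccontr)
    assume "\<not> s \<le> t"
    then have "Suc t \<le> s" "t \<noteq> N - 1" using that by auto
    then have "\<kappa> (Suc t) \<noteq> \<kappa> t" using that by (simp add: final_def)
    moreover have "\<kappa> (Suc t) \<le> \<kappa> s" "\<kappa> t \<le> \<kappa> (Suc t)" using mono \<open>Suc t \<le> s\<close> that by auto
    ultimately show False using that by simp
  qed
  have final_bij: "bij_betw \<kappa> {t. t < N \<and> final t} {..<K}"
  proof (rule bij_betw_imageI)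
    show "inj_on \<kappa> {t. t < N \<and> final t}"
      by (rule inj_onI) (use final_le in \<open>simp add: eq_iff\<close>)
    show "\<kappa> ` {t. t < N \<and> final t} = {..<K}"
    proof
      show "\<kappa> ` {t. t < N \<and> final t} \<subseteq> {..<K}" using \<kappa>_less by auto
      show "{..<K} \<subseteq> \<kappa> ` {t. t < N \<and> final t}"
      proof
        fix i assume "i \<in> {..<K}"
        then obtain t0 where t0: "t0 < N" "\<kappa> t0 = i" using \<kappa>_surj by auto
        define T where "T = {t. t < N \<and> \<kappa> t = i}"
        have T: "finite T" "T \<noteq> {}" using t0 by (auto simp: T_def)
        have m: "Max T < N" "\<kappa> (Max T) = i" using Max_in[OF T] by (auto simp: T_def)
        have "final (Max T)"
        proof (rule ccontr)
          assume "\<not> final (Max T)"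
          from not_final[OF m(1) this] m have "Suc (Max T) \<in> T" by (simp add: T_def)
          then show False using Max_ge[OF T(1)] by fastforce
        qed
        then show "i \<in> \<kappa> ` {t. t < N \<and> final t}" using m by auto
      qed
    qed
  qed
  define l where "l t = (if final t then len C (flag_edge C (fs (\<kappa> t))) else 0)" for t
  have l0: "l t = 0 \<longleftrightarrow> \<not> final t" "0 \<le> l t" if "t < N" for t
    using op(6)[OF fs[OF \<kappa>_less[OF that]]] by (auto simp: l_def)
  define h where "h t = pos C (w (\<kappa> t))" for t
  define v where "v = dir C (fs (K - 1))"
  define Sg where "Sg i = (\<Sum>x\<in>{x. x < N \<and> blk x \<le> i}. end_dirs n d ! x)" for i
  \<comment> \<open>The balancing condition at vertex \<open>i\<close>, where \<open>j\<close> is the vertex before it.\<close>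
  have step: "dir C (fs i) = dir C (fs j) - (\<Sum>x\<in>{x. x < N \<and> blk x = i}. end_dirs n d ! x)"
    if ij: "i < K" "j < K" "Suc j mod K = i" for i j
  proof -
    have v: "w i \<in> verts C" using ij w_img by auto
    have b2: "bounded_at C (w i) = {fs i, opp C (fs j)}"
    proof (rule sym, rule card_subset_eq)
      show "finite (bounded_at C (w i))" using two[OF v] by (metis card.infinite zero_neq_numeral)
      show "{fs i, opp C (fs j)} \<subseteq> bounded_at C (w i)"
        using fs[OF ij(1)] op(1)[OF fs[OF ij(2)]] nxt[OF ij(2)] ij(3) by (auto simp: bounded_at_def w_def)
      show "card {fs i, opp C (fs j)} = card (bounded_at C (w i))"
        using two[OF v] ne[OF ij(1,2)] by simp
    qed
    have un: "flags_at C (w i) = bounded_at C (w i) \<union> (!) es ` {x. x < N \<and> blk x = i}"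
    proof (intro set_eqI iffI)
      fix f assume "f \<in> flags_at C (w i)"
      then have f: "f \<in> flags C" "base C f = w i" by (auto simp: flags_at_def)
      show "f \<in> bounded_at C (w i) \<union> (!) es ` {x. x < N \<and> blk x = i}"
      proof (cases "f \<in> unbounded_edges C")
        case True
        then obtain x where x: "x < N" "es ! x = f" using es(2) les by (metis in_set_conv_nth)
        then have "blk x = i" using w_inj[of "blk x" i] blk[OF x(1)] f ij(1) by simp
        then show ?thesis using x by auto
      qed (use f in \<open>auto simp: bounded_at_def bounded_flags_def unbounded_edges_def\<close>)
    next
      fix f assume "f \<in> bounded_at C (w i) \<union> (!) es ` {x. x < N \<and> blk x = i}"
      then show "f \<in> flags_at C (w i)"
        using es_un(2) blk(2) by (auto simp: flags_at_def bounded_at_def bounded_flags_def)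
    qed
    have "0 = (\<Sum>f\<in>flags_at C (w i). dir C f)" using C' v by simp
    also have "\<dots> = (\<Sum>f\<in>bounded_at C (w i). dir C f) + (\<Sum>f\<in>(!) es ` {x. x < N \<and> blk x = i}. dir C f)"
      unfolding un
    proof (rule sum.union_disjoint)
      show "bounded_at C (w i) \<inter> (!) es ` {x. x < N \<and> blk x = i} = {}"
        using es_un(3) by (auto simp: bounded_at_def bounded_flags_def)
    qed (simp_all add: b2)
    also have "(\<Sum>f\<in>bounded_at C (w i). dir C f) = dir C (fs i) - dir C (fs j)"
      unfolding b2 using ne[OF ij(1,2)] op(4)[OF fs[OF ij(2)]] by simp
    also have "(\<Sum>f\<in>(!) es ` {x. x < N \<and> blk x = i}. dir C f) = (\<Sum>x\<in>{x. x < N \<and> blk x = i}. end_dirs n d ! x)"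
      using es(1) les es_dir by (subst sum.reindex) (auto simp: inj_on_def nth_eq_iff_index_eq intro!: sum.cong)
    finally show ?thesis by (simp add: algebra_simps)
  qed
  have fs_dir: "dir C (fs i) = v - Sg i" if "i < K" for i
    using that
  proof (induction i)
    case 0
    have "Suc (K - 1) mod K = 0" using K by simp
    from step[OF 0 _ this] K show ?case by (simp add: v_def Sg_def)
  next
    case (Suc i)
    have un: "{x. x < N \<and> blk x \<le> Suc i} = {x. x < N \<and> blk x \<le> i} \<union> {x. x < N \<and> blk x = Suc i}" by auto
    have "Sg (Suc i) = Sg i + (\<Sum>x\<in>{x. x < N \<and> blk x = Suc i}. end_dirs n d ! x)"
      unfolding Sg_def un
    proof (rule sum.union_disjoint)
      show "{x. x < N \<and> blk x \<le> i} \<inter> {x. x < N \<and> blk x = Suc i} = {}" by auto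
    qed simp_all
    then show ?case using step[of "Suc i" i] Suc by (simp add: algebra_simps)
  qed
  have edge: "edge_dir (end_dirs n d) xs v t = dir C (fs (\<kappa> t))" if t: "t < N" "final t" for t
  proof -
    have "sum_list (map ((!) (end_dirs n d)) (take (Suc t) xs)) = sum ((!) (end_dirs n d)) (set (take (Suc t) xs))"
      using xs(1) by (intro sum_list_distinct_conv_sum_set distinct_take)
    also have "set (take (Suc t) xs) = {x. x < N \<and> blk x \<le> \<kappa> t}"
    proof (intro set_eqI iffI)
      fix x assume "x \<in> set (take (Suc t) xs)"
      then obtain s where "s \<le> t" "x = xs ! s" using t xs(3) by (auto simp: in_set_conv_nth less_Suc_eq_le)
      then show "x \<in> {x. x < N \<and> blk x \<le> \<kappa> t}" using xs_less mono[of s t] t by (auto simp: \<kappa>_def)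
    next
      fix x assume "x \<in> {x. x < N \<and> blk x \<le> \<kappa> t}"
      then have x: "x < N" "blk x \<le> \<kappa> t" by auto
      then obtain s where s: "s < N" "xs ! s = x" using xs by (metis in_set_conv_nth lessThan_iff)
      then have "s \<le> t" using final_le[OF s(1) t] x by (simp add: \<kappa>_def)
      then show "x \<in> set (take (Suc t) xs)" using s t xs(3) by (auto simp: in_set_conv_nth intro!: exI[of _ s])
    qed
    finally show ?thesis using fs_dir[OF \<kappa>_less[OF t(1)]] by (simp add: edge_dir_def Sg_def)
  qed
  have cls: "closes n d xs v l h"
    unfolding closes_def xs(3)
  proof (intro conjI allI impI)
    have last: "N - 1 < N" "final (N - 1)" using N by (simp_all add: final_def)
    then have "l (N - 1) \<noteq> 0" "0 \<le> l (N - 1)" using l0[OF last(1)] by blast+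
    then have "0 < l (N - 1)" by linarith
    then show "\<exists>t<N. 0 < l t" using last(1) by blast
    fix t assume t: "t < N"
    show "0 \<le> l t" by (rule l0[OF t])
    show "h (Suc t mod N) = h t + l t *\<^sub>R real_vec (edge_dir (end_dirs n d) xs v t)"
    proof (cases "final t")
      case True
      have k: "\<kappa> t < K" by (rule \<kappa>_less[OF t])
      have "pos C (base C (opp C (fs (\<kappa> t)))) = pos C (base C (fs (\<kappa> t))) + len C (flag_edge C (fs (\<kappa> t))) *\<^sub>R
          real_vec (dir C (fs (\<kappa> t)))"
        using fits fs[OF k] by (simp add: fits_def)
      then show ?thesis using True edge[OF t True] final[OF t True] nxt[OF k] by (simp add: h_def l_def w_def)
    next
      case False
      then show ?thesis using not_final[OF t False] by (simp add: h_def l_def)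
    qed
  qed
  let ?F = "necklace n d xs v l h"
  have F_fin: "finite_graph ?F" by (rule necklace_finite[OF arr d cls])
  define \<psi> where "\<psi> f = (if f < N then es ! f else if f < 2 * N then fs (\<kappa> (f - N)) else opp C (fs (\<kappa> (f - 2 * N))))" for f
  define La where "La = {t. t < N \<and> final t}"
  have \<psi>: "\<psi> x = es ! x" "\<psi> (N + x) = fs (\<kappa> x)" "\<psi> (2 * N + x) = opp C (fs (\<kappa> x))" "\<psi> (N + x + N) = opp C (fs (\<kappa> x))"
    if "x < N" for x
    using that by (auto simp: \<psi>_def mult_2)
  have ZF: "contracted_flags ?F = (\<lambda>t. N + t) ` {t. t < N \<and> \<not> final t} \<union> (\<lambda>t. 2 * N + t) ` {t. t < N \<and> \<not> final t}"
  proof -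
    have "{t. t < N \<and> l t = 0} = {t. t < N \<and> \<not> final t}" using l0(1) by auto
    then show ?thesis using necklace_contracted_flags[OF arr d cls] unfolding xs(3) by simp
  qed
  have rest: "flags ?F - contracted_flags ?F = {..<N} \<union> ((\<lambda>t. N + t) ` La \<union> (\<lambda>t. 2 * N + t) ` La)"
  proof (intro set_eqI iffI)
    fix f assume f: "f \<in> flags ?F - contracted_flags ?F"
    then have "f < 3 * N" by (simp add: xs(3))
    from third_cases[OF this] f show "f \<in> {..<N} \<union> ((\<lambda>t. N + t) ` La \<union> (\<lambda>t. 2 * N + t) ` La)"
      unfolding ZF La_def by blast
  qed (auto simp: ZF La_def xs(3))
  have bij_La: "bij_betw \<kappa> La {..<K}" using final_bij by (simp add: La_def)
  have bij1: "bij_betw \<psi> {..<N} (unbounded_edges C)"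
  proof -
    have "bij_betw ((!) es) {..<length es} (set es)" by (rule bij_betw_nth[OF es(1)]) auto
    then have "bij_betw ((!) es) {..<N} (unbounded_edges C)" using es(2) les by simp
    then show ?thesis by (rule iffD1[OF bij_betw_cong, rotated]) (simp add: \<psi>)
  qed
  have bij2: "bij_betw \<psi> ((\<lambda>t. N + t) ` La) (fs ` {..<K})"
  proof -
    have "bij_betw (fs \<circ> \<kappa>) La (fs ` {..<K})"
      by (rule bij_betw_trans[OF bij_La]) (use fs_inj in \<open>simp add: bij_betw_def\<close>)
    then have "bij_betw (\<psi> \<circ> (\<lambda>t. N + t)) La (fs ` {..<K})"
      by (rule iffD1[OF bij_betw_cong, rotated]) (simp add: \<psi> La_def)
    moreover have "bij_betw (\<lambda>t. N + t) La ((\<lambda>t. N + t) ` La)" by (simp add: bij_betw_def)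
    ultimately show ?thesis using bij_betw_comp_iff by blast
  qed
  have bij3: "bij_betw \<psi> ((\<lambda>t. 2 * N + t) ` La) ((\<lambda>i. opp C (fs i)) ` {..<K})"
  proof -
    have "inj_on (\<lambda>i. opp C (fs i)) {..<K}"
    proof (rule inj_onI)
      fix i j assume ij: "i \<in> {..<K}" "j \<in> {..<K}" "opp C (fs i) = opp C (fs j)"
      then have "i < K" "j < K" by simp_all
      then have "fs i = opp C (opp C (fs i))" "opp C (opp C (fs j)) = fs j" using op(2) fs by simp_all
      then have "fs i = fs j" unfolding ij(3) by (rule trans)
      then show "i = j" using fs_inj ij by (simp add: inj_on_def)
    qed
    then have "bij_betw ((\<lambda>i. opp C (fs i)) \<circ> \<kappa>) La ((\<lambda>i. opp C (fs i)) ` {..<K})"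
      by (intro bij_betw_trans[OF bij_La]) (simp add: bij_betw_def)
    then have "bij_betw (\<psi> \<circ> (\<lambda>t. 2 * N + t)) La ((\<lambda>i. opp C (fs i)) ` {..<K})"
      by (rule iffD1[OF bij_betw_cong, rotated]) (simp add: \<psi> La_def)
    moreover have "bij_betw (\<lambda>t. 2 * N + t) La ((\<lambda>t. 2 * N + t) ` La)" by (simp add: bij_betw_def)
    ultimately show ?thesis using bij_betw_comp_iff by blast
  qed
  have "bij_betw \<psi> ({..<N} \<union> ((\<lambda>t. N + t) ` La \<union> (\<lambda>t. 2 * N + t) ` La))
      (unbounded_edges C \<union> (fs ` {..<K} \<union> (\<lambda>i. opp C (fs i)) ` {..<K}))"
  proof (intro bij_betw_combine bij1 bij2 bij3)
    show "fs ` {..<K} \<inter> (\<lambda>i. opp C (fs i)) ` {..<K} = {}" using ne by auto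
    show "unbounded_edges C \<inter> (fs ` {..<K} \<union> (\<lambda>i. opp C (fs i)) ` {..<K}) = {}"
      unfolding B[symmetric] by (auto simp: unbounded_edges_def bounded_flags_def)
  qed
  moreover have "unbounded_edges C \<union> (fs ` {..<K} \<union> (\<lambda>i. opp C (fs i)) ` {..<K}) = flags C"
    unfolding B[symmetric] by (auto simp: unbounded_edges_def bounded_flags_def)
  ultimately have bij: "bij_betw \<psi> (flags ?F - contracted_flags ?F) (flags C)" by (simp only: rest)
  have merged: "merged_vertex ?F s = merged_vertex ?F t" if "s \<le> t" "t < N" "\<kappa> s = \<kappa> t" for s t
    using that
  proof (induction t)
    case (Suc t)
    show ?case
    proof (cases "s = Suc t")
      case False
      then have st: "s \<le> t" using Suc.prems by simp
      then have eq: "\<kappa> t = \<kappa> s" using mono[of s t] mono[of t "Suc t"] Suc.prems by simp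
      then have "\<not> final t" using Suc.prems by (auto simp: final_def)
      then have "l t = 0" by (simp add: l_def)
      then have "merged_vertex ?F (Suc t mod N) = merged_vertex ?F t"
        using necklace_merged_Suc[OF arr d cls, of t] Suc.prems by (simp add: xs(3))
      then show ?thesis using Suc.IH[OF st] Suc.prems eq by simp
    qed simp
  qed simp
  have connected: "\<kappa> s = \<kappa> t \<longleftrightarrow> (s, t) \<in> (contracted_rel ?F)\<^sup>*" if "s < N" "t < N" for s t
  proof
    assume eq: "\<kappa> s = \<kappa> t"
    have "merged_vertex ?F s = merged_vertex ?F t"
    proof (cases "s \<le> t")
      case True
      from merged[OF this that(2) eq] show ?thesis .
    next
      case False
      then have "t \<le> s" by simp
      from merged[OF this that(1) eq[symmetric]] show ?thesis by (rule sym)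
    qed
    then show "(s, t) \<in> (contracted_rel ?F)\<^sup>*" by (simp only: merged_vertex_eq_iff[OF F_fin])
  next
    assume "(s, t) \<in> (contracted_rel ?F)\<^sup>*"
    then show "\<kappa> s = \<kappa> t"
    proof induction
      case (step y z)
      then obtain t where "t < N" "l t = 0" "(y, z) = (t, Suc t mod N) \<or> (y, z) = (Suc t mod N, t)"
        using necklace_contracted_rel[OF arr d cls] by (auto simp: xs(3))
      moreover then have "\<kappa> (Suc t mod N) = \<kappa> t" using l0(1) not_final(3) by blast
      ultimately show ?case using step.IH by auto
    qed simp
  qed
  have "collapse ?F C"
    unfolding collapse_def
  proof (rule exI[of _ "w \<circ> \<kappa>"], rule exI[of _ \<psi>], intro conjI ballI)
    have "\<kappa> ` {..<N} = {..<K}" using \<kappa>_less \<kappa>_surj by (auto simp: image_iff)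
    then show "(w \<circ> \<kappa>) ` verts ?F = verts C" using w_img unfolding necklace_simps xs(3) by (simp only: image_comp[symmetric])
    show "((w \<circ> \<kappa>) s = (w \<circ> \<kappa>) t) = ((s, t) \<in> (contracted_rel ?F)\<^sup>*)" if "s \<in> verts ?F" "t \<in> verts ?F" for s t
      using connected[of s t] that w_inj[of "\<kappa> s" "\<kappa> t"] \<kappa>_less by (auto simp: xs(3))
    show "bij_betw \<psi> (flags ?F - contracted_flags ?F) (flags C)" by (rule bij)
    have "[0..<n] = take n [0..<N]" by (simp add: N_def)
    then have "map \<psi> [0..<n] = take n (map \<psi> [0..<N])" by (simp add: take_map)
    also have "map \<psi> [0..<N] = map ((!) es) [0..<N]" by (simp add: \<psi>)
    also have "\<dots> = es" using map_nth[of es] les by simp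
    finally show "marks C = map \<psi> (marks ?F)" using es(4) by simp
    fix f assume "f \<in> flags ?F - contracted_flags ?F"
    then have "f \<in> {..<N} \<union> ((\<lambda>t. N + t) ` La \<union> (\<lambda>t. 2 * N + t) ` La)" by (simp only: rest)
    then have "base C (\<psi> f) = w (\<kappa> (base ?F f)) \<and> opp C (\<psi> f) = \<psi> (opp ?F f) \<and> dir C (\<psi> f) = dir ?F f"
    proof (elim UnE imageE)
      assume "f \<in> {..<N}"
      then have f: "f < N" by simp
      have "w (\<kappa> (position xs f)) = base C (es ! f)"
        using position_nth(2)[of xs f] xs f blk(2)[OF f] by (simp add: \<kappa>_def)
      then show ?thesis using f \<psi>[OF f] es_un[OF f] es_dir[OF f] unfolding necklace_simps xs(3) by simp
    next
      fix t assume "f = N + t" "t \<in> La"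
      then have t: "t < N" "final t" "f = N + t" by (auto simp: La_def)
      show ?thesis using t \<psi>[OF t(1)] edge[OF t(1,2)] unfolding necklace_simps xs(3) by (simp add: w_def)
    next
      fix t assume "f = 2 * N + t" "t \<in> La"
      then have t: "t < N" "final t" "f = 2 * N + t" by (auto simp: La_def)
      have b: "fs (\<kappa> t) \<in> bounded_flags C" by (rule fs[OF \<kappa>_less[OF t(1)]])
      have "2 * N + t - N = N + t" by simp
      then show ?thesis
        using t \<psi>[OF t(1)] edge[OF t(1,2)] op(2,4)[OF b] nxt[OF \<kappa>_less[OF t(1)]] final[OF t(1,2)]
        unfolding necklace_simps xs(3) by (simp add: w_def)
    qed
    then show "base C (\<psi> f) = (w \<circ> \<kappa>) (base ?F f)" "opp C (\<psi> f) = \<psi> (opp ?F f)" "dir C (\<psi> f) = dir ?F f"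
      by (simp_all only: o_apply)
  next
    show "pos C ((w \<circ> \<kappa>) t) = pos ?F t" if "t \<in> verts ?F" for t by (simp add: h_def)
  next
    fix f assume f: "f \<in> bounded_flags ?F - contracted_flags ?F"
    then have "f \<in> flags ?F - contracted_flags ?F" "opp ?F f \<noteq> f" by (auto simp: bounded_flags_def)
    then have "f \<in> {..<N} \<union> ((\<lambda>t. N + t) ` La \<union> (\<lambda>t. 2 * N + t) ` La)" "\<not> f < N"
      unfolding rest by (auto simp: xs(3))
    then obtain t where t: "t < N" "final t" "f = N + t \<or> f = 2 * N + t" by (auto simp: La_def)
    have "flag_edge ?F f = {N + t, 2 * N + t}"
      using t necklace_flag_edge[OF arr d cls] unfolding xs(3) by blast
    then have "len ?F (flag_edge ?F f) = len C (flag_edge C (fs (\<kappa> t)))"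
      using t unfolding necklace_simps xs(3) by (simp add: l_def)
    moreover have "flag_edge C (\<psi> f) = flag_edge C (fs (\<kappa> t))"
      using t(3) \<psi>[OF t(1)] op(2)[OF fs[OF \<kappa>_less[OF t(1)]]] by (auto simp: flag_edge_def)
    ultimately show "len C (flag_edge C (\<psi> f)) = len ?F (flag_edge ?F f)" by simp
  qed
  from collapse_isomorphic[OF F_fin this] show ?thesis using arr cls by blast
qed


section \<open>Connectedness\<close>

lemma linked_to_standard:
  assumes C: "C \<in> genus_one_curves n d" and d: "1 \<le> d"
  shows "\<exists>l h. closes n d [0..<n + 3 * d] 0 l h \<and> linked n d C (contract (necklace n d [0..<n + 3 * d] 0 l h))"
proof -
  obtain D where D: "linked n d C D" "\<And>v. v \<in> verts D \<Longrightarrow> card (bounded_at D v) = 2"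
    using linked_to_cycle[OF C] by blast
  then have "D \<in> genus_one_curves n d" by (simp add: linked_def)
  from cycle_is_necklace[OF this d D(2)] obtain xs v l h where
    N: "arrangement n d xs" "closes n d xs v l h" "isomorphic (contract (necklace n d xs v l h)) D" by blast
  have 1: "linked n d D (contract (necklace n d xs v l h))"
    using linked_sym[OF linked_isomorphic[OF contract_necklace[OF N(1) d N(2)] N(3)]] .
  obtain m where "hex_distance m v" using hex_distance_exists by blast
  from reach_standard[OF d this N(1,2)] obtain l1 h1 l2 h2 where
    2: "closes n d xs v l1 h1" "closes n d [0..<n + 3 * d] 0 l2 h2"
    "linked n d (contract (necklace n d xs v l1 h1)) (contract (necklace n d [0..<n + 3 * d] 0 l2 h2))"
    by (auto simp: deformable_def)
  have "linked n d (contract (necklace n d xs v l h)) (contract (necklace n d xs v l1 h1))"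
    by (rule necklace_lengths_linked[OF N(1) d N(2) 2(1)])
  then have "linked n d C (contract (necklace n d [0..<n + 3 * d] 0 l2 h2))"
    using D(1) 1 2(3) linked_trans by blast
  then show ?thesis using 2(2) by blast
qed

theorem theorem5p3:
  fixes d n :: nat
  assumes "d \<ge> 1"
  shows "connected_space (moduli_space n d)"
proof -
  have arr: "arrangement n d [0..<n + 3 * d]" by (simp add: arrangement_mset)
  have "connected_component_of (moduli_space n d) X Y" if XY: "X \<in> moduli_set n d" "Y \<in> moduli_set n d" for X Y
  proof -
    obtain C D where CD: "C \<in> genus_one_curves n d" "D \<in> genus_one_curves n d"
      "X = iso_rel n d `` {C}" "Y = iso_rel n d `` {D}"
      using XY by (auto simp: moduli_set_def elim!: quotientE)
    obtain l h where 1: "closes n d [0..<n + 3 * d] 0 l h"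
      "linked n d C (contract (necklace n d [0..<n + 3 * d] 0 l h))"
      using linked_to_standard[OF CD(1) assms] by blast
    obtain l' h' where 2: "closes n d [0..<n + 3 * d] 0 l' h'"
      "linked n d D (contract (necklace n d [0..<n + 3 * d] 0 l' h'))"
      using linked_to_standard[OF CD(2) assms] by blast
    have "linked n d C D"
      using 1(2) necklace_lengths_linked[OF arr assms 1(1) 2(1)] linked_sym[OF 2(2)] linked_trans by blast
    then show ?thesis by (simp add: linked_def CD)
  qed
  then show ?thesis
    unfolding connected_space_iff_connected_component topspace_moduli_space by blast
qed

end
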